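(* Let $n\ge 1$ and let $T$ be a triangulated $(n+3)$-gon with diagonals labelled $1,\dots,n$ and boundary sides labelled $n+1,\dots,2n+3$, such that the quiver $Q=Q_T$ is acyclic with underlying graph the path $1 - 2 - \cdots - n$. Let $\mathcal{A}(\overline{Q})$ be the cluster algebra with coefficients of the ice quiver $\overline{Q}=\overline{Q}_T$, with initial seed $((x_1,\dots,x_{2n+3}),\overline{Q})$. For $1\le i\le j\le n$ let $f^{[i,j]}\in\mathbb{Z}[x_1,\dots,x_{2n+3}]$ be the numerator of the cluster variable $\frac{f^{[i,j]}}{x_ix_{i+1}\cdots x_j}$ of $\mathcal{A}(\overline{Q})$. Then for all $1\le i\le j\le n$, $$f^{[i,j]}=\sum_{C\in\mathbb{C}(\widetilde{Q}^{[i,j]},\widetilde{W}^{[i,j]})}\ \prod_{\alpha\in C}x_\alpha,$$ where $\mathbb{C}(\widetilde{Q}^{[i,j]},\widetilde{W}^{[i,j]})$ is the set of all minimal cuts of the quiver with potential $(\widetilde{Q}^{[i,j]},\widetilde{W}^{[i,j]})$ obtained from $T^{[i,j]}$, and $x_\alpha$ is the element of $\{x_1,\dots,x_{2n+3}\}$ indexed by the third side of the triangle of $T$ having sides $s(\alpha)$ and $t(\alpha)$.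
   Context: Quivers from triangulations. Let $T$ be a triangulated (convex, planar) $(n+3)$-gon, with $n$ diagonals $1,\dots,n$ and boundary sides (boundary arcs) $n+1,\dots,2n+3$. The quiver $Q_T$ has vertices $1,\dots,n$ and an arrow $i\to j$ whenever the diagonals $i,j$ are sides of a common triangle of $T$ and $j$ follows $i$ in the clockwise order on the boundary of that triangle. The ice quiver $\overline{Q}_T$ is obtained from $Q_T$ by adding a vertex for each boundary arc and adding, by the same rule, the arrows between diagonals and boundary arcs lying in a common triangle (no arrows between two boundary arcs). The frozen vertices are the boundary arcs. For an arrow $\alpha$, $s(\alpha)$ and $t(\alpha)$ are its source and target. Cluster algebra. A seed is a pair $(x,R)$ where $R$ is a quiver on $\{1,\dots,m\}$ without loops and $2$-cycles, with no arrows between the frozen vertices $n+1,\dots,m$, and $x=(x_1,\dots,x_m)$ is a free generating set of the field $\mathbb{Q}(t_1,\dots,t_m)$ over $\mathbb{Q}$. Mutation at $k\in\{1,\dots,n\}$ gives $(x',R')$: $R'$ is obtained by adding an arrow $i\to j$ for each path $i\to k\to j$, reversing all arrows at $k$, removing a maximal set of disjoint $2$-cycles, and removing all arrows between frozen vertices; $x'_i=x_i$ for $i\ne k$ and $x_kx'_k=\prod_{(j\to k)\in R_1}x_j+\prod_{(k\to j)\in R_1}x_j$. The cluster variables are the elements $x_1,\dots,x_n$ of all seeds obtained from the initial seed by sequences of mutations; the coefficients are $x_{n+1},\dots,x_m$. $\mathcal{A}$ is the $\mathbb{Z}$-subalgebra generated by all cluster variables and coefficients. Here $m=2n+3$. Known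 fact used as definition of $f^{[i,j]}$: the non-initial cluster variables of $\mathcal{A}(\overline{Q})$ are indexed by pairs $1\le i\le j\le n$, the pair $(i,j)$ corresponding to the unique cluster variable of the form $f^{[i,j]}/(x_ix_{i+1}\cdots x_j)$ with $f^{[i,j]}\in\mathbb{Z}[x_1,\dots,x_{2n+3}]$ not divisible by any of $x_1,\dots,x_n$. Subpolygon. $T^{[i,j]}$ is the triangulated subpolygon of $T$ whose set of diagonals is $\{i,i+1,\dots,j\}$, i.e. the union of the triangles of $T$ having at least one side in $\{i,\dots,j\}$; its sides keep their labels from $T$. The quiver with potential of a triangulated polygon. For a triangulated polygon $S$ with $d$ diagonals (here $S=T^{[i,j]}$, $d=j-i+1$), let $\widetilde{Q}$ have the same vertices as $\overline{Q}_S$ and arrow set $(\overline{Q}_S)_1\sqcup I\sqcup E$, where: $I$ consists of an arrow $a\to b$ for boundary arcs $a,b$ of $S$ lying in a common triangle of $S$ with $b$ following $a$ in clockwise order in this triangle, i.e. sharing the polygon vertex between them with $a\to b$ clockwise around the triangle at that vertex; $E$ (external arrows) consists of an arrow $a\to b$ for boundary arcs $a,b$ of $S$ not in a common triangle of $S$ such that $a$ is the immediate predecessor of $b$ in the anticlockwise order of the boundary of $S$. A triangle cycle is a cycle of length $3$ inside a triangle of $S$, made of arrows of $(\overline{Q}_S)_1\sqcup I$ (for a triangle with two boundary sides the cycle uses its arrow in $I$). A big cycle is a cycle winding around a vertex $v$ of $S$ and containing precisely one external arrow: for each vertex $v$ incident to at least one diagonal of $S$, it consists of the arrows of $\overline{Q}_S$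 between consecutive arcs at $v$, together with the external arrow between the two boundary arcs at $v$. Put $\widetilde{W}=\sum(\text{triangle cycles})-\sum(\text{big cycles})$. For $S=T^{[i,j]}$ the result is denoted $(\widetilde{Q}^{[i,j]},\widetilde{W}^{[i,j]})$. Cuts. A cut of $(\widetilde{Q},\widetilde{W})$ is a set $C$ of arrows of $\widetilde{Q}$ such that every cyclic path appearing in $\widetilde{W}$ contains precisely one arrow in $C$. A cut $C$ is minimal if $|C|=d+1$, where $d$ is the number of diagonals (so $|C|=j-i+2$ for $T^{[i,j]}$). *)

theory Defs
  imports Complex_Main "HOL-Library.Poly_Mapping"
begin

section \<open>Triangulated polygons\<close>

text \<open>
  The vertices of a convex polygon are finitely many natural numbers, listed in increasing order
  as one walks clockwise along the boundary. A segment between two vertices is the set of its two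
  endpoints. The arcs (diagonals and boundary sides) of a triangulated polygon carry labels
  in \<^typ>\<open>nat\<close>.
\<close>

record labelled_polygon =
  verts :: "nat set"
  diags :: "nat set"
  sides :: "nat set"
  ends :: "nat \<Rightarrow> nat set"

definition clockwise :: "nat \<Rightarrow> nat \<Rightarrow> nat \<Rightarrow> bool" where
  "clockwise p q r \<longleftrightarrow> p < q \<and> q < r \<or> q < r \<and> r < p \<or> r < p \<and> p < q"

definition cw_next :: "nat set \<Rightarrow> nat \<Rightarrow> nat \<Rightarrow> bool" where
  "cw_next V u v \<longleftrightarrow> u \<in> V \<and> v \<in> V \<and> u \<noteq> v \<and> \<not> (\<exists>w\<in>V. clockwise u w v)"

definition boundary_segments :: "nat set \<Rightarrow> nat set set" where
  "boundary_segments V = {{u, v} | u v. cw_next V u v}"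

definition diagonal_segments :: "nat set \<Rightarrow> nat set set" where
  "diagonal_segments V = {{u, v} | u v. u \<in> V \<and> v \<in> V \<and> u \<noteq> v} - boundary_segments V"

definition crossing :: "nat set \<Rightarrow> nat set \<Rightarrow> bool" where
  "crossing e f \<longleftrightarrow> (\<exists>p q r s. e = {p, r} \<and> f = {q, s} \<and> clockwise p q r \<and> clockwise r s p)"

definition triangulated_polygon :: "labelled_polygon \<Rightarrow> bool" where
  "triangulated_polygon S \<longleftrightarrow>
     finite (verts S) \<and> card (verts S) \<ge> 3 \<and>
     diags S \<inter> sides S = {} \<and>
     bij_betw (ends S) (sides S) (boundary_segments (verts S)) \<and>
     inj_on (ends S) (diags S) \<and>
     ends S ` diags S \<subseteq> diagonal_segments (verts S) \<and>
     (\<forall>e\<in>ends S ` diags S. \<forall>f\<in>ends S ` diags S. \<not> crossing e f) \<and>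
     (\<forall>e\<in>diagonal_segments (verts S).
        (\<forall>f\<in>ends S ` diags S. \<not> crossing e f) \<longrightarrow> e \<in> ends S ` diags S)"

definition arcs :: "labelled_polygon \<Rightarrow> nat set" where
  "arcs S = diags S \<union> sides S"

text \<open>
  The arcs \<open>a\<close>, \<open>b\<close>, \<open>c\<close> are, in this clockwise order, the sides of a triangle. No diagonal can
  enter a triangle bounded by three arcs, so any three such arcs bound a triangle of the
  triangulation.
\<close>

definition cw_triangle :: "labelled_polygon \<Rightarrow> nat \<Rightarrow> nat \<Rightarrow> nat \<Rightarrow> bool" where
  "cw_triangle S a b c \<longleftrightarrow> a \<in> arcs S \<and> b \<in> arcs S \<and> c \<in> arcs S \<and>
     (\<exists>p q r. clockwise p q r \<and> ends S a = {p, q} \<and> ends S b = {q, r} \<and> ends S c = {r, p})"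

definition follows_in_triangle :: "labelled_polygon \<Rightarrow> nat \<Rightarrow> nat \<Rightarrow> bool" where
  "follows_in_triangle S a b \<longleftrightarrow> (\<exists>c. cw_triangle S a b c)"

definition in_common_triangle :: "labelled_polygon \<Rightarrow> nat \<Rightarrow> nat \<Rightarrow> bool" where
  "in_common_triangle S a b \<longleftrightarrow> follows_in_triangle S a b \<or> follows_in_triangle S b a"

definition third_side :: "labelled_polygon \<Rightarrow> nat \<Rightarrow> nat \<Rightarrow> nat" where
  "third_side S a b = (THE c. cw_triangle S a b c \<or> cw_triangle S b a c)"

definition subpolygon :: "labelled_polygon \<Rightarrow> nat set \<Rightarrow> labelled_polygon" where
  "subpolygon T D =
     \<lparr>verts = {v. \<exists>a b c. cw_triangle T a b c \<and> {a, b, c} \<inter> D \<noteq> {} \<and>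
                 v \<in> ends T a \<union> ends T b \<union> ends T c},
      diags = D,
      sides = {a. \<exists>b c. cw_triangle T a b c \<and> {a, b, c} \<inter> D \<noteq> {}} - D,
      ends = ends T\<rparr>"


section \<open>Quivers of a triangulated polygon\<close>

text \<open>
  Two distinct arcs lie in at most one common triangle, so none of the following quivers has
  parallel arrows. An arrow is therefore the pair of its source and its target.
\<close>

type_synonym arrow = "nat \<times> nat"

definition diagonal_quiver :: "labelled_polygon \<Rightarrow> arrow set" where
  "diagonal_quiver S = {(a, b). a \<in> diags S \<and> b \<in> diags S \<and> follows_in_triangle S a b}"

definition ice_quiver :: "labelled_polygon \<Rightarrow> arrow set" where
  "ice_quiver S = {(a, b). (a \<in> diags S \<or> b \<in> diags S) \<and> follows_in_triangle S a b}"

definition internal_arrows :: "labelled_polygon \<Rightarrow> arrow set" where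
  "internal_arrows S = {(a, b). a \<in> sides S \<and> b \<in> sides S \<and> follows_in_triangle S a b}"

text \<open>
  Walking anticlockwise, the side from \<open>w\<close> to \<open>v\<close> immediately precedes the side from \<open>v\<close> to \<open>u\<close>
  when \<open>u\<close>, \<open>v\<close>, \<open>w\<close> are clockwise consecutive.
\<close>

definition external_arrows :: "labelled_polygon \<Rightarrow> arrow set" where
  "external_arrows S = {(a, b). a \<in> sides S \<and> b \<in> sides S \<and> \<not> in_common_triangle S a b \<and>
     (\<exists>u v w. cw_next (verts S) u v \<and> cw_next (verts S) v w \<and>
        ends S a = {w, v} \<and> ends S b = {v, u})}"

definition extended_quiver :: "labelled_polygon \<Rightarrow> arrow set" where
  "extended_quiver S = ice_quiver S \<union> internal_arrows S \<union> external_arrows S"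

text \<open>
  The cycles in the potential pass through no arrow twice, so up to rotation such a
  cycle is determined by its set of arrows. The potential is the integral
  combination of cycles given by its coefficient function.
\<close>

definition triangle_cycles :: "labelled_polygon \<Rightarrow> arrow set set" where
  "triangle_cycles S = {{(a, b), (b, c), (c, a)} | a b c. cw_triangle S a b c}"

definition big_cycle :: "labelled_polygon \<Rightarrow> nat \<Rightarrow> arrow set" where
  "big_cycle S v =
     {(a, b) \<in> ice_quiver S \<union> external_arrows S. v \<in> ends S a \<and> v \<in> ends S b}"

definition big_cycles :: "labelled_polygon \<Rightarrow> arrow set set" where
  "big_cycles S = {big_cycle S v | v. v \<in> verts S \<and> (\<exists>d\<in>diags S. v \<in> ends S d)}"

definition potential :: "labelled_polygon \<Rightarrow> arrow set \<Rightarrow> int" where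
  "potential S c = of_bool (c \<in> triangle_cycles S) - of_bool (c \<in> big_cycles S)"

definition is_cut :: "arrow set \<Rightarrow> (arrow set \<Rightarrow> int) \<Rightarrow> arrow set \<Rightarrow> bool" where
  "is_cut Q W C \<longleftrightarrow> C \<subseteq> Q \<and> (\<forall>c. W c \<noteq> 0 \<longrightarrow> (\<exists>!\<alpha>. \<alpha> \<in> c \<and> \<alpha> \<in> C))"

definition minimal_cuts :: "labelled_polygon \<Rightarrow> arrow set set" where
  "minimal_cuts S =
     {C. is_cut (extended_quiver S) (potential S) C \<and> card C = card (diags S) + 1}"


section \<open>Cluster algebras with coefficients\<close>

type_synonym 'c mpoly = "(nat \<Rightarrow>\<^sub>0 nat) \<Rightarrow>\<^sub>0 'c"

definition mpolys :: "nat \<Rightarrow> 'c::zero mpoly set" where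
  "mpolys m = {P. \<forall>e\<in>Poly_Mapping.keys P. Poly_Mapping.keys e \<subseteq> {1..m}}"

definition eval_mpoly ::
  "('c::zero \<Rightarrow> 'k) \<Rightarrow> (nat \<Rightarrow> 'k) \<Rightarrow> 'c mpoly \<Rightarrow> 'k::comm_semiring_1" where
  "eval_mpoly h x P = (\<Sum>e\<in>Poly_Mapping.keys P. h (Poly_Mapping.lookup P e) * (\<Prod>k\<in>Poly_Mapping.keys e. x k ^ Poly_Mapping.lookup e k))"

text \<open>
  The rational function field in \<open>m\<close> indeterminates over the rationals is realised as a subfield
  \<open>F\<close> of a field of characteristic zero: \<open>F\<close> is generated by algebraically independent elements.
\<close>

definition free_generating_set :: "'k::field_char_0 set \<Rightarrow> nat \<Rightarrow> (nat \<Rightarrow> 'k) \<Rightarrow> bool" where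
  "free_generating_set F m x \<longleftrightarrow>
     (\<forall>P\<in>mpolys m. eval_mpoly of_rat x P = 0 \<longrightarrow> P = 0) \<and>
     F = {eval_mpoly of_rat x P / eval_mpoly of_rat x R | P R.
            P \<in> mpolys m \<and> R \<in> mpolys m \<and> eval_mpoly of_rat x R \<noteq> 0}"

definition integer_polynomials :: "nat \<Rightarrow> (nat \<Rightarrow> 'k) \<Rightarrow> 'k::field_char_0 set" where
  "integer_polynomials m x = eval_mpoly of_int x ` mpolys m"

text \<open>
  Mutation may create parallel arrows, so here a quiver on \<open>{1..m}\<close> is given by its numbers
  \<open>R i j\<close> of arrows from \<open>i\<close> to \<open>j\<close>. The vertices above \<open>n\<close> are frozen.
\<close>

type_synonym quiver = "nat \<Rightarrow> nat \<Rightarrow> nat"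

definition quiver_of_arrows :: "arrow set \<Rightarrow> quiver" where
  "quiver_of_arrows A i j = of_bool ((i, j) \<in> A)"

text \<open>
  In order: add an arrow for each path through \<open>k\<close>; reverse the arrows at \<open>k\<close>; remove a maximal
  set of disjoint 2-cycles (truncated subtraction); remove the arrows between frozen vertices.
\<close>

definition mutate_quiver :: "nat \<Rightarrow> nat \<Rightarrow> quiver \<Rightarrow> quiver" where
  "mutate_quiver n k R =
     (let R1 = (\<lambda>i j. R i j + R i k * R k j);
          R2 = (\<lambda>i j. if i = k \<or> j = k then R1 j i else R1 i j);
          R3 = (\<lambda>i j. R2 i j - R2 j i)
      in (\<lambda>i j. if i > n \<and> j > n then 0 else R3 i j))"

definition mutate_cluster ::
  "nat \<Rightarrow> nat \<Rightarrow> (nat \<Rightarrow> 'k) \<Rightarrow> quiver \<Rightarrow> nat \<Rightarrow> 'k::field_char_0" where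
  "mutate_cluster m k x R =
     x(k := ((\<Prod>j\<in>{1..m}. x j ^ R j k) + (\<Prod>j\<in>{1..m}. x j ^ R k j)) / x k)"

inductive_set seeds ::
  "nat \<Rightarrow> nat \<Rightarrow> (nat \<Rightarrow> 'k) \<Rightarrow> quiver \<Rightarrow> ((nat \<Rightarrow> 'k::field_char_0) \<times> quiver) set"
  for n m :: nat and x0 :: "nat \<Rightarrow> 'k" and R0 :: quiver where
  initial: "(x0, R0) \<in> seeds n m x0 R0"
| mutation: "(x, R) \<in> seeds n m x0 R0 \<Longrightarrow> k \<in> {1..n} \<Longrightarrow>
    (mutate_cluster m k x R, mutate_quiver n k R) \<in> seeds n m x0 R0"

definition cluster_variables ::
  "nat \<Rightarrow> nat \<Rightarrow> (nat \<Rightarrow> 'k) \<Rightarrow> quiver \<Rightarrow> 'k::field_char_0 set" where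
  "cluster_variables n m x0 R0 = {x k | x R k. (x, R) \<in> seeds n m x0 R0 \<and> k \<in> {1..n}}"

definition cluster_numerator ::
  "nat \<Rightarrow> nat \<Rightarrow> (nat \<Rightarrow> 'k) \<Rightarrow> quiver \<Rightarrow> nat \<Rightarrow> nat \<Rightarrow> 'k::field_char_0" where
  "cluster_numerator n m x R i j =
     (THE f. f \<in> integer_polynomials m x \<and>
        (\<forall>k\<in>{1..n}. \<not> (\<exists>g\<in>integer_polynomials m x. f = x k * g)) \<and>
        f / (\<Prod>k\<in>{i..j}. x k) \<in> cluster_variables n m x R)"

end

theory Submission
  imports Defs
begin

text \<open>
  Vectors in the plane attached to the vertices of the polygon can be chosen such that the
  determinants along the arcs of \<open>T\<close> are, up to sign, the initial variables. The Pluecker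
  relations make mutation a flip of triangulations, so the cluster variables are the
  determinants along all diagonals of the polygon. The triangles of \<open>T\<close> form a path, and a
  segment that is not an arc of \<open>T\<close> joins the two ears of a unique subpath, whose inner
  diagonals \<open>i, ..., j\<close> it crosses. Propagating the Ptolemy relation along this subpath
  expresses the numerator as the sum over the bijections from its triangles to its vertices
  other than the two ears, each triangle being sent to one of its own vertices with the opposite
  side as weight. Setting \<open>x k\<close> to 0 and the other variables to 1 leaves a positive number, so
  the numerator is not divisible by \<open>x k\<close>. Finally, a minimal cut picks exactly one arrow, that
  is, one angle, of each triangle, and the big cycles say that each vertex other than the ears
  is picked once.
\<close>

section \<open>Noncrossing segments and flips\<close>

text \<open>The numerator is given by a definite description, so a cluster variable with the right
  numerator is only half of the work: uniqueness needs the complete list of cluster variables and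
  the fact that a reduced fraction determines its denominator. Mutation divides, and division by
  zero is a total operation, so mutation is a flip only once the determinants along all segments are
  known to be nonzero. This comes from the same positivity as non-divisibility; hence the numerators
  are computed, as \<open>matching_sum\<close>, before any seed is considered. That recursion is the
  hinge: over a general semiring it is at once the polynomial (at \<open>indet\<close>), its value
  in the field (at \<open>x\<close>), a positive integer (at 0 and 1) and a weighted count of
  matchings. The weights come from Ptolemy in the quadrilateral formed by triangle \<open>t\<close>
  and \<open>ear i\<close>: the determinant from \<open>ear i\<close> to \<open>r t\<close>, times
  \<open>x t\<close>, is a sum of two terms. The term with the determinant from \<open>ear i\<close>
  to \<open>p t\<close> carries the side opposite to \<open>p t\<close>, so it stands for matching
  triangle \<open>t\<close> with \<open>p t\<close>, which the remaining triangles must then avoid;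
  likewise for \<open>q t\<close>.\<close>

definition noncrossing :: "nat set set \<Rightarrow> bool" where
  "noncrossing E \<longleftrightarrow>
     (\<forall>u v w z. {u, w} \<in> E \<longrightarrow> {v, z} \<in> E \<longrightarrow> clockwise u v w \<longrightarrow> \<not> clockwise w z u)"

lemma clockwise_rotate: "clockwise a b c \<Longrightarrow> clockwise b c a"
  by (auto simp: clockwise_def)

lemma clockwise_distinct: "clockwise a b c \<Longrightarrow> a \<noteq> b \<and> b \<noteq> c \<and> a \<noteq> c"
  by (auto simp: clockwise_def)

lemma clockwise_asym: "clockwise a b c \<Longrightarrow> \<not> clockwise a c b"
  by (auto simp: clockwise_def)

lemma clockwise_total: "a \<noteq> b \<Longrightarrow> b \<noteq> c \<Longrightarrow> a \<noteq> c \<Longrightarrow> clockwise a b c \<or> clockwise a c b"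
  by (auto simp: clockwise_def)

lemma clockwise_trans: "clockwise a b c \<Longrightarrow> clockwise a c d \<Longrightarrow> clockwise a b d"
  by (auto simp: clockwise_def)

lemma clockwise_between:
  "clockwise a b c \<Longrightarrow> clockwise a v c \<Longrightarrow>
    v = b \<or> clockwise a v b \<and> clockwise v b c \<or> clockwise b v c \<and> clockwise a b v"
  by (cases v b rule: linorder_cases) (auto simp: clockwise_def)

lemma clockwise_extend:
  assumes "clockwise a b c" "clockwise c z a"
  shows "clockwise b z a" "clockwise c z b"
  using assms by (auto simp: clockwise_def)

text \<open>Of two candidates in the order \<open>u\<close>, \<open>t\<close>, \<open>t'\<close>,
  \<open>v\<close>, the segments \<open>{u, t'}\<close> and \<open>{t, v}\<close> would
  cross.\<close>

lemma apex_unique: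
  assumes "noncrossing E" "clockwise u t v" "clockwise u t' v"
    and "{u, t} \<in> E" "{t, v} \<in> E" "{u, t'} \<in> E" "{t', v} \<in> E"
  shows "t = t'"
proof (rule ccontr)
  assume "t \<noteq> t'"
  then consider "clockwise u t t'" "clockwise t t' v" | "clockwise u t' t" "clockwise t' t v"
    using clockwise_between[OF assms(2,3)] by blast
  then show False
  proof cases
    case 1
    then show False
      using assms(1,5,6) clockwise_rotate[OF assms(3)] unfolding noncrossing_def by blast
  next
    case 2
    then show False
      using assms(1,4,7) clockwise_rotate[OF assms(2)] unfolding noncrossing_def by blast
  qed
qed

text \<open>
  A labelled triangulation, with maximality replaced by the local condition that every diagonal
  bounds a triangle on either side; this is what a flip visibly preserves.
\<close>

definition arc_system :: "nat \<Rightarrow> nat \<Rightarrow> nat set \<Rightarrow> (nat \<Rightarrow> nat set) \<Rightarrow> bool" where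
  "arc_system n m V e \<longleftrightarrow> n \<le> m \<and> inj_on e {1..m} \<and>
     (\<forall>a\<in>{1..m}. \<exists>u v. u \<in> V \<and> v \<in> V \<and> u \<noteq> v \<and> e a = {u, v}) \<and>
     noncrossing (e ` {1..m}) \<and>
     (\<forall>k\<in>{1..n}. \<forall>u v. e k = {u, v} \<longrightarrow>
        (\<exists>t. clockwise u t v \<and> {u, t} \<in> e ` {1..m} \<and> {t, v} \<in> e ` {1..m}))"

definition arc_quiver :: "nat \<Rightarrow> nat \<Rightarrow> (nat \<Rightarrow> nat set) \<Rightarrow> arrow set" where
  "arc_quiver n m e = {(a, b). (a \<le> n \<or> b \<le> n) \<and> a \<in> {1..m} \<and> b \<in> {1..m} \<and>
     (\<exists>p q r. clockwise p q r \<and> e a = {p, q} \<and> e b = {q, r} \<and> {r, p} \<in> e ` {1..m})}"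

text \<open>The corners are \<open>p\<close>, \<open>r\<close>, \<open>q\<close>, \<open>s\<close>
  in clockwise order, the sides \<open>a\<close>, \<open>b\<close>, \<open>c\<close>,
  \<open>d\<close> follow in the same order from \<open>p\<close>, and \<open>k\<close> is the
  diagonal about to be replaced. A locale allows the symmetries of the quadrilateral to be used by
  reinterpretation.\<close>

locale flip =
  fixes n m :: nat and V :: "nat set" and e :: "nat \<Rightarrow> nat set"
    and k a b c d p q r s :: nat
  assumes sys: "arc_system n m V e"
    and k: "k \<in> {1..n}" and abcd: "{a, b, c, d} \<subseteq> {1..m}"
    and cw: "clockwise p r q" "clockwise q s p"
    and ends_quad: "e k = {p, q}" "e a = {p, r}" "e b = {r, q}" "e c = {q, s}" "e d = {s, p}"
begin

definition "e' = e(k := {r, s})"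

text \<open>The half turn of the quadrilateral: whatever is shown for the triangle at
  \<open>r\<close> transfers to the triangle at \<open>s\<close>.\<close>

lemma swapped: "flip n m V e k c d a b q p s r"
  using sys k abcd cw ends_quad by unfold_locales (auto simp: insert_commute)

lemma inj: "inj_on e {1..m}" and nc: "noncrossing (e ` {1..m})" and nm: "n \<le> m"
  using sys by (auto simp: arc_system_def)

lemma k_arc: "k \<in> {1..m}" using k nm by auto

lemma ends_eqD: "e i = e j \<Longrightarrow> i \<in> {1..m} \<Longrightarrow> j \<in> {1..m} \<Longrightarrow> i = j"
  using inj by (auto dest: inj_onD)

lemma noncrossD:
  "{u, w} \<in> e ` {1..m} \<Longrightarrow> {v, z} \<in> e ` {1..m} \<Longrightarrow> clockwise u v w \<Longrightarrow> \<not> clockwise w z u"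
  using nc unfolding noncrossing_def by blast

lemma quad_in: "{p, q} \<in> e ` {1..m}" "{p, r} \<in> e ` {1..m}" "{r, q} \<in> e ` {1..m}"
  "{q, s} \<in> e ` {1..m}" "{s, p} \<in> e ` {1..m}"
  using ends_quad abcd k_arc by (metis imageI insert_subset)+

lemma cw_quad: "clockwise p r s" "clockwise r q s"
  using cw by (auto simp: clockwise_def)

lemma distinct_quad: "p \<noteq> q" "p \<noteq> r" "p \<noteq> s" "q \<noteq> r" "q \<noteq> s" "r \<noteq> s"
  using cw by (auto simp: clockwise_def)

lemma apex_r: "clockwise p t q \<Longrightarrow> {p, t} \<in> e ` {1..m} \<Longrightarrow> {t, q} \<in> e ` {1..m} \<Longrightarrow> t = r"
  using apex_unique[OF nc, of p t q r] cw quad_in by auto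

lemma rs_notin: "{r, s} \<notin> e ` {1..m}"
  using noncrossD[OF quad_in(1), of r s] cw by auto

lemma distinct_labels: "distinct [k, a, b, c, d]"
proof -
  have "distinct (map e [k, a, b, c, d])"
    using distinct_quad distinct_quad[symmetric] by (simp add: ends_quad doubleton_eq_iff)
  then show ?thesis unfolding distinct_map by blast
qed

lemma ends_image_flip: "e' ` {1..m} = insert {r, s} (e ` {1..m} - {{p, q}})"
proof -
  have "e ` {1..m} - {{p, q}} = e ` ({1..m} - {k})"
    using inj_on_image_set_diff[OF inj, of "{1..m}" "{k}"] k_arc ends_quad(1) by simp
  then show ?thesis using k_arc by (auto simp: e'_def)
qed

text \<open>An end other than \<open>p\<close> and \<open>q\<close> would lie strictly beyond a side
  of the quadrilateral, and the arc would cross that side. So the only old arc that obstructs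
  \<open>{r, s}\<close> is the one being removed.\<close>

lemma cross_new:
  assumes "{v, z} \<in> e ` {1..m}" "clockwise r v s" "clockwise s z r"
  shows "v = q \<and> z = p"
proof -
  have v: "v = q"
  proof (rule ccontr)
    assume "v \<noteq> q"
    then consider "clockwise r v q" | "clockwise q v s"
      using clockwise_between[OF cw_quad(2) assms(2)] by blast
    then show False
      using noncrossD[OF quad_in(3) assms(1)] noncrossD[OF quad_in(4) assms(1)]
        clockwise_extend[OF cw_quad(2) assms(3)] by cases auto
  qed
  have sr: "clockwise s p r" using cw_quad(1) clockwise_rotate by blast
  have zv: "{z, v} \<in> e ` {1..m}" using assms(1) by (simp add: insert_commute)
  have "z = p"
  proof (rule ccontr)
    assume "z \<noteq> p"
    then consider "clockwise s z p" | "clockwise p z r"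
      using clockwise_between[OF sr assms(3)] by blast
    then show False
      using noncrossD[OF quad_in(2) zv] noncrossD[OF quad_in(5) zv]
        clockwise_extend[OF sr assms(2)] by cases auto
  qed
  with v show ?thesis by simp
qed

lemma noncrossing': "noncrossing (e' ` {1..m})"
  unfolding noncrossing_def
proof (intro allI impI notI)
  fix u v w z
  assume A: "{u, w} \<in> e' ` {1..m}" "{v, z} \<in> e' ` {1..m}" "clockwise u v w" "clockwise w z u"
  have rot: "clockwise v w z" "clockwise z u v"
    using clockwise_extend[OF A(3,4)] clockwise_rotate by metis+
  have P: False if "{u, w} = {r, s}" "{v, z} \<in> e ` {1..m} - {{p, q}}" "clockwise u v w" "clockwise w z u"
    for u v w z
  proof -
    from that(1) consider "u = r" "w = s" | "u = s" "w = r" by (auto simp: doubleton_eq_iff)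
    then show False
    proof cases
      case 1
      then show False using cross_new[of v z] that(2-4) by blast
    next
      case 2
      then show False using cross_new[of z v] that(2-4) by (metis Diff_iff insert_commute singletonI)
    qed
  qed
  consider "{u, w} = {r, s}" "{v, z} = {r, s}" | "{u, w} = {r, s}" "{v, z} \<in> e ` {1..m} - {{p, q}}"
    | "{v, z} = {r, s}" "{u, w} \<in> e ` {1..m} - {{p, q}}"
    | "{u, w} \<in> e ` {1..m}" "{v, z} \<in> e ` {1..m}"
    using A(1,2) unfolding ends_image_flip by (metis Diff_iff insert_iff)
  then show False
  proof cases
    case 1
    then show False using clockwise_distinct[OF A(3)] by (metis doubleton_eq_iff)
  next
    case 2
    then show False using P[OF _ _ A(3,4)] by simp
  next
    case 3
    then show False using P[of v z w u] rot by (metis insert_commute)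
  next
    case 4
    then show False using noncrossD[OF 4 A(3)] A(4) by simp
  qed
qed

text \<open>Only the two triangles along \<open>{p, q}\<close> disappear. If the triangle over an
  old arc was one of them, the arc is a side of the quadrilateral and its apex moves from
  \<open>p\<close> or \<open>q\<close> to \<open>r\<close> or \<open>s\<close>; the last four cases
  are the four sides.\<close>

lemma apex':
  assumes l: "l \<in> {1..n}" and uv: "e' l = {u, v}"
  shows "\<exists>t. clockwise u t v \<and> {u, t} \<in> e' ` {1..m} \<and> {t, v} \<in> e' ` {1..m}"
proof -
  have in': "{p, r} \<in> e' ` {1..m}" "{r, q} \<in> e' ` {1..m}" "{q, s} \<in> e' ` {1..m}"
    "{s, p} \<in> e' ` {1..m}" "{r, s} \<in> e' ` {1..m}"
    unfolding ends_image_flip using quad_in distinct_quad by (auto simp: doubleton_eq_iff)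
  show ?thesis
  proof (cases "l = k")
    case True
    then consider "u = r" "v = s" | "u = s" "v = r"
      using uv by (auto simp: e'_def doubleton_eq_iff)
    then show ?thesis
    proof cases
      case 1
      then show ?thesis using in' cw_quad by (intro exI[of _ q]) simp
    next
      case 2
      then show ?thesis
        using in' clockwise_rotate[OF clockwise_rotate[OF cw_quad(1)]] by (intro exI[of _ p]) simp
    qed
  next
    case False
    then have el: "e l = {u, v}" using uv by (simp add: e'_def)
    then obtain t where t: "clockwise u t v" "{u, t} \<in> e ` {1..m}" "{t, v} \<in> e ` {1..m}"
      using sys l unfolding arc_system_def by blast
    have uvE: "{u, v} \<in> e ` {1..m}" using el l nm by (metis atLeastAtMost_iff imageI le_trans)
    interpret sw: flip n m V e k c d a b q p s r by (rule swapped)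
    have cases: "{u, t} \<noteq> {p, q} \<and> {t, v} \<noteq> {p, q} \<or> u = p \<and> t = q \<or> u = q \<and> t = p
      \<or> t = p \<and> v = q \<or> t = q \<and> v = p"
      by (auto simp: doubleton_eq_iff)
    note rot = clockwise_rotate[OF t(1)] clockwise_rotate[OF clockwise_rotate[OF t(1)]]
    have in'': "{r, p} \<in> e' ` {1..m}" "{q, r} \<in> e' ` {1..m}" "{s, q} \<in> e' ` {1..m}"
      "{p, s} \<in> e' ` {1..m}" "{s, r} \<in> e' ` {1..m}"
      using in' by (simp_all add: insert_commute)
    have E: "{v, u} \<in> e ` {1..m}" "{t, u} \<in> e ` {1..m}" "{v, t} \<in> e ` {1..m}"
      using t uvE by (simp_all add: insert_commute)
    from cases consider "{u, t} \<noteq> {p, q}" "{t, v} \<noteq> {p, q}" | "u = p" "t = q" | "u = q" "t = p"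
      | "t = p" "v = q" | "t = q" "v = p"
      by metis
    then show ?thesis
    proof cases
      case 1
      then show ?thesis using t ends_image_flip by (intro exI[of _ t]) simp
    next
      case 2
      then have "v = s" using sw.apex_r[of v] rot t E by simp
      with 2 show ?thesis using in' in'' cw_quad by (intro exI[of _ r]) simp
    next
      case 3
      then have "v = r" using apex_r[of v] rot t E by simp
      with 3 show ?thesis using in' in'' sw.cw_quad by (intro exI[of _ s]) simp
    next
      case 4
      then have "u = s" using sw.apex_r[of u] rot t E uvE by simp
      with 4 show ?thesis using in' in'' clockwise_rotate[OF clockwise_rotate[OF cw_quad(2)]]
        by (intro exI[of _ r]) simp
    next
      case 5
      then have "u = r" using apex_r[of u] rot t E uvE by simp
      with 5 show ?thesis using in' in'' clockwise_rotate[OF cw_quad(1)] by (intro exI[of _ s]) simp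
    qed
  qed
qed

lemma arc_system': "arc_system n m V e'"
proof -
  have "inj_on e' {1..m}"
    using inj rs_notin unfolding e'_def by (intro inj_on_fun_updI) auto
  moreover have "\<forall>l\<in>{1..m}. \<exists>u v. u \<in> V \<and> v \<in> V \<and> u \<noteq> v \<and> e' l = {u, v}"
  proof
    fix l assume l: "l \<in> {1..m}"
    have ends: "\<exists>u v. u \<in> V \<and> v \<in> V \<and> u \<noteq> v \<and> e i = {u, v}" if "i \<in> {1..m}" for i
      using sys that unfolding arc_system_def by blast
    have "e a \<subseteq> V" "e c \<subseteq> V" using ends[of a] ends[of c] abcd by auto
    then have "r \<in> V \<and> s \<in> V \<and> r \<noteq> s" using ends_quad distinct_quad by auto
    then show "\<exists>u v. u \<in> V \<and> v \<in> V \<and> u \<noteq> v \<and> e' l = {u, v}"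
      using ends[OF l] by (cases "l = k") (auto simp: e'_def)
  qed
  ultimately show ?thesis
    using nm noncrossing' apex' unfolding arc_system_def by blast
qed

section \<open>Arrows and exchange relation under a flip\<close>

definition "tri i j \<longleftrightarrow> (\<exists>u v w. clockwise u v w \<and> e i = {u, v} \<and> e j = {v, w} \<and> {w, u} \<in> e ` {1..m})"

text \<open>Arrows whose triangle has a third side other than the flipped diagonal; between labels
  other than \<open>k\<close> they survive the flip unchanged.\<close>

definition "tri_off i j \<longleftrightarrow> (\<exists>u v w. clockwise u v w \<and> e i = {u, v} \<and> e j = {v, w} \<and>
  {w, u} \<in> e ` {1..m} \<and> {w, u} \<noteq> {p, q})"

lemma tri_to_k:
  assumes "i \<in> {1..m}"
  shows "tri i k \<longleftrightarrow> i = b \<or> i = d"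
proof
  interpret sw: flip n m V e k c d a b q p s r by (rule swapped)
  assume "tri i k"
  then obtain u v w where t: "clockwise u v w" "e i = {u, v}" "{p, q} = {v, w}" "{w, u} \<in> e ` {1..m}"
    unfolding tri_def ends_quad(1) by blast
  have E: "{u, v} \<in> e ` {1..m}" using t(2) assms by (metis imageI)
  note rot = clockwise_rotate[OF clockwise_rotate[OF t(1)]]
  from t(3) consider "v = p" "w = q" | "v = q" "w = p" by (auto simp: doubleton_eq_iff)
  then show "i = b \<or> i = d"
  proof cases
    case 1
    then have "u = s" using sw.apex_r[of u] rot t(4) E by simp
    with 1 t(2) ends_quad(5) have "e i = e d" by simp
    then show ?thesis using ends_eqD assms abcd by simp
  next
    case 2
    then have "u = r" using apex_r[of u] rot t(4) E by simp
    with 2 t(2) ends_quad(3) have "e i = e b" by simp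
    then show ?thesis using ends_eqD assms abcd by simp
  qed
next
  assume "i = b \<or> i = d"
  then show "tri i k"
  proof
    assume "i = b"
    moreover have "clockwise r q p \<and> e b = {r, q} \<and> e k = {q, p} \<and> {p, r} \<in> e ` {1..m}"
      using cw(1) clockwise_rotate ends_quad quad_in by (simp add: insert_commute)
    ultimately show ?thesis unfolding tri_def by blast
  next
    assume "i = d"
    moreover have "clockwise s p q \<and> e d = {s, p} \<and> e k = {p, q} \<and> {q, s} \<in> e ` {1..m}"
      using cw(2) clockwise_rotate ends_quad quad_in by simp
    ultimately show ?thesis unfolding tri_def by blast
  qed
qed

lemma tri_from_k:
  assumes "j \<in> {1..m}"
  shows "tri k j \<longleftrightarrow> j = a \<or> j = c"
proof
  interpret sw: flip n m V e k c d a b q p s r by (rule swapped)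
  assume "tri k j"
  then obtain u v w where t: "clockwise u v w" "e j = {v, w}" "{p, q} = {u, v}" "{w, u} \<in> e ` {1..m}"
    unfolding tri_def ends_quad(1) by blast
  have E: "{v, w} \<in> e ` {1..m}" using t(2) assms by (metis imageI)
  note rot = clockwise_rotate[OF t(1)]
  from t(3) consider "u = p" "v = q" | "u = q" "v = p" by (auto simp: doubleton_eq_iff)
  then show "j = a \<or> j = c"
  proof cases
    case 1
    then have "w = s" using sw.apex_r[of w] rot t(4) E by simp
    with 1 t(2) ends_quad(4) have "e j = e c" by simp
    then show ?thesis using ends_eqD assms abcd by simp
  next
    case 2
    then have "w = r" using apex_r[of w] rot t(4) E by simp
    with 2 t(2) ends_quad(2) have "e j = e a" by simp
    then show ?thesis using ends_eqD assms abcd by simp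
  qed
next
  assume "j = a \<or> j = c"
  then show "tri k j"
  proof
    assume "j = a"
    moreover have "clockwise q p r \<and> e k = {q, p} \<and> e a = {p, r} \<and> {r, q} \<in> e ` {1..m}"
      using clockwise_rotate[OF clockwise_rotate[OF cw(1)]] ends_quad quad_in by (simp add: insert_commute)
    ultimately show ?thesis unfolding tri_def by blast
  next
    assume "j = c"
    moreover have "clockwise p q s \<and> e k = {p, q} \<and> e c = {q, s} \<and> {s, p} \<in> e ` {1..m}"
      using clockwise_rotate[OF clockwise_rotate[OF cw(2)]] ends_quad quad_in by simp
    ultimately show ?thesis unfolding tri_def by blast
  qed
qed

lemma tri_iff:
  assumes "i \<in> {1..m}" "j \<in> {1..m}" "i \<noteq> k" "j \<noteq> k"
  shows "tri i j \<longleftrightarrow> tri_off i j \<or> i = a \<and> j = b \<or> i = c \<and> j = d"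
proof
  interpret sw: flip n m V e k c d a b q p s r by (rule swapped)
  assume "tri i j"
  then obtain u v w where t: "clockwise u v w" "e i = {u, v}" "e j = {v, w}" "{w, u} \<in> e ` {1..m}"
    unfolding tri_def by blast
  have E: "{u, v} \<in> e ` {1..m}" "{v, w} \<in> e ` {1..m}" using t(2,3) assms by (metis imageI)+
  consider "{w, u} \<noteq> {p, q}" | "u = p" "w = q" | "u = q" "w = p" by (auto simp: doubleton_eq_iff)
  then show "tri_off i j \<or> i = a \<and> j = b \<or> i = c \<and> j = d"
  proof cases
    case 1
    then show ?thesis using t unfolding tri_off_def by blast
  next
    case 2
    then have "v = r" using apex_r[of v] t E by simp
    with 2 t ends_quad have "e i = e a" "e j = e b" by simp_all
    then show ?thesis using ends_eqD assms abcd by simp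
  next
    case 3
    then have "v = s" using sw.apex_r[of v] t E by simp
    with 3 t ends_quad have "e i = e c" "e j = e d" by simp_all
    then show ?thesis using ends_eqD assms abcd by simp
  qed
next
  have "{q, p} \<in> e ` {1..m}" using quad_in(1) by (simp add: insert_commute)
  then have "tri a b" "tri c d"
    using cw ends_quad quad_in unfolding tri_def by blast+
  moreover assume "tri_off i j \<or> i = a \<and> j = b \<or> i = c \<and> j = d"
  moreover have "tri_off i j \<Longrightarrow> tri i j" unfolding tri_def tri_off_def by blast
  ultimately show "tri i j" by blast
qed

text \<open>Two sides of a triangle determine the third as the symmetric difference of their ends.
  For adjacent sides of the quadrilateral this is \<open>{p, q}\<close>, excluded in
  \<open>tri_off\<close>, or \<open>{r, s}\<close>, which is not an arc before the flip.\<close>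

lemma tri_off_quad:
  assumes "i \<in> {a, b, c, d}" "j \<in> {a, b, c, d}"
  shows "\<not> tri_off i j"
proof
  assume "tri_off i j"
  then obtain u v w where t: "clockwise u v w" "e i = {u, v}" "e j = {v, w}" "{w, u} \<in> e ` {1..m}"
    "{w, u} \<noteq> {p, q}"
    unfolding tri_off_def by (elim exE conjE) (rule that)
  have wu: "{w, u} = (e i \<union> e j) - (e i \<inter> e j)" and ne: "e i \<inter> e j \<noteq> {}" "e i \<noteq> e j"
    using clockwise_distinct[OF t(1)] unfolding t(2,3) by (auto simp: doubleton_eq_iff)
  define sd where "sd X Y = (X \<union> Y) - (X \<inter> Y)" for X Y :: "nat set"
  have sd_commute: "sd X Y = sd Y X" for X Y unfolding sd_def by blast
  have disj: "e a \<inter> e c = {}" "e b \<inter> e d = {}" "e c \<inter> e a = {}" "e d \<inter> e b = {}"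
    unfolding ends_quad by (simp_all add: distinct_quad distinct_quad[symmetric])
  have sd: "sd (e a) (e b) = {p, q}" "sd (e c) (e d) = {p, q}"
    "sd (e a) (e d) = {r, s}" "sd (e b) (e c) = {r, s}"
    unfolding sd_def ends_quad by (auto simp: distinct_quad distinct_quad[symmetric])
  have "i = a \<or> i = b \<or> i = c \<or> i = d" "j = a \<or> j = b \<or> j = c \<or> j = d" using assms by auto
  then have "sd (e i) (e j) = {p, q} \<or> sd (e i) (e j) = {r, s}"
    using ne sd disj by (elim disjE) (metis sd_commute)+
  then show False using wu t(4,5) rs_notin unfolding sd_def by metis
qed

lemma tri_asym: "tri i j \<Longrightarrow> \<not> tri j i"
proof
  assume "tri i j" "tri j i"
  then obtain u v w u' v' w' where t: "clockwise u v w" "e i = {u, v}" "e j = {v, w}"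
    "clockwise u' v' w'" "e j = {u', v'}" "e i = {v', w'}"
    unfolding tri_def by blast
  then have "v' = v \<and> u' = w \<and> w' = u"
    using clockwise_distinct[OF t(1)] clockwise_distinct[OF t(4)] by (metis doubleton_eq_iff)
  then show False using t(1,4) clockwise_asym clockwise_rotate by blast
qed

text \<open>The quarter turn: after the flip \<open>k\<close> joins \<open>r\<close> and
  \<open>s\<close>, and the corners are read from \<open>r\<close> on. The descriptions of the
  arrows thus become available on both sides of the mutation rule.\<close>

lemma flipped: "flip n m V e' k b c d a r s q p"
proof -
  have "clockwise s p r" using clockwise_rotate[OF clockwise_rotate[OF cw_quad(1)]] .
  then show ?thesis
    using arc_system' k abcd cw_quad ends_quad distinct_labels
    by unfold_locales (auto simp: e'_def)
qed

lemma arc_quiver_iff: "(i, j) \<in> arc_quiver n m e \<longleftrightarrow> (i \<le> n \<or> j \<le> n) \<and> i \<in> {1..m} \<and> j \<in> {1..m} \<and> tri i j"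
  by (auto simp: arc_quiver_def tri_def)

text \<open>The arrows at \<open>k\<close> are \<open>b -> k\<close>, \<open>d -> k\<close>,
  \<open>k -> a\<close>, \<open>k -> c\<close>. Up to arrows between frozen labels, the paths
  \<open>b -> k -> a\<close> and \<open>d -> k -> c\<close> cancel the arrows \<open>a -> b\<close>
  and \<open>c -> d\<close> of the vanishing triangles, while \<open>b -> k -> c\<close> and
  \<open>d -> k -> a\<close> create those of the new triangles.\<close>

lemma mutate_arc_quiver:
  "mutate_quiver n k (quiver_of_arrows (arc_quiver n m e)) = quiver_of_arrows (arc_quiver n m e')"
proof (intro ext)
  interpret fl: flip n m V e' k b c d a r s q p by (rule flipped)
  fix i j
  have off: "fl.tri_off i j = tri_off i j" if "i \<noteq> k" "j \<noteq> k" for i j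
  proof -
    have "z \<in> e' ` {1..m} \<and> z \<noteq> {r, s} \<longleftrightarrow> z \<in> e ` {1..m} \<and> z \<noteq> {p, q}" for z
      using ends_image_flip rs_notin by auto
    then show ?thesis using that unfolding fl.tri_off_def tri_off_def by (simp add: e'_def)
  qed
  have kn: "k \<le> n" using k by simp
  have kk: "\<not> tri k k" "\<not> fl.tri k k" using tri_asym fl.tri_asym by blast+
  show "mutate_quiver n k (quiver_of_arrows (arc_quiver n m e)) i j =
      quiver_of_arrows (arc_quiver n m e') i j"
  proof (cases "i \<in> {1..m} \<and> j \<in> {1..m}")
    case False
    then have "(x = i \<and> y = j \<or> x = j \<and> y = i) \<Longrightarrow> (x, y) \<notin> arc_quiver n m e"
      "(i, x) \<notin> arc_quiver n m e \<or> (x, j) \<notin> arc_quiver n m e"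
      "(j, x) \<notin> arc_quiver n m e \<or> (x, i) \<notin> arc_quiver n m e"
      "(i, j) \<notin> arc_quiver n m e'" for x y
      by (auto simp: arc_quiver_iff fl.arc_quiver_iff)
    then show ?thesis by (simp add: mutate_quiver_def Let_def quiver_of_arrows_def)
  next
    case True
    consider "i = k" "j = k" | "i = k" "j \<noteq> k" | "i \<noteq> k" "j = k" | "i \<noteq> k" "j \<noteq> k" by blast
    then show ?thesis
    proof cases
      case 1
      then show ?thesis using kk
        by (simp add: mutate_quiver_def Let_def quiver_of_arrows_def arc_quiver_iff fl.arc_quiver_iff)
    next
      case 2
      then show ?thesis using kk kn True k_arc distinct_labels
        by (auto simp: mutate_quiver_def Let_def quiver_of_arrows_def arc_quiver_iff
            fl.arc_quiver_iff tri_to_k tri_from_k fl.tri_to_k fl.tri_from_k)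
    next
      case 3
      then show ?thesis using kk kn True k_arc distinct_labels
        by (auto simp: mutate_quiver_def Let_def quiver_of_arrows_def arc_quiver_iff
            fl.arc_quiver_iff tri_to_k tri_from_k fl.tri_to_k fl.tri_from_k)
    next
      case 4
      note unf = mutate_quiver_def Let_def quiver_of_arrows_def arc_quiver_iff fl.arc_quiver_iff
      have T: "tri i j \<longleftrightarrow> tri_off i j \<or> i = a \<and> j = b \<or> i = c \<and> j = d"
        "tri j i \<longleftrightarrow> tri_off j i \<or> j = a \<and> i = b \<or> j = c \<and> i = d"
        "fl.tri i j \<longleftrightarrow> tri_off i j \<or> i = b \<and> j = c \<or> i = d \<and> j = a"
        using tri_iff[of i j] tri_iff[of j i] fl.tri_iff[of i j] off True 4 by auto
      have K: "quiver_of_arrows (arc_quiver n m e) x k = of_bool (x = b \<or> x = d)"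
        "quiver_of_arrows (arc_quiver n m e) k x = of_bool (x = a \<or> x = c)"
        if "x \<in> {1..m}" for x
        using that kn k_arc unfolding quiver_of_arrows_def arc_quiver_iff
        by (simp_all add: tri_to_k tri_from_k)
      have M: "mutate_quiver n k Q i j = (if n < i \<and> n < j then 0
          else (Q i j + Q i k * Q k j) - (Q j i + Q j k * Q k i))" for Q
        using 4 by (simp add: mutate_quiver_def)
      show ?thesis
      proof (cases "i \<in> {a, b, c, d} \<and> j \<in> {a, b, c, d}")
        case True': True
        then have "\<not> tri_off i j" "\<not> tri_off j i" using tri_off_quad by blast+
        then have R: "quiver_of_arrows (arc_quiver n m e) i j =
              of_bool ((i \<le> n \<or> j \<le> n) \<and> (i = a \<and> j = b \<or> i = c \<and> j = d))"
            "quiver_of_arrows (arc_quiver n m e) j i =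
              of_bool ((i \<le> n \<or> j \<le> n) \<and> (j = a \<and> i = b \<or> j = c \<and> i = d))"
            "quiver_of_arrows (arc_quiver n m e') i j =
              of_bool ((i \<le> n \<or> j \<le> n) \<and> (i = b \<and> j = c \<or> i = d \<and> j = a))"
          using T True unfolding quiver_of_arrows_def arc_quiver_iff fl.arc_quiver_iff by auto
        have D: "a \<noteq> b" "a \<noteq> c" "a \<noteq> d" "b \<noteq> c" "b \<noteq> d" "c \<noteq> d" using distinct_labels by auto
        have ij: "i = a \<or> i = b \<or> i = c \<or> i = d" "j = a \<or> j = b \<or> j = c \<or> j = d"
          using True' by auto
        show ?thesis
          using ij unfolding M R K[OF conjunct1[OF True]] K[OF conjunct2[OF True]]
          by (elim disjE) (simp_all add: D D[symmetric])
      next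
        case False
        then have T': "tri i j = tri_off i j" "tri j i = tri_off j i" "fl.tri i j = tri_off i j"
          using T False by blast+
        have no_path: "quiver_of_arrows (arc_quiver n m e) i k * quiver_of_arrows (arc_quiver n m e) k j = 0"
            "quiver_of_arrows (arc_quiver n m e) j k * quiver_of_arrows (arc_quiver n m e) k i = 0"
          unfolding K[OF conjunct1[OF True]] K[OF conjunct2[OF True]]
          using False by (simp_all add: of_bool_def) blast+
        \<comment> \<open>In the absence of 2-cycles the truncated subtraction leaves every arrow
          alone.\<close>
        have "tri i j \<Longrightarrow> \<not> tri j i" by (rule tri_asym)
        then show ?thesis
          unfolding M no_path unfolding quiver_of_arrows_def arc_quiver_iff fl.arc_quiver_iff T'
          by (auto simp: of_bool_def)
      qed
    qed
  qed
qed

lemma mutate_arc_cluster: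
  fixes y :: "nat \<Rightarrow> 'k::field_char_0"
  shows "mutate_cluster m k y (quiver_of_arrows (arc_quiver n m e)) =
    y(k := (y b * y d + y a * y c) / y k)"
proof -
  have dl: "b \<noteq> d" "a \<noteq> c" using distinct_labels by auto
  have kn: "k \<le> n" using k by simp
  have "(\<Prod>j\<in>{1..m}. y j ^ quiver_of_arrows (arc_quiver n m e) j k) = (\<Prod>j\<in>{b, d}. y j)"
    using abcd kn k_arc
    by (intro prod.mono_neutral_cong_right)
      (auto simp: quiver_of_arrows_def arc_quiver_iff tri_to_k)
  moreover have "(\<Prod>j\<in>{1..m}. y j ^ quiver_of_arrows (arc_quiver n m e) k j) = (\<Prod>j\<in>{a, c}. y j)"
    using abcd kn k_arc
    by (intro prod.mono_neutral_cong_right)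
      (auto simp: quiver_of_arrows_def arc_quiver_iff tri_from_k)
  ultimately show ?thesis using dl by (simp add: mutate_cluster_def)
qed

end

section \<open>Evaluation of integer polynomials\<close>

definition eval_monomial :: "(nat \<Rightarrow> 'a::comm_semiring_1) \<Rightarrow> (nat \<Rightarrow>\<^sub>0 nat) \<Rightarrow> 'a" where
  "eval_monomial z e = (\<Prod>k\<in>Poly_Mapping.keys e. z k ^ Poly_Mapping.lookup e k)"

definition indet :: "nat \<Rightarrow> int mpoly" where
  "indet l = Poly_Mapping.single (Poly_Mapping.single l 1) 1"

lemma eval_monomial_superset:
  assumes "finite A" "Poly_Mapping.keys e \<subseteq> A"
  shows "eval_monomial z e = (\<Prod>k\<in>A. z k ^ Poly_Mapping.lookup e k)"
  unfolding eval_monomial_def using assms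
  by (intro prod.mono_neutral_left) (auto simp: in_keys_iff)

lemma eval_monomial_add: "eval_monomial z (e + f) = eval_monomial z e * eval_monomial z f"
proof -
  let ?A = "Poly_Mapping.keys e \<union> Poly_Mapping.keys f"
  have "Poly_Mapping.keys (e + f) \<subseteq> ?A" by (rule keys_add)
  then show ?thesis
    by (simp add: eval_monomial_superset[of ?A] lookup_add power_add prod.distrib)
qed

lemma eval_monomial_single: "eval_monomial z (Poly_Mapping.single l 1) = z l"
  by (simp add: eval_monomial_def)

lemma eval_mpoly_superset:
  assumes "finite A" "Poly_Mapping.keys P \<subseteq> A"
  shows "eval_mpoly of_int z P = (\<Sum>e\<in>A. of_int (Poly_Mapping.lookup P e) * eval_monomial z e)"
  unfolding eval_mpoly_def eval_monomial_def[symmetric] using assms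
  by (intro sum.mono_neutral_left) (auto simp: in_keys_iff)

lemma eval_mpoly_add:
  "eval_mpoly of_int z (P + R) = eval_mpoly of_int z P + eval_mpoly of_int z R"
proof -
  let ?A = "Poly_Mapping.keys P \<union> Poly_Mapping.keys R"
  have "Poly_Mapping.keys (P + R) \<subseteq> ?A" by (rule keys_add)
  then show ?thesis
    by (simp add: eval_mpoly_superset[of ?A] lookup_add distrib_right sum.distrib)
qed

lemma eval_mpoly_0 [simp]: "eval_mpoly of_int z 0 = 0"
  by (simp add: eval_mpoly_def)

lemma eval_mpoly_sum:
  "eval_mpoly of_int z (\<Sum>i\<in>I. P i) = (\<Sum>i\<in>I. eval_mpoly of_int z (P i))"
  by (induction I rule: infinite_finite_induct) (simp_all add: eval_mpoly_add)

lemma eval_mpoly_single: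
  "eval_mpoly of_int z (Poly_Mapping.single e c) = of_int c * eval_monomial z e"
  by (simp add: eval_mpoly_superset[of "{e}"])

lemma eval_indet [simp]: "eval_mpoly of_int z (indet l) = z l"
  by (simp only: indet_def eval_mpoly_single eval_monomial_single of_int_1 mult_1)

lemma mpoly_eq_sum_single:
  "(\<Sum>e\<in>Poly_Mapping.keys P. Poly_Mapping.single e (Poly_Mapping.lookup P e)) = P"
proof (rule poly_mapping_eqI)
  fix f
  show "Poly_Mapping.lookup (\<Sum>e\<in>Poly_Mapping.keys P. Poly_Mapping.single e (Poly_Mapping.lookup P e)) f
      = Poly_Mapping.lookup P f"
    by (simp add: lookup_sum lookup_single when_def in_keys_iff sum.delta)
qed

lemma eval_mpoly_mult:
  "eval_mpoly of_int z (P * R) = eval_mpoly of_int z P * eval_mpoly of_int z R"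
proof -
  let ?s = "\<lambda>P e. Poly_Mapping.single e (Poly_Mapping.lookup P e)"
  have "P * R = (\<Sum>e\<in>Poly_Mapping.keys P. ?s P e) * (\<Sum>f\<in>Poly_Mapping.keys R. ?s R f)"
    by (simp only: mpoly_eq_sum_single)
  also have "eval_mpoly of_int z \<dots> = (\<Sum>e\<in>Poly_Mapping.keys P. \<Sum>f\<in>Poly_Mapping.keys R.
      eval_mpoly of_int z (?s P e) * eval_mpoly of_int z (?s R f))"
    by (simp add: sum_product eval_mpoly_sum mult_single eval_mpoly_single eval_monomial_add mult_ac)
  also have "\<dots> = eval_mpoly of_int z (\<Sum>e\<in>Poly_Mapping.keys P. ?s P e) *
      eval_mpoly of_int z (\<Sum>f\<in>Poly_Mapping.keys R. ?s R f)"
    by (simp only: sum_product eval_mpoly_sum)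
  finally show ?thesis by (simp only: mpoly_eq_sum_single)
qed

lemma eval_mpoly_1: "eval_mpoly of_int z 1 = 1"
  using eval_mpoly_single[of z 0 1] by (simp add: eval_monomial_def)

lemma eval_mpoly_prod:
  "eval_mpoly of_int z (\<Prod>i\<in>I. P i) = (\<Prod>i\<in>I. eval_mpoly of_int z (P i))"
  by (induction I rule: infinite_finite_induct) (simp_all add: eval_mpoly_mult eval_mpoly_1)

lemma mpolys_add: "P \<in> mpolys m \<Longrightarrow> R \<in> mpolys m \<Longrightarrow> P + R \<in> mpolys m"
  unfolding mpolys_def using keys_add[of P R] by blast

lemma mpolys_uminus: "P \<in> mpolys m \<Longrightarrow> - P \<in> mpolys m" for P :: "int mpoly"
  by (simp add: mpolys_def)

lemma mpolys_mult: "P \<in> mpolys m \<Longrightarrow> R \<in> mpolys m \<Longrightarrow> P * R \<in> mpolys m"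
proof -
  assume PR: "P \<in> mpolys m" "R \<in> mpolys m"
  have "Poly_Mapping.keys (e + f) \<subseteq> {1..m}"
    if "e \<in> Poly_Mapping.keys P" "f \<in> Poly_Mapping.keys R" for e f
    using keys_add[of e f] PR that unfolding mpolys_def by blast
  then show ?thesis unfolding mpolys_def using keys_mult[of P R] by blast
qed

lemma mpolys_sum: "(\<And>i. i \<in> I \<Longrightarrow> P i \<in> mpolys m) \<Longrightarrow> (\<Sum>i\<in>I. P i) \<in> mpolys m"
proof (induction I rule: infinite_finite_induct)
  case (insert i I)
  then show ?case by (simp add: mpolys_add)
qed (simp_all add: mpolys_def)

lemma mpolys_indet: "l \<in> {1..m} \<Longrightarrow> indet l \<in> mpolys m"
  by (simp add: mpolys_def indet_def)

lemma mpolys_prod_indet: "I \<subseteq> {1..m} \<Longrightarrow> (\<Prod>i\<in>I. indet i) \<in> mpolys m"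
proof (induction I rule: infinite_finite_induct)
  case (insert i I)
  then show ?case by (simp add: mpolys_mult mpolys_indet)
qed (simp_all add: mpolys_def)

lemma mpolys_single: "Poly_Mapping.keys e \<subseteq> {1..m} \<Longrightarrow> Poly_Mapping.single e c \<in> mpolys m"
  by (simp add: mpolys_def)

section \<open>Algebraic independence and divisibility by a variable\<close>

locale algebraically_independent =
  fixes m :: nat and x :: "nat \<Rightarrow> 'k::field_char_0"
  assumes independent: "P \<in> mpolys m \<Longrightarrow> eval_mpoly of_int x P = 0 \<Longrightarrow> P = 0"
begin

lemma mpoly_eqI:
  assumes "P \<in> mpolys m" "R \<in> mpolys m" "eval_mpoly of_int x P = eval_mpoly of_int x R"
  shows "P = R"
proof -
  have "eval_mpoly of_int x (P + - R) + eval_mpoly of_int x R = eval_mpoly of_int x P"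
    unfolding eval_mpoly_add[symmetric] by simp
  then have "P + - R = 0"
    using independent[of "P + - R"] assms by (simp add: mpolys_add mpolys_uminus del: add_uminus_conv_diff)
  then show ?thesis by simp
qed

lemma indet_nonzero: "l \<in> {1..m} \<Longrightarrow> x l \<noteq> 0"
proof
  assume "l \<in> {1..m}" "x l = 0"
  then have "indet l = 0" using independent[OF mpolys_indet, of l] by simp
  then show False by (simp add: indet_def)
qed

lemma prod_indet_nonzero: "I \<subseteq> {1..m} \<Longrightarrow> (\<Prod>i\<in>I. x i) \<noteq> 0"
  using indet_nonzero by (cases "finite I") auto

text \<open>By independence, divisibility of values at \<open>x\<close> is divisibility of
  polynomials, and therefore survives evaluation at any point \<open>z\<close> of any commutative
  ring.\<close>

lemma not_divisible:
  fixes z :: "nat \<Rightarrow> 'a::comm_ring_1"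
  assumes "P \<in> mpolys m" "l \<in> {1..m}" "z l = 0" "eval_mpoly of_int z P \<noteq> 0"
  shows "\<not> (\<exists>g\<in>integer_polynomials m x. eval_mpoly of_int x P = x l * g)"
proof
  assume "\<exists>g\<in>integer_polynomials m x. eval_mpoly of_int x P = x l * g"
  then obtain G where G: "G \<in> mpolys m" "eval_mpoly of_int x P = x l * eval_mpoly of_int x G"
    unfolding integer_polynomials_def by blast
  then have "P = indet l * G"
    using assms by (intro mpoly_eqI) (simp_all add: mpolys_mult mpolys_indet eval_mpoly_mult)
  then show False using assms(3,4) by (simp add: eval_mpoly_mult)
qed

text \<open>Setting \<open>x l\<close> to 0 kills the monomials that contain it and does not change
  the others. The sum of these others therefore vanishes at \<open>x\<close>, so by independence
  there are none, and every monomial can be divided by \<open>x l\<close>.\<close>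

lemma divisible_if_vanishing:
  assumes P: "P \<in> mpolys m" and l: "l \<in> {1..m}" and van: "eval_mpoly of_int (x(l := 0)) P = 0"
  shows "\<exists>g\<in>integer_polynomials m x. eval_mpoly of_int x P = x l * g"
proof -
  let ?K = "Poly_Mapping.keys P"
  let ?s = "\<lambda>e. Poly_Mapping.single e (Poly_Mapping.lookup P e)"
  define K0 where "K0 = {e \<in> ?K. Poly_Mapping.lookup e l = 0}"
  define P0 where "P0 = (\<Sum>e\<in>K0. ?s e)"
  have fin: "finite K0" by (simp add: K0_def)
  have P0: "P0 \<in> mpolys m"
    unfolding P0_def using P by (intro mpolys_sum mpolys_single) (auto simp: K0_def mpolys_def)
  have "eval_mpoly of_int x P0 = (\<Sum>e\<in>K0. of_int (Poly_Mapping.lookup P e) * eval_monomial (x(l := 0)) e)"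
    unfolding P0_def eval_mpoly_sum eval_mpoly_single
    by (intro sum.cong refl) (auto simp: eval_monomial_def K0_def in_keys_iff intro!: prod.cong)
  also have "\<dots> = (\<Sum>e\<in>?K. of_int (Poly_Mapping.lookup P e) * eval_monomial (x(l := 0)) e)"
  proof (intro sum.mono_neutral_left)
    show "\<forall>e\<in>?K - K0. of_int (Poly_Mapping.lookup P e) * eval_monomial (x(l := 0)) e = 0"
    proof
      fix e assume "e \<in> ?K - K0"
      then have "l \<in> Poly_Mapping.keys e" by (auto simp: K0_def in_keys_iff)
      then have "eval_monomial (x(l := 0)) e = 0"
        unfolding eval_monomial_def by (intro prod_zero) (auto simp: in_keys_iff intro!: bexI[of _ l])
      then show "of_int (Poly_Mapping.lookup P e) * eval_monomial (x(l := 0)) e = 0" by simp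
    qed
  qed (auto simp: K0_def)
  also have "\<dots> = 0" using van by (simp add: eval_mpoly_superset[of ?K])
  finally have "P0 = 0" using independent P0 by blast
  have K0: "K0 = {}"
  proof (rule ccontr)
    assume "K0 \<noteq> {}"
    then obtain e where e: "e \<in> K0" by blast
    have "Poly_Mapping.lookup P0 e = Poly_Mapping.lookup P e"
      using e fin by (simp add: P0_def lookup_sum lookup_single when_def sum.delta)
    then show False using e \<open>P0 = 0\<close> by (simp add: K0_def in_keys_iff)
  qed
  \<comment> \<open>Subtraction of exponents is truncated; adding the exponent back restores
    \<open>e\<close> only because \<open>K0\<close> is empty.\<close>
  define dec where "dec e = e - Poly_Mapping.single l (1::nat)" for e
  have dec: "dec e + Poly_Mapping.single l 1 = e" if "e \<in> ?K" for e
  proof (rule poly_mapping_eqI)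
    fix j
    have "Poly_Mapping.lookup e l > 0" using that K0 by (auto simp: K0_def)
    then show "Poly_Mapping.lookup (dec e + Poly_Mapping.single l 1) j = Poly_Mapping.lookup e j"
      by (auto simp: dec_def lookup_add lookup_minus lookup_single when_def)
  qed
  define G where "G = (\<Sum>e\<in>?K. Poly_Mapping.single (dec e) (Poly_Mapping.lookup P e))"
  have "G \<in> mpolys m"
    unfolding G_def
  proof (intro mpolys_sum mpolys_single)
    fix e assume e: "e \<in> ?K"
    have "Poly_Mapping.keys (dec e) \<subseteq> Poly_Mapping.keys e"
      by (auto simp: dec_def in_keys_iff lookup_minus)
    then show "Poly_Mapping.keys (dec e) \<subseteq> {1..m}" using P e unfolding mpolys_def by blast
  qed
  moreover have "eval_mpoly of_int x P = x l * eval_mpoly of_int x G"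
  proof -
    have "eval_monomial x e = x l * eval_monomial x (dec e)" if "e \<in> ?K" for e
      using eval_monomial_add[of x "dec e" "Poly_Mapping.single l 1"] dec[OF that]
        eval_monomial_single[of x l] by (simp add: mult.commute)
    then show ?thesis
      unfolding G_def eval_mpoly_sum eval_mpoly_single sum_distrib_left
        eval_mpoly_superset[OF finite_keys subset_refl, of x P]
      by (intro sum.cong refl) (simp add: mult_ac)
  qed
  ultimately show ?thesis unfolding integer_polynomials_def by blast
qed

text \<open>Cleared of denominators, the equation is one between polynomials and may be evaluated at
  \<open>x(l := 0)\<close>. For \<open>l\<close> in \<open>I\<close> but not in \<open>J\<close> the
  right side dies while the product over \<open>J\<close> does not, so \<open>f\<close> would be
  divisible by \<open>x l\<close>. Used in both directions, this shows that equal reduced fractions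
  have equal denominators.\<close>

lemma denominator_subset:
  assumes f: "f \<in> integer_polynomials m x" and g: "g \<in> integer_polynomials m x"
    and I: "I \<subseteq> {1..m}" and J: "J \<subseteq> {1..m}"
    and eq: "f / (\<Prod>i\<in>I. x i) = g / (\<Prod>i\<in>J. x i)"
    and irred: "\<And>l. l \<in> I \<Longrightarrow> \<not> (\<exists>h\<in>integer_polynomials m x. f = x l * h)"
  shows "I \<subseteq> J"
proof
  fix l assume l: "l \<in> I"
  show "l \<in> J"
  proof (rule ccontr)
    assume lJ: "l \<notin> J"
    obtain P R where P: "P \<in> mpolys m" "f = eval_mpoly of_int x P"
      and R: "R \<in> mpolys m" "g = eval_mpoly of_int x R"
      using f g unfolding integer_polynomials_def by blast
    have fin: "finite I" using I finite_subset by blast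
    have "f * (\<Prod>i\<in>J. x i) = g * (\<Prod>i\<in>I. x i)"
      using eq prod_indet_nonzero[OF I] prod_indet_nonzero[OF J] by (simp add: field_simps)
    then have "P * (\<Prod>i\<in>J. indet i) = R * (\<Prod>i\<in>I. indet i)"
      using P R I J by (intro mpoly_eqI)
        (simp_all add: mpolys_mult mpolys_prod_indet eval_mpoly_mult eval_mpoly_prod)
    then have "eval_mpoly of_int (x(l := 0)) (P * (\<Prod>i\<in>J. indet i)) =
        eval_mpoly of_int (x(l := 0)) (R * (\<Prod>i\<in>I. indet i))"
      by simp
    moreover have "(\<Prod>i\<in>I. (x(l := 0)) i) = 0"
      using l fin by (intro prod_zero) auto
    moreover have "(\<Prod>i\<in>J. (x(l := 0)) i) \<noteq> 0"
      using prod_indet_nonzero[OF J] lJ prod.cong[of J J "x(l := 0)" x] by fastforce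
    ultimately have "eval_mpoly of_int (x(l := 0)) P = 0"
      unfolding eval_mpoly_mult eval_mpoly_prod eval_indet by simp
    then show False using divisible_if_vanishing[OF P(1)] l I irred[OF l] P(2) by blast
  qed
qed

end

lemma free_generating_set_independent:
  assumes "free_generating_set F m x"
  shows "algebraically_independent m x"
proof
  fix P :: "int mpoly"
  assume P: "P \<in> mpolys m" "eval_mpoly of_int x P = 0"
  define R :: "rat mpoly" where "R = Poly_Mapping.map of_int P"
  have look: "Poly_Mapping.lookup R e = of_int (Poly_Mapping.lookup P e)" for e
    by (simp add: R_def map.rep_eq when_def)
  then have keys: "Poly_Mapping.keys R = Poly_Mapping.keys P"
    by (auto simp: in_keys_iff)
  have "R \<in> mpolys m" "eval_mpoly of_rat x R = 0"
    using P by (simp_all add: mpolys_def eval_mpoly_def keys look)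
  then have "R = 0" using assms unfolding free_generating_set_def by blast
  then show "P = 0" using keys by (metis keys_eq_empty)
qed

section \<open>Paths of triangles and their matchings\<close>

lemma arc_system_ends:
  assumes "arc_system n m V e" "a \<in> {1..m}"
  obtains u v where "u \<in> V" "v \<in> V" "u \<noteq> v" "e a = {u, v}"
  using assms unfolding arc_system_def by meson

text \<open>
  The triangles of the triangulation form a path: the triangle with vertices \<open>p t\<close>, \<open>r t\<close>, \<open>q t\<close>
  is entered through its side \<open>{p t, q t}\<close> and left through one of the sides at \<open>r t\<close>.
\<close>

locale triangle_path =
  fixes n m :: nat and V :: "nat set" and e :: "nat \<Rightarrow> nat set" and p q r :: "nat \<Rightarrow> nat"
  assumes sys: "arc_system n m V e"
    and cw: "t \<le> n \<Longrightarrow> clockwise (p t) (r t) (q t)"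
    and step: "t < n \<Longrightarrow>
      p (Suc t) = p t \<and> q (Suc t) = r t \<or> p (Suc t) = r t \<and> q (Suc t) = q t"
    and diag: "t \<in> {1..n} \<Longrightarrow> e t = {p t, q t}"
    and base: "{p 0, q 0} \<in> e ` {1..m}"
    and sides_in: "t \<le> n \<Longrightarrow> {p t, r t} \<in> e ` {1..m}" "t \<le> n \<Longrightarrow> {r t, q t} \<in> e ` {1..m}"
    and verts_cover: "v \<in> V \<Longrightarrow> \<exists>t\<le>n. v \<in> {p t, q t, r t}"
    and arcs_cover: "a \<in> {1..m} \<Longrightarrow> \<exists>t\<le>n. e a \<subseteq> {p t, q t, r t}"
begin

definition tri :: "nat \<Rightarrow> nat set" where "tri t = {p t, q t, r t}"

lemma nm: "n \<le> m" and inj: "inj_on e {1..m}"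
  using sys by (auto simp: arc_system_def)

lemma distinct: "t \<le> n \<Longrightarrow> p t \<noteq> q t \<and> p t \<noteq> r t \<and> q t \<noteq> r t"
  using clockwise_distinct[OF cw, of t] by simp

lemma pq_in: "t \<le> n \<Longrightarrow> {p t, q t} \<in> e ` {1..m}"
proof (cases "t = 0")
  case False
  assume "t \<le> n"
  with False have "t \<in> {1..m}" "e t = {p t, q t}" using nm diag[of t] by auto
  then show ?thesis by (metis imageI)
qed (use base in simp)

lemma tri_arc: "t \<le> n \<Longrightarrow> u \<in> tri t \<Longrightarrow> v \<in> tri t \<Longrightarrow> u \<noteq> v \<Longrightarrow> {u, v} \<in> e ` {1..m}"
  using pq_in[of t] sides_in[of t] unfolding tri_def by (auto simp: insert_commute)

lemma pq_Suc: "t < n \<Longrightarrow> {p (Suc t), q (Suc t)} \<subseteq> tri t \<and> r t \<in> {p (Suc t), q (Suc t)}"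
  using step[of t] by (auto simp: tri_def)

text \<open>The stretches of the boundary from \<open>p t\<close> clockwise to \<open>q t\<close>
  are nested, because the next entry side is a side at \<open>r t\<close>, which lies inside the
  current stretch. Triangles already passed stay outside all later stretches, so each
  \<open>r t\<close> is a new vertex.\<close>

lemma outside:
  assumes "t \<le> n" "s < t" "v \<in> tri s"
  shows "\<not> clockwise (p t) v (q t)"
  using assms
proof (induction t)
  case (Suc t)
  have t: "t < n" "t \<le> n" using Suc by auto
  have v: "\<not> clockwise (p t) v (q t) \<or> v \<in> tri t"
    using Suc by (cases "s = t") auto
  note ct = cw[OF t(2)]
  show ?case
  proof
    assume "clockwise (p (Suc t)) v (q (Suc t))"
    with step[OF t(1)] consider "clockwise (p t) v (r t)" | "clockwise (r t) v (q t)" by auto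
    then show False
    proof cases
      case 1
      then have "clockwise (p t) v (q t)" by (rule clockwise_trans) (rule ct)
      with v have "v \<in> {p t, q t, r t}" by (simp add: tri_def)
      with 1 show False using clockwise_asym[OF ct] clockwise_distinct[OF 1] by auto
    next
      case 2
      have "clockwise (q t) (p t) v"
        using clockwise_trans clockwise_rotate[OF clockwise_rotate[OF ct]]
          clockwise_rotate[OF clockwise_rotate[OF 2]] by blast
      then have "clockwise (p t) v (q t)" by (rule clockwise_rotate)
      with v have "v \<in> {p t, q t, r t}" by (simp add: tri_def)
      with 2 show False
        using clockwise_distinct[OF 2] clockwise_asym[OF clockwise_rotate[OF ct]] clockwise_rotate
        by auto
    qed
  qed
qed simp

lemma r_new: "s < t \<Longrightarrow> t \<le> n \<Longrightarrow> r t \<notin> tri s"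
  using outside cw by blast

lemma r_inj: "s \<le> n \<Longrightarrow> t \<le> n \<Longrightarrow> r s = r t \<Longrightarrow> s = t"
  using r_new[of s t] r_new[of t s] by (cases s t rule: linorder_cases) (auto simp: tri_def)

text \<open>The vertex of triangle \<open>i - 1\<close> that does not lie on the diagonal \<open>i\<close>.\<close>

definition ear :: "nat \<Rightarrow> nat" where
  "ear i = (if p i = p (i - 1) then q (i - 1) else p (i - 1))"

lemma ear:
  assumes "1 \<le> i" "i \<le> n"
  shows "tri (i - 1) = {ear i, p i, q i}" "ear i \<noteq> p i" "ear i \<noteq> q i"
proof -
  obtain t where t: "i = Suc t" "t < n" using assms by (cases i) auto
  note d = distinct[of t]
  from step[OF t(2)] have "tri t = {ear (Suc t), p (Suc t), q (Suc t)} \<and>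
      ear (Suc t) \<noteq> p (Suc t) \<and> ear (Suc t) \<noteq> q (Suc t)"
  proof
    assume s: "p (Suc t) = p t \<and> q (Suc t) = r t"
    then have "ear (Suc t) = q t" by (simp add: ear_def)
    with s show ?thesis using d t by (auto simp: tri_def)
  next
    assume s: "p (Suc t) = r t \<and> q (Suc t) = q t"
    then have "ear (Suc t) = p t" using d t by (simp add: ear_def)
    with s show ?thesis using d t by (auto simp: tri_def)
  qed
  then show "tri (i - 1) = {ear i, p i, q i}" "ear i \<noteq> p i" "ear i \<noteq> q i"
    using t by auto
qed

lemma tri_subset:
  assumes "i \<le> t" "t \<le> n"
  shows "tri t \<subseteq> {p i, q i} \<union> r ` {i..t}"
  using assms
proof (induction t)
  case (Suc t)
  show ?case
  proof (cases "i = Suc t")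
    case False
    then have "tri t \<subseteq> {p i, q i} \<union> r ` {i..t}" and "t < n" "i \<le> t" using Suc by auto
    moreover have "tri (Suc t) \<subseteq> insert (r (Suc t)) (tri t)"
      using pq_Suc[OF \<open>t < n\<close>] unfolding tri_def by blast
    moreover have "{i..Suc t} = insert (Suc t) {i..t}" using \<open>i \<le> t\<close> by auto
    ultimately show ?thesis by auto
  qed (auto simp: tri_def)
qed (auto simp: tri_def)

text \<open>Beyond the diagonal \<open>i\<close> only the ends of \<open>i\<close> and newly met
  vertices \<open>r s\<close> occur.\<close>

lemma ear_gone:
  assumes "1 \<le> i" "i \<le> t" "t \<le> n"
  shows "ear i \<notin> tri t"
proof
  assume "ear i \<in> tri t"
  then have "ear i \<in> r ` {i..t}" using tri_subset[of i t] ear[of i] assms by auto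
  then obtain s where "i \<le> s" "s \<le> t" "ear i = r s" by auto
  moreover have "i - 1 < s" "s \<le> n" using \<open>i \<le> s\<close> \<open>s \<le> t\<close> assms by linarith+
  ultimately show False using r_new[of "i - 1" s] ear(1)[of i] assms by simp
qed

text \<open>This places \<open>ear i\<close> and \<open>r t\<close> on opposite sides of the
  diagonal \<open>t\<close>: \<open>p t\<close>, \<open>r t\<close>, \<open>q t\<close>,
  \<open>ear i\<close> are the clockwise corners of a quadrilateral, as the Ptolemy relation
  requires.\<close>

lemma ear_cw:
  assumes "1 \<le> i" "i \<le> t" "t \<le> n"
  shows "clockwise (q t) (ear i) (p t)"
proof -
  have "\<not> clockwise (p t) (ear i) (q t)"
    using outside[of t "i - 1" "ear i"] ear(1)[of i] assms by simp
  then have "clockwise (p t) (q t) (ear i)"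
    using clockwise_total[of "p t" "q t" "ear i"] ear_gone[OF assms] distinct[of t] assms
    unfolding tri_def by auto
  then show ?thesis by (rule clockwise_rotate)
qed

lemma diag_tri: "l \<in> {1..n} \<Longrightarrow> e l \<subseteq> tri l"
  using diag by (auto simp: tri_def)

lemma diag_ear_gone: "1 \<le> i \<Longrightarrow> i \<le> l \<Longrightarrow> l \<le> n \<Longrightarrow> ear i \<notin> e l"
  using ear_gone[of i l] diag_tri[of l] by auto

lemma diag_r_new: "1 \<le> l \<Longrightarrow> l \<le> t \<Longrightarrow> t \<le> n \<Longrightarrow> r t \<notin> e l"
  using r_new[of l t] diag_tri[of l] diag[of l] distinct[of l] by (cases "l = t") auto

text \<open>A segment between vertices that is not an arc leaves the path of triangles at its earlier end
  before its later end is reached.\<close>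

lemma non_arc:
  assumes "u \<in> V" "v \<in> V" "u \<noteq> v" "{u, v} \<notin> e ` {1..m}"
  shows "\<exists>i j. 1 \<le> i \<and> i \<le> j \<and> j \<le> n \<and> {u, v} = {ear i, r j}"
proof -
  define entry where "entry w = (LEAST t. w \<in> tri t)" for w
  have entry: "w \<in> tri (entry w)" "entry w \<le> n" if "w \<in> V" for w
  proof -
    obtain t where "t \<le> n" "w \<in> tri t" using verts_cover[of w] \<open>w \<in> V\<close> unfolding tri_def by blast
    then show "w \<in> tri (entry w)" "entry w \<le> n"
      unfolding entry_def using LeastI[of "\<lambda>t. w \<in> tri t" t] Least_le[of "\<lambda>t. w \<in> tri t" t] by auto
  qed
  have main: "\<exists>i j. 1 \<le> i \<and> i \<le> j \<and> j \<le> n \<and> u = ear i \<and> v = r j"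
    if uv: "u \<in> V" "v \<in> V" "u \<noteq> v" "{u, v} \<notin> e ` {1..m}" and le: "entry u \<le> entry v" for u v
  proof -
    define j where "j = entry v"
    have j: "v \<in> tri j" "j \<le> n" using entry uv unfolding j_def by blast+
    have uj: "u \<notin> tri j" using tri_arc[of j u v] uv j by blast
    then have lt: "entry u < j" using entry(1)[OF uv(1)] le unfolding j_def by (metis le_neq_implies_less)
    have "v \<notin> tri (j - 1)"
      using lt not_less_Least[of "j - 1" "\<lambda>t. v \<in> tri t"] unfolding j_def entry_def by simp
    moreover have "tri j \<subseteq> insert (r j) (tri (j - 1))"
      using pq_Suc[of "j - 1"] lt j unfolding tri_def by auto
    ultimately have v: "v = r j" using j by blast
    \<comment> \<open>The first triangle after the entry of \<open>u\<close> that misses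
      \<open>u\<close>. Its predecessor contains \<open>u\<close>, so \<open>u\<close> is the vertex
      of that predecessor off the diagonal \<open>i\<close>.\<close>
    define i where "i = (LEAST t. entry u < t \<and> u \<notin> tri t)"
    have i: "entry u < i" "u \<notin> tri i" "i \<le> j"
      unfolding i_def using LeastI[of "\<lambda>t. entry u < t \<and> u \<notin> tri t" j]
        Least_le[of "\<lambda>t. entry u < t \<and> u \<notin> tri t" j] lt uj by auto
    have "u \<in> tri (i - 1)"
    proof (cases "i - 1 = entry u")
      case False
      then show ?thesis
        using not_less_Least[of "i - 1" "\<lambda>t. entry u < t \<and> u \<notin> tri t"] i unfolding i_def[symmetric] by auto
    qed (use entry uv in auto)
    then have "u = ear i" using ear(1)[of i] i j unfolding tri_def by auto
    moreover have "1 \<le> i" using i(1) by simp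
    ultimately show ?thesis using v i(3) j(2) by blast
  qed
  show ?thesis
  proof (cases "entry u \<le> entry v")
    case True
    then show ?thesis using main[of u v] assms by auto
  next
    case False
    then show ?thesis using main[of v u] assms by (auto simp: insert_commute)
  qed
qed

section \<open>The numerators as a recursion\<close>

definition lab :: "nat \<Rightarrow> nat \<Rightarrow> nat" where "lab u v = inv_into {1..m} e {u, v}"

lemma lab: "{u, v} \<in> e ` {1..m} \<Longrightarrow> lab u v \<in> {1..m} \<and> e (lab u v) = {u, v}"
  unfolding lab_def by (metis f_inv_into_f inv_into_into)

lemma lab_eq: "a \<in> {1..m} \<Longrightarrow> e a = {u, v} \<Longrightarrow> lab u v = a"
  unfolding lab_def using inj inv_into_f_f by metis

lemma lab_commute: "lab u v = lab v u"
  by (simp add: lab_def insert_commute)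

lemma lab_diag: "t \<in> {1..n} \<Longrightarrow> lab (p t) (q t) = t"
  using lab_eq[of t] diag[of t] nm by auto

lemma lab_tri:
  "t \<le> n \<Longrightarrow> u \<in> tri t \<Longrightarrow> v \<in> tri t \<Longrightarrow> u \<noteq> v \<Longrightarrow> lab u v \<in> {1..m} \<and> e (lab u v) = {u, v}"
  by (rule lab) (rule tri_arc)

text \<open>
  The sum, over all ways of matching the triangles \<open>i - 1\<close>, ..., \<open>i + k - 1\<close> bijectively to
  incident vertices other than \<open>ear i\<close> and \<open>v\<close>, of the products of the variables of the sides
  opposite to the chosen vertices.
\<close>

primrec matching_sum :: "(nat \<Rightarrow> 'a::comm_semiring_1) \<Rightarrow> nat \<Rightarrow> nat \<Rightarrow> nat \<Rightarrow> 'a" where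
  "matching_sum z i 0 v = z (lab (ear i) v)"
| "matching_sum z i (Suc k) v =
    (if v = r (i + k)
     then z (lab (r (i + k)) (q (i + k))) * matching_sum z i k (p (i + k)) +
          z (lab (p (i + k)) (r (i + k))) * matching_sum z i k (q (i + k))
     else z (i + k) * matching_sum z i k v)"

text \<open>The vertices \<open>v\<close> for which \<open>matching_sum z i k v\<close> is
  meaningful, namely those of the last triangle \<open>i + k - 1\<close>. For \<open>k = 0\<close>
  this is the triangle \<open>i - 1\<close>, whose third vertex \<open>ear i\<close> is already left
  out.\<close>

definition last_verts :: "nat \<Rightarrow> nat \<Rightarrow> nat set" where
  "last_verts i k = (if k = 0 then {p i, q i} else tri (i + k - 1))"

lemma pq_last_verts: "i + k \<le> n \<Longrightarrow> {p (i + k), q (i + k)} \<subseteq> last_verts i k"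
  using pq_Suc[of "i + k - 1"] by (cases k) (auto simp: last_verts_def)

lemma last_verts_Suc: "v \<in> last_verts i (Suc k) \<Longrightarrow> v \<noteq> r (i + k) \<Longrightarrow> v \<in> {p (i + k), q (i + k)}"
  by (auto simp: last_verts_def tri_def)

lemma ear_labs:
  assumes "1 \<le> i" "i \<le> n" "v \<in> {p i, q i}"
  shows "lab (ear i) v \<in> {1..m} \<and> e (lab (ear i) v) = {ear i, v}"
proof (rule lab_tri)
  show "i - 1 \<le> n" "ear i \<in> tri (i - 1)" "v \<in> tri (i - 1)" "ear i \<noteq> v"
    using assms ear[of i] by auto
qed

lemma matching_sum_mpolys:
  assumes "1 \<le> i" "i \<le> n" "i + k \<le> Suc n" "v \<in> last_verts i k"
  shows "matching_sum indet i k v \<in> mpolys m"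
  using assms(3,4)
proof (induction k arbitrary: v)
  case 0
  then have "v \<in> {p i, q i}" by (simp add: last_verts_def)
  then show ?case using ear_labs[OF assms(1,2)] by (simp add: mpolys_indet)
next
  case (Suc k)
  then have t: "i + k \<le> n" by simp
  have IH: "matching_sum indet i k w \<in> mpolys m" if "w \<in> {p (i + k), q (i + k)}" for w
    using Suc.IH that pq_last_verts[OF t] t by auto
  have "indet (i + k) \<in> mpolys m" using t nm assms(1) by (intro mpolys_indet) auto
  moreover have "indet (lab (r (i + k)) (q (i + k))) \<in> mpolys m"
    "indet (lab (p (i + k)) (r (i + k))) \<in> mpolys m"
    using lab sides_in[OF t] by (simp_all only: mpolys_indet)
  ultimately show ?case
    using IH last_verts_Suc[OF Suc.prems(2)] by (auto intro!: mpolys_add mpolys_mult)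
qed

lemma eval_matching_sum:
  "eval_mpoly of_int z (matching_sum indet i k v) = matching_sum z i k v"
  by (induction k arbitrary: v) (simp_all add: eval_mpoly_add eval_mpoly_mult)

text \<open>Up to the diagonal \<open>l\<close> both values at the ends of the entry side are
  positive, and at most one of the two weights at the next apex is zero. Beyond \<open>l\<close>
  both weights are 1, since no side at a later apex is labelled \<open>l\<close>, so it suffices
  that the two values are not both zero.\<close>

lemma matching_sum_positive:
  fixes h :: "nat \<Rightarrow> int"
  assumes i: "1 \<le> i" "i + k \<le> n" and l: "l \<in> {1..n}"
    and h: "h = (\<lambda>a. if a = l then 0 else 1)"
  shows "matching_sum h i (Suc k) (r (i + k)) > 0"
proof -
  let ?a = "\<lambda>k. matching_sum h i k (p (i + k))" and ?b = "\<lambda>k. matching_sum h i k (q (i + k))"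
  \<comment> \<open>Passing \<open>l\<close> multiplies the value that is kept by 0, so beyond it
    only the sum is known to be positive; the last conjunct records the stronger bound needed up to
    \<open>l\<close>.\<close>
  let ?inv = "\<lambda>k. ?a k \<ge> 0 \<and> ?b k \<ge> 0 \<and> ?a k + ?b k > 0 \<and> (i + k \<le> l \<longrightarrow> ?a k > 0 \<and> ?b k > 0)"
  have sum: "matching_sum h i (Suc k) (r (i + k)) > 0" if k: "i + k \<le> n" and inv: "?inv k" for k
  proof -
    let ?t = "i + k"
    have labs: "e (lab (r ?t) (q ?t)) = {r ?t, q ?t}" "e (lab (p ?t) (r ?t)) = {p ?t, r ?t}"
      using lab sides_in[OF k] by auto
    then have ne: "lab (r ?t) (q ?t) \<noteq> lab (p ?t) (r ?t)"
      using distinct[OF k] by (metis doubleton_eq_iff)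
    show ?thesis
    proof (cases "?t \<le> l")
      case True
      then show ?thesis using ne inv by (auto simp: h)
    next
      case False
      then have "r ?t \<notin> e l" using diag_r_new[of l ?t] l k by auto
      then have "lab (r ?t) (q ?t) \<noteq> l" "lab (p ?t) (r ?t) \<noteq> l" using labs by auto
      then show ?thesis using inv by (simp add: h)
    qed
  qed
  have "?inv k" if "i + k \<le> n" for k
    using that
  proof (induction k)
    case 0
    have labs: "e (lab (ear i) (p i)) = {ear i, p i}" "e (lab (ear i) (q i)) = {ear i, q i}"
      using ear_labs[of i] 0 i by auto
    have ne: "lab (ear i) (p i) \<noteq> lab (ear i) (q i)"
      using labs distinct[of i] 0 by (metis add_0_right doubleton_eq_iff)
    have "i \<le> l \<Longrightarrow> lab (ear i) (p i) \<noteq> l \<and> lab (ear i) (q i) \<noteq> l"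
      using diag_ear_gone[of i l] labs l i by auto
    then show ?case using ne by (auto simp: h)
  next
    case (Suc k)
    then have k: "i + k \<le> n" "i + k < n" and inv: "?inv k" by auto
    have r: "matching_sum h i (Suc k) (r (i + k)) > 0" using sum k inv by blast
    have keep: "matching_sum h i (Suc k) v \<ge> 0 \<and> (Suc (i + k) \<le> l \<longrightarrow> matching_sum h i (Suc k) v > 0)"
      if "v \<in> {p (i + k), q (i + k)}" for v
    proof -
      have "matching_sum h i (Suc k) v = h (i + k) * matching_sum h i k v"
        using that distinct[OF k(1)] by auto
      moreover have "matching_sum h i k v \<ge> 0" "i + k \<le> l \<Longrightarrow> matching_sum h i k v > 0"
        using that inv by blast+
      moreover have "h (i + k) \<ge> 0" "Suc (i + k) \<le> l \<Longrightarrow> h (i + k) > 0" by (auto simp: h)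
      ultimately show ?thesis by (simp del: matching_sum.simps)
    qed
    from step[OF k(2)] show ?case
    proof
      assume "p (Suc (i + k)) = p (i + k) \<and> q (Suc (i + k)) = r (i + k)"
      then show ?thesis using r keep[of "p (i + k)"] by (simp del: matching_sum.simps)
    next
      assume "p (Suc (i + k)) = r (i + k) \<and> q (Suc (i + k)) = q (i + k)"
      then show ?thesis using r keep[of "q (i + k)"] by (simp del: matching_sum.simps)
    qed
  qed
  then show ?thesis using sum i(2) by blast
qed

end

section \<open>Lambda lengths and cluster variables\<close>

text \<open>
  Up to sign a determinant of vectors attached to the vertices; the Pluecker relation is the
  Ptolemy relation.
\<close>

definition len :: "(nat \<Rightarrow> 'k \<times> 'k) \<Rightarrow> nat \<Rightarrow> nat \<Rightarrow> 'k::field_char_0" where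
  "len w u v = (if u < v then 1 else -1) * (fst (w u) * snd (w v) - fst (w v) * snd (w u))"

lemma len_commute: "len w u v = len w v u"
  by (cases u v rule: linorder_cases) (auto simp: len_def)

text \<open>The sign in \<open>len\<close> makes it symmetric, so it does not matter at which of the
  four points the linear order of the vertices starts: each of the four rotations reduces to the
  Pluecker identity for 2 by 2 determinants.\<close>

lemma ptolemy:
  assumes "clockwise a b c" "clockwise c d a"
  shows "len w a c * len w b d = len w a b * len w c d + len w b c * len w d a"
proof -
  consider "a < b" "b < c" "c < d" | "b < c" "c < d" "d < a" | "c < d" "d < a" "a < b"
    | "d < a" "a < b" "b < c"
    using assms unfolding clockwise_def by linarith
  then show ?thesis
    by cases (simp_all add: len_def, algebra+)
qed

context triangle_path
begin

text \<open>The vectors are chosen triangle by triangle. Those at the entry side are linearly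
  independent because their determinant is, up to sign, a nonzero variable, so the two conditions on
  the vector at \<open>r t\<close> can be solved; since \<open>r t\<close> is new, no earlier
  condition is disturbed.\<close>

lemma ex_vectors:
  fixes x :: "nat \<Rightarrow> 'k::field_char_0"
  assumes x: "\<And>a. a \<in> {1..m} \<Longrightarrow> x a \<noteq> 0"
  shows "\<exists>w. \<forall>a\<in>{1..m}. \<forall>u v. e a = {u, v} \<longrightarrow> len w u v = x a"
proof -
  let ?P = "\<lambda>w s. len w (p s) (q s) = x (lab (p s) (q s)) \<and>
    len w (p s) (r s) = x (lab (p s) (r s)) \<and> len w (q s) (r s) = x (lab (q s) (r s))"
  have extend: "\<exists>v. len (w(c := v)) a c = y1 \<and> len (w(c := v)) b c = y2"
    if "len w a b \<noteq> 0" "c \<noteq> a" "c \<noteq> b" for w :: "nat \<Rightarrow> 'k \<times> 'k" and a b c y1 y2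
  proof -
    define D where "D = fst (w a) * snd (w b) - fst (w b) * snd (w a)"
    define s1 s2 :: 'k where "s1 = (if a < c then 1 else -1)" and "s2 = (if b < c then 1 else -1)"
    have D: "D \<noteq> 0" using that(1) unfolding len_def D_def by auto
    have s: "s1 * s1 = 1" "s2 * s2 = 1" by (auto simp: s1_def s2_def)
    \<comment> \<open>Cramer's rule; \<open>s1\<close> and \<open>s2\<close> undo the signs in
      \<open>len\<close>.\<close>
    define v where "v = ((s1 * y1 * fst (w b) - s2 * y2 * fst (w a)) / D,
      (s1 * y1 * snd (w b) - s2 * y2 * snd (w a)) / D)"
    have "fst (w a) * snd v - fst v * snd (w a) = s1 * y1 * D / D"
      unfolding v_def D_def by (simp add: algebra_simps diff_divide_distrib add_divide_distrib)
    moreover have "fst (w b) * snd v - fst v * snd (w b) = s2 * y2 * D / D"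
      unfolding v_def D_def by (simp add: algebra_simps diff_divide_distrib add_divide_distrib)
    ultimately have "len (w(c := v)) a c = y1 \<and> len (w(c := v)) b c = y2"
      using that(2,3) D s unfolding len_def s1_def[symmetric] s2_def[symmetric]
      by (simp add: mult.assoc[symmetric])
    then show ?thesis by blast
  qed
  have upd: "len (w(c := v)) a b = len w a b" if "c \<noteq> a" "c \<noteq> b" for w :: "nat \<Rightarrow> 'k \<times> 'k" and a b c v
    using that by (simp add: len_def)
  have step': "\<exists>w'. (\<forall>s\<le>t. ?P w' s)"
    if tn: "t \<le> n" and old: "\<forall>s<t. ?P w s" and pq: "len w (p t) (q t) = x (lab (p t) (q t))" for w t
  proof -
    have "lab (p t) (q t) \<in> {1..m}" using lab pq_in tn by blast
    then have "len w (p t) (q t) \<noteq> 0" using x pq by simp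
    from extend[OF this, of "r t" "x (lab (p t) (r t))" "x (lab (q t) (r t))"]
    obtain v where v: "len (w(r t := v)) (p t) (r t) = x (lab (p t) (r t))"
      "len (w(r t := v)) (q t) (r t) = x (lab (q t) (r t))"
      using distinct[OF tn] by metis
    have "?P (w(r t := v)) s" if "s \<le> t" for s
    proof (cases "s = t")
      case True
      then show ?thesis using v upd distinct[OF tn] pq by metis
    next
      case False
      then have "s < t" using that by simp
      then have "r t \<noteq> p s" "r t \<noteq> q s" "r t \<noteq> r s"
        using r_new[of s t] tn unfolding tri_def by auto
      then show ?thesis using old \<open>s < t\<close> upd by simp
    qed
    then show ?thesis by blast
  qed
  have "\<exists>w. \<forall>s\<le>t. ?P w s" if "t \<le> n" for t
    using that
  proof (induction t)
    case 0
    \<comment> \<open>Any two vectors with the prescribed determinant will do at the first side; the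
      sign undoes the one in \<open>len\<close>.\<close>
    let ?w = "(\<lambda>_. (0, 0))(p 0 := (1, 0), q 0 := (0, (if p 0 < q 0 then 1 else -1) * x (lab (p 0) (q 0))))"
    have "len ?w (p 0) (q 0) = x (lab (p 0) (q 0))" using distinct[of 0] by (simp add: len_def)
    then show ?case using step'[of 0 ?w] by blast
  next
    case (Suc t)
    then obtain w where w: "\<forall>s\<le>t. ?P w s" by auto
    have t: "t < n" using Suc by simp
    have "len w (p (Suc t)) (q (Suc t)) = x (lab (p (Suc t)) (q (Suc t)))"
      using step[OF t] w by (metis len_commute lab_commute order_refl)
    then show ?case using step'[of "Suc t" w] w Suc.prems by auto
  qed
  then obtain w where w: "\<And>s. s \<le> n \<Longrightarrow> ?P w s" by blast
  have "len w u v = x a" if a: "a \<in> {1..m}" "e a = {u, v}" for a u v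
  proof -
    obtain u' v' where "u' \<noteq> v'" "e a = {u', v'}" using arc_system_ends[OF sys a(1)] by metis
    then have "u \<noteq> v" using a(2) by (auto simp: doubleton_eq_iff)
    obtain t where t: "t \<le> n" "{u, v} \<subseteq> {p t, q t, r t}" using arcs_cover[OF a(1)] a(2) by auto
    have "len w u v = x (lab u v)"
    proof -
      have "u = p t \<and> v = q t \<or> u = p t \<and> v = r t \<or> u = q t \<and> v = r t \<or>
          v = p t \<and> u = q t \<or> v = p t \<and> u = r t \<or> v = q t \<and> u = r t"
        using t(2) \<open>u \<noteq> v\<close> by auto
      then show ?thesis
        using w[OF t(1)] len_commute[of w u v] lab_commute[of u v] by (elim disjE) simp_all
    qed
    then show ?thesis using lab_eq[OF a] by simp
  qed
  then show ?thesis by blast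
qed

end

locale lambda_lengths =
  triangle_path n m V e p q r + algebraically_independent m x
  for n m V e p q r and x :: "nat \<Rightarrow> 'k::field_char_0" +
  fixes w :: "nat \<Rightarrow> 'k \<times> 'k"
  assumes len_arc: "a \<in> {1..m} \<Longrightarrow> e a = {u, v} \<Longrightarrow> len w u v = x a"
begin

lemma len_lab: "{u, v} \<in> e ` {1..m} \<Longrightarrow> len w u v = x (lab u v)"
  using lab[of u v] len_arc[of "lab u v" u v] by simp

text \<open>At the new apex this is Ptolemy in the quadrilateral \<open>p t\<close>,
  \<open>r t\<close>, \<open>q t\<close>, \<open>ear i\<close>: the diagonal \<open>t\<close>
  contributes the new factor \<open>x t\<close>, the sides at \<open>r t\<close> are the weights.
  For an older vertex the segment is the same and only the common denominator grows.\<close>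

lemma len_matching_sum:
  assumes i: "1 \<le> i" "i \<le> n" and k: "i + k \<le> Suc n" and v: "v \<in> last_verts i k"
  shows "len w (ear i) v * (\<Prod>l\<in>{i..<i + k}. x l) = matching_sum x i k v"
  using k v
proof (induction k arbitrary: v)
  case 0
  then have "v \<in> {p i, q i}" by (simp add: last_verts_def)
  then show ?case using ear_labs[OF i] len_arc by simp
next
  case (Suc k)
  let ?t = "i + k"
  let ?X = "\<Prod>l\<in>{i..<?t}. x l"
  have t: "?t \<le> n" using Suc.prems by simp
  have IH: "len w (ear i) v * ?X = matching_sum x i k v" if "v \<in> {p ?t, q ?t}" for v
    using Suc.IH that pq_last_verts[OF t] t by auto
  have X: "(\<Prod>l\<in>{i..<i + Suc k}. x l) = ?X * x ?t" by simp
  show ?case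
  proof (cases "v = r ?t")
    case True
    have pq: "len w (p ?t) (q ?t) = x ?t"
      using len_arc[of ?t] diag[of ?t] t i nm by simp
    have "len w (p ?t) (q ?t) * len w (r ?t) (ear i) =
        len w (p ?t) (r ?t) * len w (q ?t) (ear i) + len w (r ?t) (q ?t) * len w (ear i) (p ?t)"
      by (rule ptolemy) (use cw t ear_cw i in auto)
    then have "len w (ear i) (r ?t) * ?X * x ?t =
        x (lab (r ?t) (q ?t)) * (len w (ear i) (p ?t) * ?X) +
        x (lab (p ?t) (r ?t)) * (len w (ear i) (q ?t) * ?X)"
      unfolding pq len_commute[of w "r ?t" "ear i"] len_commute[of w "q ?t" "ear i"]
        len_lab[OF sides_in(1)[OF t]] len_lab[OF sides_in(2)[OF t]]
      by algebra
    then show ?thesis using True IH X by (simp add: mult.assoc)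
  next
    case False
    then show ?thesis using IH last_verts_Suc[OF Suc.prems(2) False] X by (simp add: algebra_simps)
  qed
qed

lemma len_numerator:
  assumes "1 \<le> i" "i \<le> j" "j \<le> n"
  shows "len w (ear i) (r j) = matching_sum x i (Suc (j - i)) (r j) / (\<Prod>l\<in>{i..j}. x l)"
proof -
  have "len w (ear i) (r j) * (\<Prod>l\<in>{i..<i + Suc (j - i)}. x l) = matching_sum x i (Suc (j - i)) (r j)"
    using assms by (intro len_matching_sum) (auto simp: last_verts_def tri_def)
  moreover have set: "{i..<i + Suc (j - i)} = {i..j}" using assms by auto
  moreover have "(\<Prod>l\<in>{i..j}. x l) \<noteq> 0" using assms nm by (intro prod_indet_nonzero) auto
  ultimately show ?thesis
    unfolding set by (simp add: nonzero_eq_divide_eq del: matching_sum.simps prod.op_ivl_Suc)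
qed

lemma numerator_mpolys:
  assumes "1 \<le> i" "i \<le> j" "j \<le> n"
  shows "matching_sum indet i (Suc (j - i)) (r j) \<in> mpolys m"
  using assms by (intro matching_sum_mpolys) (auto simp: last_verts_def tri_def)

lemma numerator_integer_polynomial:
  assumes "1 \<le> i" "i \<le> j" "j \<le> n"
  shows "matching_sum x i (Suc (j - i)) (r j) \<in> integer_polynomials m x"
  unfolding integer_polynomials_def
  by (rule image_eqI[where f = "eval_mpoly of_int x",
        OF eval_matching_sum[symmetric] numerator_mpolys[OF assms]])

lemma numerator_not_divisible:
  assumes "1 \<le> i" "i \<le> j" "j \<le> n" and l: "l \<in> {1..n}"
  shows "\<not> (\<exists>g\<in>integer_polynomials m x. matching_sum x i (Suc (j - i)) (r j) = x l * g)"
proof -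
  let ?h = "\<lambda>a. if a = l then 0 else 1 :: int"
  have "matching_sum ?h i (Suc (j - i)) (r (i + (j - i))) > 0"
    using assms by (intro matching_sum_positive) auto
  then have "eval_mpoly of_int ?h (matching_sum indet i (Suc (j - i)) (r j)) \<noteq> 0"
    unfolding eval_matching_sum using assms by (simp del: matching_sum.simps)
  then show ?thesis
    using not_divisible[OF numerator_mpolys[OF assms(1-3)], of l ?h] l nm
    unfolding eval_matching_sum by auto
qed

text \<open>A zero numerator would be divisible by \<open>x i\<close>. Needed because mutation
  divides by the determinant along the flipped segment.\<close>

lemma len_nonzero:
  assumes "u \<in> V" "v \<in> V" "u \<noteq> v"
  shows "len w u v \<noteq> 0"
proof (cases "{u, v} \<in> e ` {1..m}")
  case True
  then show ?thesis using len_arc indet_nonzero by auto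
next
  case False
  then obtain i j where ij: "1 \<le> i" "i \<le> j" "j \<le> n" "{u, v} = {ear i, r j}"
    using non_arc[OF assms] by blast
  then have "len w u v = len w (ear i) (r j)" using len_commute by (metis doubleton_eq_iff)
  moreover have "matching_sum x i (Suc (j - i)) (r j) \<noteq> 0"
  proof
    assume "matching_sum x i (Suc (j - i)) (r j) = 0"
    moreover have "0 \<in> integer_polynomials m x"
      unfolding integer_polynomials_def by (rule image_eqI[of _ _ 0]) (simp_all add: mpolys_def)
    ultimately show False
      using numerator_not_divisible[OF ij(1-3), of i] ij by (auto simp del: matching_sum.simps)
  qed
  moreover have "(\<Prod>l\<in>{i..j}. x l) \<noteq> 0" using ij nm by (intro prod_indet_nonzero) auto
  ultimately show ?thesis using len_numerator[OF ij(1-3)] by simp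
qed

section \<open>Seeds as triangulations\<close>

abbreviation "R0 \<equiv> quiver_of_arrows (arc_quiver n m e)"

text \<open>The invariant of mutation: the vectors \<open>w\<close> stay fixed and only the
  triangulation moves. Frozen variables are included among the determinants.\<close>

definition triangulated_seed :: "(nat \<Rightarrow> 'k) \<Rightarrow> quiver \<Rightarrow> (nat \<Rightarrow> nat set) \<Rightarrow> bool" where
  "triangulated_seed y R e' \<longleftrightarrow> (y, R) \<in> seeds n m x R0 \<and> arc_system n m V e' \<and>
     R = quiver_of_arrows (arc_quiver n m e') \<and>
     (\<forall>a\<in>{1..m}. \<forall>u v. e' a = {u, v} \<longrightarrow> y a = len w u v)"

text \<open>The exchange relation is the Ptolemy relation of the quadrilateral around
  \<open>k\<close>, solved for the new diagonal; the old one can be cancelled by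
  \<open>len_nonzero\<close>.\<close>

lemma seed_flip:
  assumes seed: "triangulated_seed y R e'" and k: "k \<in> {1..n}"
    and cwq: "clockwise a b c" "clockwise c d a" and ek: "e' k = {a, c}"
    and quad: "{a, b} \<in> e' ` {1..m}" "{b, c} \<in> e' ` {1..m}" "{c, d} \<in> e' ` {1..m}" "{d, a} \<in> e' ` {1..m}"
  shows "triangulated_seed (mutate_cluster m k y R) (mutate_quiver n k R) (e'(k := {b, d}))"
proof -
  have S: "(y, R) \<in> seeds n m x R0" "arc_system n m V e'"
    "R = quiver_of_arrows (arc_quiver n m e')"
    and y: "\<And>l u v. l \<in> {1..m} \<Longrightarrow> e' l = {u, v} \<Longrightarrow> y l = len w u v"
    using seed unfolding triangulated_seed_def by blast+
  have "\<exists>l\<in>{1..m}. e' l = f" if "f \<in> e' ` {1..m}" for f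
    using that by auto
  with quad obtain l1 l2 l3 l4 where l: "l1 \<in> {1..m}" "l2 \<in> {1..m}" "l3 \<in> {1..m}" "l4 \<in> {1..m}"
    "e' l1 = {a, b}" "e' l2 = {b, c}" "e' l3 = {c, d}" "e' l4 = {d, a}"
    by meson
  interpret fl: flip n m V e' k l1 l2 l3 l4 a c b d
    using S(2) k l cwq ek by unfold_locales simp_all
  have km: "k \<in> {1..m}" using k nm by auto
  have "a \<in> V" "c \<in> V" "a \<noteq> c"
    using arc_system_ends[OF S(2) km] ek clockwise_distinct[OF cwq(1)] by (metis doubleton_eq_iff)+
  then have ac: "len w a c \<noteq> 0" by (rule len_nonzero)
  have "y l2 * y l4 + y l1 * y l3 = len w b d * y k"
    using ptolemy[OF cwq, of w] y[OF l(1,5)] y[OF l(2,6)] y[OF l(3,7)] y[OF l(4,8)] y[OF km ek]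
    by (simp add: mult.commute)
  then have mc: "mutate_cluster m k y R = y(k := len w b d)"
    using ac y[OF km ek] unfolding S(3) fl.mutate_arc_cluster by simp
  show ?thesis
    unfolding triangulated_seed_def
  proof (intro conjI ballI allI impI)
    show "(mutate_cluster m k y R, mutate_quiver n k R) \<in> seeds n m x R0"
      using S(1) k by (rule seeds.mutation)
    show "arc_system n m V (e'(k := {b, d}))"
      using fl.arc_system' unfolding fl.e'_def .
    show "mutate_quiver n k R = quiver_of_arrows (arc_quiver n m (e'(k := {b, d})))"
      using fl.mutate_arc_quiver S(3) unfolding fl.e'_def by simp
    fix l u v assume l: "l \<in> {1..m}" "(e'(k := {b, d})) l = {u, v}"
    show "mutate_cluster m k y R l = len w u v"
    proof (cases "l = k")
      case True
      then have "u = b \<and> v = d \<or> u = d \<and> v = b" using l(2) by (auto simp: doubleton_eq_iff)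
      then show ?thesis using True mc len_commute[of w b d] by auto
    qed (use l mc y in simp)
  qed
qed

lemma initial_seed: "triangulated_seed x R0 e"
  using seeds.initial sys len_arc unfolding triangulated_seed_def by simp

text \<open>The local condition in \<open>arc_system\<close> supplies an apex on either side of the
  mutated diagonal, so every mutation is a flip.\<close>

lemma seeds_triangulated:
  assumes "(y, R) \<in> seeds n m x R0"
  shows "\<exists>e'. triangulated_seed y R e'"
  using assms
proof (induction y R rule: seeds.induct)
  case initial
  show ?case using initial_seed by blast
next
  case (mutation y R k)
  then obtain e' where e': "triangulated_seed y R e'" by blast
  then have sys': "arc_system n m V e'" unfolding triangulated_seed_def by blast
  then obtain a c where ac: "e' k = {a, c}"
    using mutation(2) nm unfolding arc_system_def by (metis atLeastAtMost_iff le_trans)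
  then have ca: "e' k = {c, a}" by (simp add: insert_commute)
  obtain b where b: "clockwise a b c" "{a, b} \<in> e' ` {1..m}" "{b, c} \<in> e' ` {1..m}"
    using sys' mutation(2) ac unfolding arc_system_def by blast
  obtain d where d: "clockwise c d a" "{c, d} \<in> e' ` {1..m}" "{d, a} \<in> e' ` {1..m}"
    using sys' mutation(2) ca unfolding arc_system_def by blast
  show ?case
    using seed_flip[OF e' mutation(2) b(1) d(1) ac b(2,3) d(2,3)] by blast
qed

text \<open>
  Flipping the diagonals \<open>i\<close>, \<open>i + 1\<close>, ... in turn, each into a segment at \<open>ear i\<close>.
\<close>

definition flipped_upto :: "nat \<Rightarrow> nat \<Rightarrow> (nat \<Rightarrow> nat set) \<Rightarrow> bool" where
  "flipped_upto i t e' \<longleftrightarrow> (\<forall>l. l \<notin> {i..<t} \<longrightarrow> e' l = e l) \<and>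
    {ear i, p t} \<in> e' ` {1..m} \<and> {ear i, q t} \<in> e' ` {1..m}"

text \<open>Once \<open>i\<close>, ..., \<open>t - 1\<close> are flipped, the diagonal
  \<open>t\<close> bounds a triangle with \<open>ear i\<close> on one side and still bounds the one
  with \<open>r t\<close> on the other, so its flip joins these two vertices.\<close>

lemma flip_next:
  assumes i: "1 \<le> i" "i \<le> t" "t \<le> n"
    and seed: "triangulated_seed y R e'" and flipped: "flipped_upto i t e'"
  shows "triangulated_seed (mutate_cluster m t y R) (mutate_quiver n t R) (e'(t := {r t, ear i}))"
proof (rule seed_flip[OF seed])
  show "t \<in> {1..n}" using i by simp
  show "clockwise (p t) (r t) (q t)" "clockwise (q t) (ear i) (p t)" using cw ear_cw i by auto
  show "e' t = {p t, q t}" using flipped diag[of t] i unfolding flipped_upto_def by simp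
  \<comment> \<open>Diagonals with label at most \<open>t\<close> do not touch \<open>r t\<close>,
    so the flips made so far have left the arcs at \<open>r t\<close> in place.\<close>
  have old: "f \<in> e' ` {1..m}" if f: "f \<in> e ` {1..m}" "r t \<in> f" for f
  proof -
    obtain l where l: "l \<in> {1..m}" "f = e l" using f(1) by auto
    have "l \<notin> {i..<t}" using diag_r_new[of l t] i f(2) l(2) by auto
    then show ?thesis using flipped l unfolding flipped_upto_def by (metis imageI)
  qed
  show "{p t, r t} \<in> e' ` {1..m}" "{r t, q t} \<in> e' ` {1..m}"
    using old sides_in i(3) by simp_all
  show "{q t, ear i} \<in> e' ` {1..m}" "{ear i, p t} \<in> e' ` {1..m}"
    using flipped unfolding flipped_upto_def by (simp_all add: insert_commute)
qed

lemma flipped_Suc: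
  assumes i: "1 \<le> i" "i \<le> t" "t < n" and flipped: "flipped_upto i t e'"
  shows "flipped_upto i (Suc t) (e'(t := {r t, ear i}))"
proof -
  have tm: "t \<in> {1..m}" using i nm by simp
  have e't: "e' t = {p t, q t}" using flipped diag[of t] i unfolding flipped_upto_def by simp
  have "{ear i, v} \<in> (e'(t := {r t, ear i})) ` {1..m}" if "v \<in> {p t, q t, r t}" for v
  proof (cases "v = r t")
    case True
    then show ?thesis using tm by (intro image_eqI[of _ _ t]) (auto simp: insert_commute)
  next
    case False
    then have "{ear i, v} \<in> e' ` {1..m}" using flipped that unfolding flipped_upto_def by auto
    then obtain l where l: "l \<in> {1..m}" "{ear i, v} = e' l" by auto
    have "l \<noteq> t" using l(2) e't ear_gone[of i t] i unfolding tri_def by auto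
    then show ?thesis using l by (intro image_eqI[of _ _ l]) auto
  qed
  then have "{ear i, p (Suc t)} \<in> (e'(t := {r t, ear i})) ` {1..m}"
    "{ear i, q (Suc t)} \<in> (e'(t := {r t, ear i})) ` {1..m}"
    using step[OF i(3)] by auto
  moreover have "(e'(t := {r t, ear i})) l = e l" if "l \<notin> {i..<Suc t}" for l
    using that flipped i(2) unfolding flipped_upto_def by auto
  ultimately show ?thesis unfolding flipped_upto_def by blast
qed

lemma ex_flipped_seed:
  assumes "1 \<le> i" "i + k \<le> n"
  shows "\<exists>y R e'. triangulated_seed y R e' \<and> flipped_upto i (i + k) e'"
  using assms(2)
proof (induction k)
  case 0
  have "flipped_upto i i e"
    unfolding flipped_upto_def using ear_labs[of i] 0 assms(1)
    by (metis add_0_right imageI insertCI)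
  then show ?case using initial_seed by auto
next
  case (Suc k)
  then obtain y R e' where "triangulated_seed y R e'" "flipped_upto i (i + k) e'" by auto
  then show ?case
    using flip_next[of i "i + k"] flipped_Suc[of i "i + k"] assms(1) Suc.prems by fastforce
qed

lemma len_cluster_variable:
  assumes "1 \<le> i" "i \<le> j" "j \<le> n"
  shows "len w (ear i) (r j) \<in> cluster_variables n m x R0"
proof -
  obtain y R e' where "triangulated_seed y R e'" "flipped_upto i j e'"
    using ex_flipped_seed[of i "j - i"] assms by auto
  then have "triangulated_seed (mutate_cluster m j y R) (mutate_quiver n j R) (e'(j := {r j, ear i}))"
    using flip_next assms by blast
  then have "(mutate_cluster m j y R, mutate_quiver n j R) \<in> seeds n m x R0"
    "mutate_cluster m j y R j = len w (r j) (ear i)"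
    using assms nm unfolding triangulated_seed_def by auto
  then show ?thesis
    unfolding cluster_variables_def mem_Collect_eq len_commute[of w "ear i" "r j"]
    using assms by (metis atLeastAtMost_iff le_trans)
qed

lemma cluster_variableE:
  assumes "z \<in> cluster_variables n m x R0"
  obtains (arc) a where "a \<in> {1..m}" "z = x a"
    | (crossing) i j where "1 \<le> i" "i \<le> j" "j \<le> n" "z = len w (ear i) (r j)"
proof -
  obtain y R k where z: "(y, R) \<in> seeds n m x R0" "k \<in> {1..n}" "z = y k"
    using assms unfolding cluster_variables_def by auto
  obtain e' where e': "triangulated_seed y R e'" using seeds_triangulated[OF z(1)] by blast
  have "k \<in> {1..m}" using z(2) nm by simp
  then obtain u v where uv: "u \<in> V" "v \<in> V" "u \<noteq> v" "e' k = {u, v}" "y k = len w u v"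
    using e' arc_system_ends[of n m V e' k] unfolding triangulated_seed_def by metis
  show thesis
  proof (cases "{u, v} \<in> e ` {1..m}")
    case True
    then obtain a where a: "a \<in> {1..m}" "e a = {u, v}" by auto
    then show thesis using arc[of a] len_arc[OF a] uv(5) z(3) by simp
  next
    case False
    then obtain i j where ij: "1 \<le> i" "i \<le> j" "j \<le> n" "{u, v} = {ear i, r j}"
      using non_arc[OF uv(1-3)] by blast
    then have "len w u v = len w (ear i) (r j)" using len_commute by (metis doubleton_eq_iff)
    then show thesis using crossing[OF ij(1-3)] uv(5) z(3) by simp
  qed
qed

text \<open>For uniqueness, a rival \<open>f\<close> also comes from one of the listed cluster
  variables. If that variable is \<open>x a\<close> for an arc \<open>a\<close>, then
  \<open>f\<close> contains the factor \<open>x i\<close>; otherwise both fractions are reduced, so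
  their denominators and hence the indices agree.\<close>

theorem cluster_numerator_eq:
  assumes ij: "1 \<le> i" "i \<le> j" "j \<le> n"
  shows "cluster_numerator n m x R0 i j = matching_sum x i (Suc (j - i)) (r j)"
  unfolding cluster_numerator_def
proof (rule the_equality)
  let ?M = "\<lambda>i j. matching_sum x i (Suc (j - i)) (r j)"
  show "?M i j \<in> integer_polynomials m x \<and>
      (\<forall>k\<in>{1..n}. \<not> (\<exists>g\<in>integer_polynomials m x. ?M i j = x k * g)) \<and>
      ?M i j / (\<Prod>k\<in>{i..j}. x k) \<in> cluster_variables n m x R0"
    using numerator_integer_polynomial[OF ij] numerator_not_divisible[OF ij]
      len_cluster_variable[OF ij] len_numerator[OF ij] by (simp del: matching_sum.simps)
  fix f
  assume "f \<in> integer_polynomials m x \<and>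
      (\<forall>k\<in>{1..n}. \<not> (\<exists>g\<in>integer_polynomials m x. f = x k * g)) \<and>
      f / (\<Prod>k\<in>{i..j}. x k) \<in> cluster_variables n m x R0"
  then have f: "f \<in> integer_polynomials m x" "\<And>k. k \<in> {1..n} \<Longrightarrow> \<not> (\<exists>g\<in>integer_polynomials m x. f = x k * g)"
    and var: "f / (\<Prod>k\<in>{i..j}. x k) \<in> cluster_variables n m x R0" by blast+
  have nz: "(\<Prod>k\<in>{i..j}. x k) \<noteq> 0" using ij nm by (intro prod_indet_nonzero) auto
  from var show "f = ?M i j"
  proof (cases rule: cluster_variableE)
    case (arc a)
    let ?G = "indet a * (\<Prod>k\<in>{Suc i..j}. indet k)"
    have "{i..j} = insert i {Suc i..j}" using ij by auto
    then have "f = x i * eval_mpoly of_int x ?G"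
      using arc nz by (simp add: eval_mpoly_mult eval_mpoly_prod divide_eq_eq)
    moreover have "?G \<in> mpolys m"
      using arc ij nm by (intro mpolys_mult mpolys_indet mpolys_prod_indet) auto
    ultimately show ?thesis using f(2)[of i] ij unfolding integer_polynomials_def by auto
  next
    case (crossing i' j')
    have eq: "f / (\<Prod>k\<in>{i..j}. x k) = ?M i' j' / (\<Prod>k\<in>{i'..j'}. x k)"
      using crossing(4) len_numerator[OF crossing(1-3)] by simp
    note M = numerator_integer_polynomial[OF crossing(1-3)]
    have sub: "{i..j} \<subseteq> {1..m}" "{i'..j'} \<subseteq> {1..m}" using ij crossing nm by auto
    have "{i..j} \<subseteq> {i'..j'}"
      using f(2) ij by (intro denominator_subset[OF f(1) M sub eq]) auto
    moreover have "{i'..j'} \<subseteq> {i..j}"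
      using numerator_not_divisible[OF crossing(1-3)] crossing(1-3)
      by (intro denominator_subset[OF M f(1) sub(2,1) eq[symmetric]]) auto
    ultimately have "i = i'" "j = j'" using ij crossing(1-3) by auto
    then show ?thesis using eq nz by (simp del: matching_sum.simps)
  qed
qed

end

section \<open>The triangles of the polygon\<close>

lemma ex_extremal:
  fixes f :: "nat \<Rightarrow> nat"
  assumes "finite S" "S \<noteq> {}"
  shows "\<exists>t\<in>S. \<forall>s\<in>S. f s \<le> f t" "\<exists>t\<in>S. \<forall>s\<in>S. f t \<le> f s"
proof -
  have "Max (f ` S) \<in> f ` S" "Min (f ` S) \<in> f ` S" using assms by auto
  then obtain t t' where "t \<in> S" "f t = Max (f ` S)" "t' \<in> S" "f t' = Min (f ` S)" by auto
  then show "\<exists>t\<in>S. \<forall>s\<in>S. f s \<le> f t" "\<exists>t\<in>S. \<forall>s\<in>S. f t \<le> f s"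
    using assms by (metis Max_ge Min_le finite_imageI imageI)+
qed

text \<open>Cutting the circle at \<open>u\<close>: the vertices before \<open>u\<close> are shifted
  past all others, which turns the cyclic order seen from \<open>u\<close> into the order of
  numbers.\<close>

lemma ex_clockwise_position:
  assumes "finite V"
  obtains f :: "nat \<Rightarrow> nat" where
    "\<And>s t. s \<in> V \<Longrightarrow> t \<in> V \<Longrightarrow> s \<noteq> u \<Longrightarrow> t \<noteq> u \<Longrightarrow> f s < f t \<longleftrightarrow> clockwise u s t"
proof
  fix s t assume st: "s \<in> V" "t \<in> V" "s \<noteq> u" "t \<noteq> u"
  let ?N = "Suc (Max V)"
  have "s < ?N" "t < ?N" using Max_ge[OF assms] st by (simp_all add: less_Suc_eq_le)
  then show "(if u < s then s else s + ?N) < (if u < t then t else t + ?N) \<longleftrightarrow> clockwise u s t"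
    using st by (auto simp: clockwise_def)
qed

lemma ex_first:
  assumes "finite V" "S \<subseteq> V - {u}" "S \<noteq> {}"
  shows "\<exists>t\<in>S. \<forall>s\<in>S. \<not> clockwise u s t"
proof -
  obtain f :: "nat \<Rightarrow> nat" where
    f: "\<And>s t. s \<in> V \<Longrightarrow> t \<in> V \<Longrightarrow> s \<noteq> u \<Longrightarrow> t \<noteq> u \<Longrightarrow> f s < f t \<longleftrightarrow> clockwise u s t"
    using ex_clockwise_position[OF assms(1)] by blast
  obtain t where "t \<in> S" "\<forall>s\<in>S. f t \<le> f s"
    using ex_extremal(2)[of S f] assms finite_subset by blast
  then have "\<not> clockwise u s t" if "s \<in> S" for s
    using that f[of s t] assms(2) by (auto simp: not_less[symmetric])
  then show ?thesis using \<open>t \<in> S\<close> by blast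
qed

lemma ex_last:
  assumes "finite V" "S \<subseteq> V - {u}" "S \<noteq> {}"
  shows "\<exists>t\<in>S. \<forall>s\<in>S. \<not> clockwise u t s"
proof -
  obtain f :: "nat \<Rightarrow> nat" where
    f: "\<And>s t. s \<in> V \<Longrightarrow> t \<in> V \<Longrightarrow> s \<noteq> u \<Longrightarrow> t \<noteq> u \<Longrightarrow> f s < f t \<longleftrightarrow> clockwise u s t"
    using ex_clockwise_position[OF assms(1)] by blast
  obtain t where "t \<in> S" "\<forall>s\<in>S. f s \<le> f t"
    using ex_extremal(1)[of S f] assms finite_subset by blast
  then have "\<not> clockwise u t s" if "s \<in> S" for s
    using that f[of t s] assms(2) by (auto simp: not_less[symmetric])
  then show ?thesis using \<open>t \<in> S\<close> by blast
qed

locale polygon =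
  fixes n :: nat and T :: labelled_polygon
  assumes n1: "1 \<le> n" and tp: "triangulated_polygon T"
    and diags: "diags T = {1..n}" and sides: "sides T = {n + 1..2 * n + 3}"
begin

abbreviation "m \<equiv> 2 * n + 3"
abbreviation "V \<equiv> verts T"
abbreviation "E \<equiv> ends T ` {1..m}"

lemma arcs: "arcs T = {1..m}"
  unfolding arcs_def diags sides by auto

lemma finV: "finite V" and cardV: "card V \<ge> 3"
  using tp unfolding triangulated_polygon_def by auto

lemma polygon_facts:
  "bij_betw (ends T) (sides T) (boundary_segments V)"
  "inj_on (ends T) (diags T)"
  "ends T ` diags T \<subseteq> diagonal_segments V"
  "\<forall>e\<in>ends T ` diags T. \<forall>f\<in>ends T ` diags T. \<not> crossing e f"
  "\<forall>e\<in>diagonal_segments V. (\<forall>f\<in>ends T ` diags T. \<not> crossing e f) \<longrightarrow> e \<in> ends T ` diags T"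
  using tp unfolding triangulated_polygon_def by simp_all

lemma E_eq: "E = ends T ` diags T \<union> boundary_segments V"
proof -
  have "ends T ` sides T = boundary_segments V"
    using polygon_facts(1) unfolding bij_betw_def by (rule conjunct2)
  moreover have "{1..m} = diags T \<union> sides T" using arcs unfolding arcs_def by simp
  ultimately show ?thesis by (metis image_Un)
qed

lemma diag_seg: "l \<in> {1..n} \<Longrightarrow> ends T l \<in> diagonal_segments V"
  using polygon_facts(3) diags by blast

lemma boundaryI: "cw_next V u v \<Longrightarrow> {u, v} \<in> E"
  unfolding E_eq boundary_segments_def by blast

lemma E_verts: "{u, v} \<in> E \<Longrightarrow> u \<in> V \<and> v \<in> V \<and> u \<noteq> v"
proof -
  assume "{u, v} \<in> E"
  then have "{u, v} \<in> diagonal_segments V \<or> {u, v} \<in> boundary_segments V"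
    using polygon_facts(3) unfolding E_eq by blast
  then show ?thesis
    unfolding diagonal_segments_def boundary_segments_def cw_next_def
    by (auto simp: doubleton_eq_iff)
qed

lemma boundary_not_separating:
  assumes "{u, w} \<in> boundary_segments V" "v \<in> V" "z \<in> V" "clockwise u v w" "clockwise w z u"
  shows False
proof -
  from assms(1) consider "cw_next V u w" | "cw_next V w u"
    unfolding boundary_segments_def by (auto simp: doubleton_eq_iff)
  then show False using assms(2-5) unfolding cw_next_def by cases blast+
qed

text \<open>Two diagonals do not cross by assumption, and a boundary side crosses nothing because
  all vertices lie on one side of it.\<close>

lemma noncrossing_E: "noncrossing E"
  unfolding noncrossing_def
proof (intro allI impI notI)
  fix u v w z
  assume A: "{u, w} \<in> E" "{v, z} \<in> E" "clockwise u v w" "clockwise w z u"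
  note V = E_verts[OF A(1)] E_verts[OF A(2)]
  have rot: "clockwise v w z" "clockwise z u v"
    using clockwise_extend[OF A(3,4)] clockwise_rotate by metis+
  have "\<not> ({u, w} \<in> ends T ` diags T \<and> {v, z} \<in> ends T ` diags T)"
  proof
    assume "{u, w} \<in> ends T ` diags T \<and> {v, z} \<in> ends T ` diags T"
    then have "\<not> crossing {u, w} {v, z}"
      using polygon_facts(4) by blast
    then show False unfolding crossing_def using A(3,4) by blast
  qed
  then have "{u, w} \<in> boundary_segments V \<or> {v, z} \<in> boundary_segments V"
    using A(1,2) unfolding E_eq by blast
  then show False
    using boundary_not_separating[of u w v z] boundary_not_separating[of v z w u] A(3,4) V rot by blast
qed

lemma ex_next:
  assumes "v \<in> V"
  shows "\<exists>u. cw_next V v u"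
proof -
  have "V - {v} \<noteq> {}"
  proof
    assume "V - {v} = {}"
    then have "V \<subseteq> {v}" by blast
    then have "card V \<le> card {v}" by (intro card_mono) auto
    then show False using cardV by simp
  qed
  then obtain t where t: "t \<in> V - {v}" "\<forall>s\<in>V - {v}. \<not> clockwise v s t"
    using ex_first[OF finV subset_refl] by blast
  have "\<not> (\<exists>w\<in>V. clockwise v w t)" using t clockwise_distinct by blast
  then show ?thesis unfolding cw_next_def using t assms by blast
qed

text \<open>Take the last neighbour \<open>t\<close> of \<open>u\<close> before \<open>v\<close>. An
  arc crossing \<open>{t, v}\<close> would end at \<open>u\<close> and give a later neighbour, or
  cross \<open>{u, v}\<close> or \<open>{u, t}\<close>. So nothing crosses \<open>{t, v}\<close>,
  and unless it is a boundary side, maximality of the triangulation makes it an arc.\<close>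

lemma ex_apex:
  assumes uv: "{u, v} \<in> E" and x: "x \<in> V" "clockwise u x v"
  shows "\<exists>t. clockwise u t v \<and> {u, t} \<in> E \<and> {t, v} \<in> E"
proof -
  note uvV = E_verts[OF uv]
  let ?A = "{t \<in> V. clockwise u t v}"
  let ?S = "{t \<in> ?A. {u, t} \<in> E}"
  have A: "?A \<subseteq> V - {u}" using clockwise_distinct by blast
  obtain t0 where t0: "t0 \<in> ?A" "\<forall>s\<in>?A. \<not> clockwise u s t0"
    using ex_first[OF finV A] x by blast
  \<comment> \<open>The clockwise successor of \<open>u\<close> is a neighbour before
    \<open>v\<close>, so there is a last one.\<close>
  have "cw_next V u t0"
    unfolding cw_next_def using t0 uvV clockwise_trans clockwise_distinct[of u t0 v] by blast
  then have "t0 \<in> ?S" using t0 boundaryI by blast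
  then obtain t where t: "t \<in> ?S" "\<forall>s\<in>?S. \<not> clockwise u t s"
    using ex_last[OF finV, of ?S u] A by blast
  have tv: "t \<noteq> v" "t \<in> V" "clockwise u t v" "{u, t} \<in> E" using t clockwise_distinct[of u t v] by auto
  have nc: "False" if f: "{a, b} \<in> E" "clockwise t a v" "clockwise v b t" for a b
  proof -
    have utv: "clockwise v u t" using tv(3) clockwise_rotate by blast
    have a: "clockwise u a v" "clockwise u t a"
      using clockwise_extend[OF _ utv] f(2) tv(3) by (metis clockwise_extend clockwise_rotate utv)+
    consider "b = u" | "clockwise v b u" | "clockwise u b t"
      using clockwise_between[OF utv f(3)] by blast
    then show False
    proof cases
      case 1
      then have "a \<in> ?S" using a(1) f(1) E_verts[OF f(1)] by (simp add: insert_commute)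
      then show False using t(2) a(2) by blast
    next
      case 2
      then show False using noncrossing_E uv f(1) a(1) unfolding noncrossing_def by blast
    next
      case 3
      have "{b, a} \<in> E" using f(1) by (simp add: insert_commute)
      moreover have "clockwise t a u" using a(2) clockwise_rotate by blast
      ultimately show False using noncrossing_E tv(4) 3 unfolding noncrossing_def by blast
    qed
  qed
  have "{t, v} \<in> E"
  proof (cases "{t, v} \<in> boundary_segments V")
    case True
    then show ?thesis unfolding E_eq by blast
  next
    case False
    then have "{t, v} \<in> diagonal_segments V"
      unfolding diagonal_segments_def using tv uvV by blast
    moreover have "\<not> crossing {t, v} f" if "f \<in> ends T ` diags T" for f
    proof
      assume "crossing {t, v} f"
      then obtain p q r s where c: "{t, v} = {p, r}" "f = {q, s}" "clockwise p q r" "clockwise r s p"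
        unfolding crossing_def by blast
      have fE: "{q, s} \<in> E" "{s, q} \<in> E" using that c(2) unfolding E_eq by (auto simp: insert_commute)
      from c(1) consider "p = t" "r = v" | "p = v" "r = t" by (auto simp: doubleton_eq_iff)
      then show False using nc fE c(3,4) by cases blast+
    qed
    ultimately have "{t, v} \<in> ends T ` diags T"
      using polygon_facts(5)[rule_format, of "{t, v}"] by blast
    then show ?thesis unfolding E_eq by (rule UnI1)
  qed
  then show ?thesis using tv by blast
qed

lemma ex_apex_diag:
  assumes l: "l \<in> {1..n}" and uv: "ends T l = {u, v}"
  shows "\<exists>t. clockwise u t v \<and> {u, t} \<in> E \<and> {t, v} \<in> E"
proof -
  have uvE: "{u, v} \<in> E" using l uv diags unfolding E_eq by blast
  have "\<not> cw_next V u v"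
    using diag_seg[OF l] uv unfolding diagonal_segments_def boundary_segments_def by blast
  then obtain x where "x \<in> V" "clockwise u x v" using E_verts[OF uvE] unfolding cw_next_def by blast
  then show ?thesis using ex_apex[OF uvE] by blast
qed

lemma inj_ends: "inj_on (ends T) {1..m}"
proof -
  have "inj_on (ends T) (diags T)" "inj_on (ends T) (sides T)"
    "ends T ` sides T = boundary_segments V" "ends T ` diags T \<subseteq> diagonal_segments V"
    using polygon_facts unfolding bij_betw_def by simp_all
  moreover from this have "ends T ` diags T \<inter> ends T ` sides T = {}"
    unfolding diagonal_segments_def by blast
  ultimately have "inj_on (ends T) (diags T \<union> sides T)"
    unfolding inj_on_Un by blast
  then show ?thesis using arcs unfolding arcs_def by simp
qed

lemma arc_system: "arc_system n m V (ends T)"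
proof -
  have "\<exists>u v. u \<in> V \<and> v \<in> V \<and> u \<noteq> v \<and> ends T a = {u, v}" if "a \<in> {1..m}" for a
  proof -
    have "ends T a \<in> E" using that by (rule imageI)
    then have "ends T a \<in> diagonal_segments V \<or> ends T a \<in> boundary_segments V"
      using polygon_facts(3) unfolding E_eq by blast
    then show ?thesis
      unfolding diagonal_segments_def boundary_segments_def cw_next_def by blast
  qed
  then show ?thesis
    using inj_ends noncrossing_E ex_apex_diag unfolding arc_system_def by simp
qed

text \<open>A triangle of three boundary sides leaves no room for a further vertex, and then the
  diagonal 1 would have its ends among these three.\<close>

lemma triangle_has_diagonal:
  assumes "clockwise u c w" "{u, c} \<in> E" "{c, w} \<in> E" "{w, u} \<in> E"
  shows "\<exists>l\<in>{1..n}. ends T l \<subseteq> {u, c, w}"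
proof (rule ccontr)
  assume "\<not> ?thesis"
  then have no: "\<And>f. f \<in> ends T ` diags T \<Longrightarrow> \<not> f \<subseteq> {u, c, w}" using diags by auto
  have nxt: "cw_next V a b" if "{a, b} \<in> E" "{a, b} \<subseteq> {u, c, w}" "clockwise a b d" "d \<in> V" for a b d
  proof -
    have "{a, b} \<in> boundary_segments V" using that(1,2) no[of "{a, b}"] unfolding E_eq by blast
    then have "cw_next V a b \<or> cw_next V b a"
      unfolding boundary_segments_def by (auto simp: doubleton_eq_iff)
    moreover have "clockwise b d a" using that(3) by (rule clockwise_rotate)
    ultimately show ?thesis using that(4) unfolding cw_next_def by blast
  qed
  have V: "u \<in> V" "c \<in> V" "w \<in> V" using E_verts assms by blast+
  have n: "cw_next V u c" "cw_next V c w" "cw_next V w u"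
    using nxt[OF assms(2)] nxt[OF assms(3)] nxt[OF assms(4)] V assms(1)
      clockwise_rotate[OF assms(1)] clockwise_rotate[OF clockwise_rotate[OF assms(1)]] by auto
  have "x \<in> {u, c, w}" if "x \<in> V" for x
  proof (rule ccontr)
    assume "x \<notin> {u, c, w}"
    then have x: "x \<noteq> u" "x \<noteq> c" "x \<noteq> w" by auto
    have "clockwise u x w \<or> clockwise w x u"
      using clockwise_total[of u x w] x clockwise_distinct[OF assms(1)] clockwise_rotate by metis
    then have "clockwise u x c \<or> clockwise c x w \<or> clockwise w x u"
      using clockwise_between[OF assms(1), of x] x by blast
    then show False using n that unfolding cw_next_def by blast
  qed
  moreover obtain a b where "ends T 1 = {a, b}" "a \<in> V" "b \<in> V"
    using diag_seg[of 1] n1 unfolding diagonal_segments_def by auto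
  ultimately have "ends T 1 \<subseteq> {u, c, w}" by auto
  then show False using no[of "ends T 1"] diags n1 by auto
qed

end

section \<open>The path of triangles read off from the quiver\<close>

locale path_polygon = polygon n T for n T +
  assumes path: "diagonal_quiver T \<union> (diagonal_quiver T)\<inverse> =
    {(a, b). a \<in> {1..n} \<and> b \<in> {1..n} \<and> (b = a + 1 \<or> a = b + 1)}"
begin

definition triangle :: "nat \<Rightarrow> nat \<Rightarrow> nat \<Rightarrow> bool" where
  "triangle a b c \<longleftrightarrow> clockwise a b c \<and> {a, b} \<in> E \<and> {b, c} \<in> E \<and> {c, a} \<in> E"

lemma triangle_rotate: "triangle a b c \<Longrightarrow> triangle b c a"
  using clockwise_rotate unfolding triangle_def by blast

lemma triangleI:
  "clockwise a b c \<Longrightarrow> {a, b} \<in> E \<Longrightarrow> {b, c} \<in> E \<Longrightarrow> {a, c} \<in> E \<Longrightarrow> triangle a b c"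
  unfolding triangle_def by (simp add: insert_commute)

lemma triangle_unique: "triangle u t v \<Longrightarrow> triangle u t' v \<Longrightarrow> t = t'"
  using apex_unique[OF noncrossing_E, of u t v t'] unfolding triangle_def by blast

lemma triangle_ends_iff:
  assumes "a \<in> {1..m}" "b \<in> {1..m}"
  shows "triangle p q r \<and> ends T a = {p, q} \<and> ends T b = {q, r} \<longleftrightarrow>
    clockwise p q r \<and> ends T a = {p, q} \<and> ends T b = {q, r} \<and> {r, p} \<in> E"
proof -
  have "ends T a \<in> E" "ends T b \<in> E" using assms by (simp_all only: imageI)
  then show ?thesis unfolding triangle_def by metis
qed

lemma follows_in_triangle_iff:
  "follows_in_triangle T a b \<longleftrightarrow> a \<in> {1..m} \<and> b \<in> {1..m} \<and>
    (\<exists>p q r. triangle p q r \<and> ends T a = {p, q} \<and> ends T b = {q, r})"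
proof (cases "a \<in> {1..m} \<and> b \<in> {1..m}")
  case True
  have "follows_in_triangle T a b \<longleftrightarrow> (\<exists>p q r. clockwise p q r \<and> ends T a = {p, q} \<and> ends T b = {q, r} \<and>
      (\<exists>c\<in>{1..m}. ends T c = {r, p}))"
    unfolding follows_in_triangle_def cw_triangle_def arcs using True by blast
  also have "\<dots> \<longleftrightarrow> (\<exists>p q r. clockwise p q r \<and> ends T a = {p, q} \<and> ends T b = {q, r} \<and> {r, p} \<in> E)"
    unfolding image_iff by (simp only: eq_commute)
  finally show ?thesis using True by (simp only: triangle_ends_iff simp_thms)
next
  case False
  then show ?thesis unfolding follows_in_triangle_def cw_triangle_def arcs by blast
qed

lemma follows_adjacent:
  assumes "l \<in> {1..n}" "l' \<in> {1..n}" "triangle a b c" "ends T l = {a, b}" "ends T l' = {b, c}"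
  shows "l' = l + 1 \<or> l = l' + 1"
proof -
  have "(l, l') \<in> diagonal_quiver T"
    unfolding diagonal_quiver_def follows_in_triangle_iff using assms diags by auto
  then have "(l, l') \<in> {(a, b). a \<in> {1..n} \<and> b \<in> {1..n} \<and> (b = a + 1 \<or> a = b + 1)}"
    unfolding path[symmetric] by (rule UnI1)
  then show ?thesis by simp
qed

lemma ends_side:
  assumes "l \<in> {1..n}" "ends T l \<subseteq> {a, b, c}"
  shows "ends T l = {a, b} \<or> ends T l = {b, c} \<or> ends T l = {c, a}"
proof -
  have "l \<in> {1..m}" using assms by simp
  then obtain u v where "u \<noteq> v" "ends T l = {u, v}" using arc_system_ends[OF arc_system] by metis
  then show ?thesis using assms(2) by auto
qed

text \<open>Two diagonals in one triangle are joined by an arrow in one of the two directions, and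
  arrows join only consecutive labels.\<close>

lemma common_triangle_adjacent:
  assumes l: "l \<in> {1..n}" "l' \<in> {1..n}" "l \<noteq> l'" and t: "triangle a b c"
    and sub: "ends T l \<subseteq> {a, b, c}" "ends T l' \<subseteq> {a, b, c}"
  shows "l' = l + 1 \<or> l = l' + 1"
proof -
  note t2 = triangle_rotate[OF t] and t3 = triangle_rotate[OF triangle_rotate[OF t]]
  have "l \<in> {1..m}" "l' \<in> {1..m}" using l by auto
  then have ne: "ends T l \<noteq> ends T l'" using l(3) inj_ends by (meson inj_onD)
  consider "ends T l = {a, b}" | "ends T l = {b, c}" | "ends T l = {c, a}"
    using ends_side[OF l(1) sub(1)] by blast
  then show ?thesis
  proof cases
    case 1
    then have "ends T l' = {b, c} \<or> ends T l' = {c, a}" using ends_side[OF l(2) sub(2)] ne by auto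
    then show ?thesis using 1 follows_adjacent[OF l(1,2) t] follows_adjacent[OF l(2,1) t3] by blast
  next
    case 2
    then have "ends T l' = {a, b} \<or> ends T l' = {c, a}" using ends_side[OF l(2) sub(2)] ne by auto
    then show ?thesis using 2 follows_adjacent[OF l(1,2) t2] follows_adjacent[OF l(2,1) t] by blast
  next
    case 3
    then have "ends T l' = {a, b} \<or> ends T l' = {b, c}" using ends_side[OF l(2) sub(2)] ne by auto
    then show ?thesis using 3 follows_adjacent[OF l(1,2) t3] follows_adjacent[OF l(2,1) t2] by blast
  qed
qed

lemma ex_common_triangle:
  assumes "1 \<le> l" "l < n"
  shows "\<exists>u c v. triangle u c v \<and> ends T l = {u, v} \<and> ends T (Suc l) \<subseteq> {u, c, v}"
proof -
  have "(l, Suc l) \<in> diagonal_quiver T \<union> (diagonal_quiver T)\<inverse>"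
    unfolding path using assms by simp
  then have "follows_in_triangle T l (Suc l) \<or> follows_in_triangle T (Suc l) l"
    unfolding diagonal_quiver_def by auto
  then show ?thesis
  proof
    assume "follows_in_triangle T l (Suc l)"
    then obtain p q r where "triangle p q r" "ends T l = {p, q}" "ends T (Suc l) = {q, r}"
      unfolding follows_in_triangle_iff by (elim conjE exE) (rule that)
    moreover from this(1) have "triangle q r p" by (rule triangle_rotate)
    ultimately show ?thesis
      by (intro exI[of _ q] exI[of _ r] exI[of _ p] conjI) (simp_all add: insert_commute)
  next
    assume "follows_in_triangle T (Suc l) l"
    then obtain p q r where "triangle p q r" "ends T (Suc l) = {p, q}" "ends T l = {q, r}"
      unfolding follows_in_triangle_iff by (elim conjE exE) (rule that)
    moreover from this have "triangle r p q" using triangle_rotate by blast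
    ultimately show ?thesis
      by (intro exI[of _ r] exI[of _ p] exI[of _ q] conjI) (simp_all add: insert_commute)
  qed
qed

lemma ex_triangle_diag:
  assumes "l \<in> {1..n}" "ends T l = {u, v}"
  shows "\<exists>t. triangle u t v"
proof -
  obtain t where "clockwise u t v" "{u, t} \<in> E" "{t, v} \<in> E" using ex_apex_diag[OF assms] by blast
  moreover have "{u, v} \<in> E" using assms by (intro image_eqI[of _ _ l]) auto
  ultimately show ?thesis using triangleI by blast
qed

text \<open>The path has to start on the side of the diagonal 1 away from the diagonal 2; for
  \<open>n = 1\<close> either side will do.\<close>

lemma ex_start:
  "\<exists>a b c. triangle a c b \<and> ends T 1 = {a, c} \<and> (2 \<le> n \<longrightarrow> \<not> ends T 2 \<subseteq> {a, b, c})"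
proof -
  have one: "1 \<in> {1..n}" using n1 by simp
  show ?thesis
  proof (cases "2 \<le> n")
    case True
    then obtain u d v where d: "triangle v d u" "ends T 1 = {v, u}" "ends T 2 \<subseteq> {v, d, u}"
      using ex_common_triangle[of 1] by (auto simp: numeral_2_eq_2)
    have vu: "ends T 1 = {u, v}" using d(2) by (simp add: insert_commute)
    then obtain c where c: "triangle u c v" using ex_triangle_diag[OF one] by blast
    have two: "2 \<in> {1..n}" "2 \<in> {1..m}" "1 \<in> {1..m}" using True by auto
    then have ne: "ends T 2 \<noteq> {v, u}"
      using inj_ends d(2) by (metis inj_onD one_eq_numeral_iff semiring_norm(85))
    \<comment> \<open>The two apexes lie on opposite sides of the diagonal 1.\<close>
    have "c \<noteq> d"
      using clockwise_asym[of u c v] c d(1) clockwise_rotate[OF clockwise_rotate[of v d u]]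
      unfolding triangle_def by auto
    have "\<not> ends T 2 \<subseteq> {v, c, u}"
    proof
      assume "ends T 2 \<subseteq> {v, c, u}"
      then have "ends T 2 \<subseteq> {v, u}" using d(3) \<open>c \<noteq> d\<close> by blast
      moreover obtain x y where "x \<noteq> y" "ends T 2 = {x, y}"
        using arc_system_ends[OF arc_system two(2)] by metis
      ultimately show False using ne by auto
    qed
    then have "\<not> ends T 2 \<subseteq> {v, c, u}" by simp
    moreover have "triangle v u c" using triangle_rotate[OF triangle_rotate[OF c]] .
    ultimately show ?thesis using d(2) by (intro exI[of _ v] exI[of _ c] exI[of _ u] conjI impI)
  next
    case False
    have "1 \<in> {1..m}" by simp
    then obtain u v where vu: "ends T 1 = {u, v}" using arc_system_ends[OF arc_system] by metis
    then obtain c where c: "triangle u c v" using ex_triangle_diag[OF one] by blast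
    have "triangle v u c" by (rule triangle_rotate[OF triangle_rotate[OF c]])
    moreover have "ends T 1 = {v, u}" using vu by (simp add: insert_commute)
    ultimately show ?thesis
      using False by (intro exI[of _ v] exI[of _ c] exI[of _ u] conjI impI) simp_all
  qed
qed

definition apex :: "nat \<Rightarrow> nat \<Rightarrow> nat" where "apex u v = (SOME t. triangle u t v)"

lemma apex: "triangle u t v \<Longrightarrow> apex u v = t"
  unfolding apex_def using triangle_unique by (metis someI)

text \<open>The state after \<open>t\<close> steps is the entry side of triangle \<open>t\<close>,
  and the walk leaves through the diagonal \<open>Suc t\<close>. The exit \<open>{c, b}\<close> is a
  default, justified for \<open>t < n\<close> in the invariant below.\<close>

primrec walk :: "nat \<times> nat \<Rightarrow> nat \<Rightarrow> nat \<times> nat" where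
  "walk s 0 = s"
| "walk s (Suc t) = (let a = fst (walk s t); b = snd (walk s t); c = apex a b in
     if ends T (Suc t) = {a, c} then (a, c) else (c, b))"

text \<open>The diagonals \<open>Suc t\<close> and \<open>Suc (Suc t)\<close> share a triangle. It
  is not the one just left: that one also contains the diagonal \<open>t\<close>, and labels in one
  triangle are consecutive (for \<open>t = 0\<close> the choice of the start excludes it). So the
  exit is found in the new triangle. All triangles are met, since each has a diagonal and a diagonal
  has one triangle on either side, both on the path.\<close>

lemma ex_triangle_path:
  "\<exists>p q r. triangle_path n m V (ends T) p q r \<and>
     (\<forall>a b c. triangle a b c \<longrightarrow> (\<exists>t\<le>n. {a, b, c} = {p t, q t, r t}))"
proof -
  obtain a0 b0 c0 where start: "triangle a0 c0 b0" "ends T 1 = {a0, c0}"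
    "2 \<le> n \<longrightarrow> \<not> ends T 2 \<subseteq> {a0, b0, c0}"
    using ex_start by blast
  define p q r where "p t = fst (walk (a0, b0) t)" and "q t = snd (walk (a0, b0) t)"
    and "r t = apex (p t) (q t)" for t
  have init: "p 0 = a0" "q 0 = b0" "r 0 = c0"
    using apex[OF start(1)] by (simp_all add: p_def q_def r_def)
  have step: "p (Suc t) = (if ends T (Suc t) = {p t, r t} then p t else r t)"
    "q (Suc t) = (if ends T (Suc t) = {p t, r t} then r t else q t)" for t
    by (simp_all add: p_def q_def r_def Let_def)
  have dist: "ends T l \<noteq> ends T l'" if "l \<in> {1..n}" "l' \<in> {1..n}" "l \<noteq> l'" for l l'
  proof -
    have "l \<in> {1..m}" "l' \<in> {1..m}" using that by auto
    then show ?thesis using inj_onD[OF inj_ends] that(3) by blast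
  qed
  have inv: "triangle (p t) (r t) (q t) \<and>
      (t < n \<longrightarrow> ends T (Suc t) = {p t, r t} \<or> ends T (Suc t) = {r t, q t}) \<and>
      (0 < t \<longrightarrow> ends T t = {p t, q t})"
    if "t \<le> n" for t
    using that
  proof (induction t)
    case 0
    show ?case using start init[symmetric] by simp
  next
    case (Suc t)
    then have t: "t < n" "t \<le> n" and tri: "triangle (p t) (r t) (q t)"
      and nxt: "ends T (Suc t) = {p t, r t} \<or> ends T (Suc t) = {r t, q t}" by auto
    have pq: "ends T (Suc t) = {p (Suc t), q (Suc t)}" using nxt step[of t] by auto
    obtain z where z: "triangle (q (Suc t)) z (p (Suc t))" "{q (Suc t), z, p (Suc t)} = {p t, q t, r t}"
    proof (cases "ends T (Suc t) = {p t, r t}")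
      case True
      then have "p (Suc t) = p t" "q (Suc t) = r t" using step by simp_all
      then show thesis using that[of "q t"] triangle_rotate[OF tri] by auto
    next
      case False
      then have "p (Suc t) = r t" "q (Suc t) = q t" using step by simp_all
      then show thesis using that[of "p t"] triangle_rotate[OF triangle_rotate[OF tri]] by auto
    qed
    have St: "Suc t \<in> {1..n}" using t by simp
    obtain c where "triangle (p (Suc t)) c (q (Suc t))" using ex_triangle_diag[OF St pq] by blast
    then have r: "triangle (p (Suc t)) (r (Suc t)) (q (Suc t))" using apex unfolding r_def by metis
    have "ends T (Suc (Suc t)) = {p (Suc t), r (Suc t)} \<or> ends T (Suc (Suc t)) = {r (Suc t), q (Suc t)}"
      if n: "Suc t < n"
    proof -
      have S2: "Suc (Suc t) \<in> {1..n}" using n by simp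
      have not_back: "\<not> ends T (Suc (Suc t)) \<subseteq> {p t, q t, r t}"
      proof (cases "t = 0")
        case True
        then show ?thesis using start(3) init n by (simp add: numeral_2_eq_2)
      next
        case False
        then have "t \<in> {1..n}" "ends T t \<subseteq> {p t, r t, q t}" using Suc by auto
        then show ?thesis
          using common_triangle_adjacent[OF S2 _ _ tri, of t] by (auto simp: insert_commute)
      qed
      obtain u c v where c: "triangle u c v" "ends T (Suc t) = {u, v}" "ends T (Suc (Suc t)) \<subseteq> {u, c, v}"
        using ex_common_triangle[of "Suc t"] n by auto
      have "u = p (Suc t) \<and> v = q (Suc t) \<or> u = q (Suc t) \<and> v = p (Suc t)"
        using c(2) pq by (auto simp: doubleton_eq_iff)
      then have uv: "u = p (Suc t) \<and> v = q (Suc t)"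
      proof
        assume "u = q (Suc t) \<and> v = p (Suc t)"
        then have "c = z" using triangle_unique z(1) c(1) by blast
        then show ?thesis using c(3) z(2) not_back \<open>u = q (Suc t) \<and> v = p (Suc t)\<close> by simp
      qed
      then have "c = r (Suc t)" using triangle_unique r c(1) by blast
      then show ?thesis
        using ends_side[OF S2, of "p (Suc t)" "r (Suc t)" "q (Suc t)"] c(3) uv
          dist[OF S2 St] pq by (auto simp: insert_commute)
    qed
    then show ?case using r pq by blast
  qed
  let ?D = "\<lambda>t. {p t, q t, r t}"
  have prev: "\<exists>z. triangle (q (Suc t)) z (p (Suc t)) \<and> {q (Suc t), z, p (Suc t)} = ?D t" if "t < n" for t
  proof -
    have tri: "triangle (p t) (r t) (q t)" using inv that by simp
    show ?thesis
    proof (cases "ends T (Suc t) = {p t, r t}")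
      case True
      then have "p (Suc t) = p t" "q (Suc t) = r t" using step by simp_all
      then show ?thesis using triangle_rotate[OF tri] by (intro exI[of _ "q t"]) auto
    next
      case False
      then have "p (Suc t) = r t" "q (Suc t) = q t" using step by simp_all
      then show ?thesis
        using triangle_rotate[OF triangle_rotate[OF tri]] by (intro exI[of _ "p t"]) auto
    qed
  qed
  have diag_tri: "\<exists>t\<le>n. {u, c, v} = ?D t" 
    if c: "triangle u c v" and l: "l \<in> {1..n}" "ends T l = {u, v}" for u c v l
  proof -
    have "ends T l = {p l, q l}" and tri: "triangle (p l) (r l) (q l)" using inv[of l] l by auto
    then consider "u = p l" "v = q l" | "u = q l" "v = p l" using l(2) by (auto simp: doubleton_eq_iff)
    then show ?thesis
    proof cases
      case 1
      then have "c = r l" using triangle_unique c tri by blast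
      then show ?thesis using 1 l by (intro exI[of _ l]) auto
    next
      case 2
      obtain t where t: "l = Suc t" "t < n" using l(1) by (cases l) auto
      obtain z where "triangle (q l) z (p l)" "{q l, z, p l} = ?D t" using prev t by blast
      moreover from this have "c = z" using triangle_unique c 2 by blast
      ultimately show ?thesis using 2 t by (intro exI[of _ t]) auto
    qed
  qed
  have tris: "\<exists>t\<le>n. {a, b, c} = ?D t" if t: "triangle a b c" for a b c
  proof -
    obtain l where l: "l \<in> {1..n}" "ends T l \<subseteq> {a, b, c}"
      using triangle_has_diagonal[of a b c] t unfolding triangle_def by blast
    note t2 = triangle_rotate[OF t] and t3 = triangle_rotate[OF triangle_rotate[OF t]]
    from ends_side[OF l] consider "ends T l = {b, a}" | "ends T l = {c, b}" | "ends T l = {a, c}"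
      by (auto simp: insert_commute)
    then show ?thesis
    proof cases
      case 1
      then show ?thesis using diag_tri[OF t2 l(1)] by (simp add: insert_commute)
    next
      case 2
      then show ?thesis using diag_tri[OF t3 l(1)] by (simp add: insert_commute)
    next
      case 3
      then show ?thesis using diag_tri[OF t l(1)] by simp
    qed
  qed
  have side: "\<exists>t\<le>n. {u, v} \<subseteq> ?D t" if uv: "cw_next V u v" for u v
  proof -
    \<comment> \<open>All other vertices lie clockwise between \<open>v\<close> and
      \<open>u\<close>, so the apex is sought over the reversed pair.\<close>
    have E: "{v, u} \<in> E" using boundaryI[OF uv] by (simp add: insert_commute)
    have "\<not> V \<subseteq> {u, v}"
    proof
      assume "V \<subseteq> {u, v}"
      then have "card V \<le> card {u, v}" by (intro card_mono) auto
      also have "\<dots> \<le> 2" by (simp add: card_insert_if)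
      finally show False using cardV by simp
    qed
    then obtain x where x: "x \<in> V" "x \<noteq> u" "x \<noteq> v" by blast
    then have "clockwise u v x"
      using uv clockwise_total[of u v x] unfolding cw_next_def by blast
    then have "clockwise v x u" by (rule clockwise_rotate)
    then obtain t where "clockwise v t u" "{v, t} \<in> E" "{t, u} \<in> E" using ex_apex[OF E x(1)] by blast
    then have "triangle v t u" using E by (intro triangleI)
    then show ?thesis using tris by blast
  qed
  have cover: "\<exists>t\<le>n. ends T a \<subseteq> ?D t" if "a \<in> {1..m}" for a
  proof -
    have "ends T a \<in> E" using that by (rule imageI)
    then consider "ends T a \<in> boundary_segments V" | l where "l \<in> {1..n}" "ends T a = ends T l"
      unfolding E_eq diags by auto
    then show ?thesis
    proof cases
      case 1
      then obtain u v where "cw_next V u v" "ends T a = {u, v}" unfolding boundary_segments_def by blast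
      then show ?thesis using side by metis
    next
      case 2
      then have "ends T a = {p l, q l}" "l \<le> n" using inv[of l] by auto
      then show ?thesis by auto
    qed
  qed
  have "triangle_path n m V (ends T) p q r"
  proof
    show "arc_system n m V (ends T)" by (rule arc_system)
    show "clockwise (p t) (r t) (q t)" "{p t, r t} \<in> E" "{r t, q t} \<in> E" if "t \<le> n" for t
      using inv[OF that] unfolding triangle_def by blast+
    show "p (Suc t) = p t \<and> q (Suc t) = r t \<or> p (Suc t) = r t \<and> q (Suc t) = q t" for t
      using step[of t] by simp
    show "ends T t = {p t, q t}" if "t \<in> {1..n}" for t using inv[of t] that by auto
    show "{p 0, q 0} \<in> E" using inv[of 0] unfolding triangle_def by (simp add: insert_commute)
    show "\<exists>t\<le>n. v \<in> ?D t" if v: "v \<in> V" for v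
      using ex_next[OF v] side by blast
  qed (rule cover)
  then show ?thesis using tris by blast
qed

lemma ice_quiver_eq: "ice_quiver T = arc_quiver n m (ends T)"
proof -
  have "(a, b) \<in> ice_quiver T \<longleftrightarrow> (a, b) \<in> arc_quiver n m (ends T)" for a b
  proof -
    have "(a, b) \<in> ice_quiver T \<longleftrightarrow> (a \<in> {1..n} \<or> b \<in> {1..n}) \<and> follows_in_triangle T a b"
      unfolding ice_quiver_def diags by simp
    also have "\<dots> \<longleftrightarrow> (a \<le> n \<or> b \<le> n) \<and> follows_in_triangle T a b"
      unfolding follows_in_triangle_iff by auto
    finally show ?thesis
      unfolding arc_quiver_def follows_in_triangle_iff
      by (cases "a \<in> {1..m} \<and> b \<in> {1..m}")
        (simp_all only: triangle_ends_iff simp_thms mem_Collect_eq prod.case, blast)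
  qed
  then show ?thesis by auto
qed

end

section \<open>Perfect matchings\<close>

text \<open>Matchings are graphs rather than functions, so that one can be mapped directly to a set
  of arrows, and products run over its pairs.\<close>

definition perfect_matchings :: "('a \<Rightarrow> 'b set) \<Rightarrow> 'a set \<Rightarrow> 'b set \<Rightarrow> ('a \<times> 'b) set set" where
  "perfect_matchings D I U = {G. G \<subseteq> Sigma I D \<and> (\<forall>t\<in>I. \<exists>!u. (t, u) \<in> G) \<and>
     (\<forall>u\<in>U. \<exists>!t. (t, u) \<in> G) \<and> snd ` G \<subseteq> U}"

lemma perfect_matchingsD:
  assumes "G \<in> perfect_matchings D I U"
  shows "G \<subseteq> Sigma I D" "t \<in> I \<Longrightarrow> \<exists>!u. (t, u) \<in> G" "u \<in> U \<Longrightarrow> \<exists>!t. (t, u) \<in> G" "snd ` G \<subseteq> U"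
  using assms by (simp_all add: perfect_matchings_def)

lemma perfect_matchings_empty: "perfect_matchings D {} U = (if U = {} then {{}} else {})"
  by (auto simp: perfect_matchings_def)

lemma perfect_matchings_unmatched:
  "u \<in> U \<Longrightarrow> (\<And>t. t \<in> I \<Longrightarrow> u \<notin> D t) \<Longrightarrow> perfect_matchings D I U = {}"
  by (auto simp: perfect_matchings_def) blast

text \<open>Removing the pair of \<open>t\<close> undoes adding it, since neither \<open>t\<close>
  nor its partner occurs in another pair.\<close>

lemma perfect_matchings_insert:
  assumes "t \<notin> I"
  shows "perfect_matchings D (insert t I) U =
    (\<Union>u\<in>D t \<inter> U. insert (t, u) ` perfect_matchings D I (U - {u}))"
proof (intro equalityI subsetI)
  fix G assume "G \<in> perfect_matchings D (insert t I) U"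
  note G = perfect_matchingsD[OF this]
  obtain u where u: "(t, u) \<in> G" "\<And>v. (t, v) \<in> G \<Longrightarrow> v = u" using G(2)[of t] by blast
  have uU: "u \<in> D t" "u \<in> U" using u(1) G(1,4) by auto
  have us: "s = t" if "(s, u) \<in> G" for s using G(3)[OF uU(2)] u(1) that by blast
  let ?H = "G - {(t, u)}"
  have "?H \<in> perfect_matchings D I (U - {u})"
    unfolding perfect_matchings_def mem_Collect_eq
  proof (intro conjI ballI)
    show "?H \<subseteq> Sigma I D" using G(1) u(2) by blast
    show "snd ` ?H \<subseteq> U - {u}" using G(4) us by auto
    show "\<exists>!v. (s, v) \<in> ?H" if "s \<in> I" for s
    proof -
      have "s \<noteq> t" using that assms by blast
      then show ?thesis using G(2)[of s] that by simp
    qed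
    show "\<exists>!s. (s, v) \<in> ?H" if "v \<in> U - {u}" for v
      using G(3)[of v] that by simp
  qed
  moreover have "G = insert (t, u) ?H" using u(1) by blast
  ultimately show "G \<in> (\<Union>u\<in>D t \<inter> U. insert (t, u) ` perfect_matchings D I (U - {u}))"
    using uU by blast
next
  fix G assume "G \<in> (\<Union>u\<in>D t \<inter> U. insert (t, u) ` perfect_matchings D I (U - {u}))"
  then obtain u H where u: "u \<in> D t" "u \<in> U" "G = insert (t, u) H"
    and "H \<in> perfect_matchings D I (U - {u})" by blast
  note H = perfect_matchingsD[OF this(4)]
  have new: "(t, v) \<notin> H" "(s, u) \<notin> H" for v s using H(1,4) assms by force+
  show "G \<in> perfect_matchings D (insert t I) U"
    unfolding perfect_matchings_def mem_Collect_eq u(3)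
  proof (intro conjI ballI)
    show "insert (t, u) H \<subseteq> Sigma (insert t I) D" using H(1) u(1) by blast
    show "snd ` insert (t, u) H \<subseteq> U" using H(4) u(2) by auto
    show "\<exists>!v. (s, v) \<in> insert (t, u) H" if "s \<in> insert t I" for s
    proof (cases "s = t")
      case True
      then show ?thesis using new by auto
    next
      case False
      then show ?thesis using H(2)[of s] that by simp
    qed
    show "\<exists>!s. (s, v) \<in> insert (t, u) H" if "v \<in> U" for v
    proof (cases "v = u")
      case True
      then show ?thesis using new by auto
    next
      case False
      then show ?thesis using H(3)[of v] that by simp
    qed
  qed
qed

lemma finite_perfect_matchings:
  assumes "finite I" "\<And>t. t \<in> I \<Longrightarrow> finite (D t)"
  shows "finite (perfect_matchings D I U)" "G \<in> perfect_matchings D I U \<Longrightarrow> finite G"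
proof -
  have fin: "finite (Sigma I D)" using assms by (rule finite_SigmaI)
  have "perfect_matchings D I U \<subseteq> Pow (Sigma I D)" unfolding perfect_matchings_def by blast
  then show "finite (perfect_matchings D I U)" "G \<in> perfect_matchings D I U \<Longrightarrow> finite G"
    using fin finite_subset[of _ "Pow (Sigma I D)"] finite_subset[of G "Sigma I D"] by auto
qed

lemma sum_perfect_matchings_insert:
  fixes f :: "'a \<times> 'b \<Rightarrow> 'c::comm_semiring_1"
  assumes "t \<notin> I" "finite I" "\<And>s. s \<in> insert t I \<Longrightarrow> finite (D s)"
  shows "(\<Sum>G\<in>perfect_matchings D (insert t I) U. \<Prod>\<alpha>\<in>G. f \<alpha>) =
    (\<Sum>u\<in>D t \<inter> U. f (t, u) * (\<Sum>G\<in>perfect_matchings D I (U - {u}). \<Prod>\<alpha>\<in>G. f \<alpha>))"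
proof -
  let ?P = "\<lambda>u. perfect_matchings D I (U - {u})"
  have fin: "finite (?P u)" "G \<in> ?P u \<Longrightarrow> finite G" for u G
    using finite_perfect_matchings[of I D] assms by auto
  have new: "(t, v) \<notin> G" if "G \<in> ?P u" for G u v
    using that assms(1) unfolding perfect_matchings_def by blast
  have inj: "inj_on (insert (t, u)) (?P u)" for u
    by (rule inj_onI) (metis Diff_insert_absorb new)
  have "(\<Sum>G\<in>perfect_matchings D (insert t I) U. \<Prod>\<alpha>\<in>G. f \<alpha>) =
      (\<Sum>u\<in>D t \<inter> U. \<Sum>G\<in>insert (t, u) ` ?P u. \<Prod>\<alpha>\<in>G. f \<alpha>)"
    unfolding perfect_matchings_insert[OF assms(1)]
  proof (rule sum.UNION_disjoint)
    show "\<forall>u\<in>D t \<inter> U. \<forall>v\<in>D t \<inter> U. u \<noteq> v \<longrightarrow> insert (t, u) ` ?P u \<inter> insert (t, v) ` ?P v = {}"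
      using new by blast
  qed (use assms fin in auto)
  also have "\<dots> = (\<Sum>u\<in>D t \<inter> U. \<Sum>G\<in>?P u. \<Prod>\<alpha>\<in>insert (t, u) G. f \<alpha>)"
    by (simp add: sum.reindex[OF inj])
  also have "\<dots> = (\<Sum>u\<in>D t \<inter> U. \<Sum>G\<in>?P u. f (t, u) * (\<Prod>\<alpha>\<in>G. f \<alpha>))"
    using fin(2) new by (intro sum.cong refl) simp
  finally show ?thesis by (simp only: sum_distrib_left)
qed

section \<open>The recursion as a sum over matchings\<close>

context triangle_path
begin

text \<open>The side of triangle \<open>t\<close> opposite to \<open>v\<close>; the last case is
  meant for \<open>v = q t\<close>.\<close>

definition opp :: "nat \<Rightarrow> nat \<Rightarrow> nat" where
  "opp t v = (if v = p t then lab (r t) (q t) else if v = r t then lab (q t) (p t) else lab (p t) (r t))"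

lemma opp_eq:
  assumes "t \<le> n" "tri t = {u, a, b}" "u \<noteq> a" "u \<noteq> b" "a \<noteq> b"
  shows "opp t u = lab a b"
proof -
  note d = distinct[OF assms(1)]
  have "tri t - {u} = {a, b}" using assms by auto
  moreover have "u = p t \<or> u = q t \<or> u = r t" using assms(2) unfolding tri_def by auto
  ultimately show ?thesis
    using d unfolding opp_def lab_def tri_def
    by (elim disjE) (simp_all add: insert_Diff_if insert_commute)
qed

lemma finite_tri: "finite (tri t)" by (simp add: tri_def)

text \<open>All vertices of the triangles \<open>i - 1\<close>, ..., \<open>i + k - 1\<close>. Along
  the path there are two more vertices than triangles, so a perfect matching has to leave out
  two.\<close>

definition inner_verts :: "nat \<Rightarrow> nat \<Rightarrow> nat set" where
  "inner_verts i k = {ear i, p i, q i} \<union> r ` {i..<i + k}"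

lemma last_inner: "v \<in> last_verts i k \<Longrightarrow> 1 \<le> i \<Longrightarrow> i + k \<le> Suc n \<Longrightarrow> v \<in> {p i, q i} \<union> r ` {i..<i + k}"
  using tri_subset[of i "i + k - 1"] unfolding last_verts_def
  by (cases k) (auto simp: atLeastLessThanSuc_atLeastAtMost)

lemma r_notin_inner:
  assumes "1 \<le> i" "i + k \<le> n"
  shows "r (i + k) \<notin> inner_verts i k"
proof
  assume "r (i + k) \<in> inner_verts i k"
  then consider "r (i + k) \<in> tri (i - 1)" | s where "s < i + k" "r (i + k) = r s"
    using ear(1)[of i] assms unfolding inner_verts_def by auto
  then show False
  proof cases
    case 1
    moreover have "i - 1 < i + k" using assms by linarith
    ultimately show False using r_new[of "i - 1" "i + k"] assms by simp
  next
    case 2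
    then show False using r_new[of s "i + k"] assms unfolding tri_def by auto
  qed
qed

text \<open>Split off the last triangle, the only one containing its apex. If the apex is left out,
  this triangle takes \<open>p\<close> or \<open>q\<close>, and the rest leaves out that vertex
  instead; otherwise it must take the apex, whose opposite side is the entry diagonal. These are the
  two cases of \<open>matching_sum\<close>.\<close>

lemma sum_matchings:
  fixes z :: "nat \<Rightarrow> 'a::comm_semiring_1"
  assumes i: "1 \<le> i" "i \<le> n" and k: "i + k \<le> Suc n" and v: "v \<in> last_verts i k"
  shows "(\<Sum>G\<in>perfect_matchings tri {i - 1..<i + k} (inner_verts i k - {ear i, v}).
      \<Prod>(t, u)\<in>G. z (opp t u)) = matching_sum z i k v"
  using k v
proof (induction k arbitrary: v)
  case 0
  have tri: "tri (i - 1) = {ear i, p i, q i}" "ear i \<noteq> p i" "ear i \<noteq> q i" "p i \<noteq> q i"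
    using ear[of i] distinct[of i] i by auto
  have "v \<in> {p i, q i}" using 0 by (simp add: last_verts_def)
  define v' where "v' = (if v = p i then q i else p i)"
  have v': "v' \<in> {p i, q i}" "v' \<noteq> v" "inner_verts i 0 - {ear i, v} = {v'}"
    "tri (i - 1) = {v', ear i, v}"
    using \<open>v \<in> {p i, q i}\<close> tri unfolding inner_verts_def v'_def by auto
  have set: "{i - 1..<i + 0} = insert (i - 1) {}" using i by auto
  have "opp (i - 1) v' = lab (ear i) v"
    using v' tri i \<open>v \<in> {p i, q i}\<close> by (intro opp_eq) auto
  moreover have "tri (i - 1) \<inter> {v'} = {v'}" using v' by auto
  ultimately show ?case
    unfolding set v'(3)
    by (subst sum_perfect_matchings_insert) (simp_all add: finite_tri perfect_matchings_empty)
next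
  case (Suc k)
  let ?t = "i + k"
  let ?I = "{i - 1..<i + k}"
  let ?f = "\<lambda>(t, u). z (opp t u)"
  have t: "?t \<le> n" using Suc.prems by simp
  note d = distinct[OF t]
  have set: "{i - 1..<i + Suc k} = insert ?t ?I" using i by auto
  have W: "inner_verts i (Suc k) = insert (r ?t) (inner_verts i k)"
    unfolding inner_verts_def by (auto simp: atLeastLessThanSuc)
  have rW: "r ?t \<notin> inner_verts i k" using r_notin_inner i t by blast
  have ear: "ear i \<notin> tri ?t" using ear_gone[of i ?t] i t by simp
  have pqW: "{p ?t, q ?t} \<subseteq> inner_verts i k"
    using pq_last_verts[OF t] last_inner[of _ i k] i t unfolding inner_verts_def by fastforce
  have IH: "(\<Sum>G\<in>perfect_matchings tri ?I (inner_verts i k - {ear i, v}). \<Prod>\<alpha>\<in>G. ?f \<alpha>) =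
      matching_sum z i k v" if "v \<in> {p ?t, q ?t}" for v
    using Suc.IH that pq_last_verts[OF t] t by auto
  have opp: "opp ?t (p ?t) = lab (r ?t) (q ?t)" "opp ?t (q ?t) = lab (p ?t) (r ?t)"
    "opp ?t (r ?t) = ?t"
    using d lab_diag[of ?t] i t unfolding opp_def by (auto simp: lab_commute)
  have rec: "(\<Sum>G\<in>perfect_matchings tri {i - 1..<i + Suc k} U. \<Prod>\<alpha>\<in>G. ?f \<alpha>) =
      (\<Sum>u\<in>tri ?t \<inter> U. ?f (?t, u) * (\<Sum>G\<in>perfect_matchings tri ?I (U - {u}). \<Prod>\<alpha>\<in>G. ?f \<alpha>))" for U
    unfolding set by (rule sum_perfect_matchings_insert) (simp_all add: finite_tri)
  show ?case
  proof (cases "v = r ?t")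
    case True
    have U: "inner_verts i (Suc k) - {ear i, v} = inner_verts i k - {ear i}"
      using W rW True by auto
    have TU: "tri ?t \<inter> (inner_verts i k - {ear i}) = {p ?t, q ?t}"
      using pqW rW ear unfolding tri_def by auto
    have diff: "inner_verts i k - {ear i} - {u} = inner_verts i k - {ear i, u}" for u by auto
    show ?thesis
      unfolding rec U TU diff using True d IH opp by simp
  next
    case False
    then have v: "v \<in> {p ?t, q ?t}" using last_verts_Suc[OF Suc.prems(2)] by blast
    define v' where "v' = (if v = p ?t then q ?t else p ?t)"
    have v': "tri ?t = {v, v', r ?t}" "v' \<noteq> v" "v' \<noteq> r ?t" "v' \<in> inner_verts i k"
      using v d pqW unfolding tri_def v'_def by auto
    let ?U = "inner_verts i (Suc k) - {ear i, v}"
    have rear: "r ?t \<noteq> ear i" using ear unfolding tri_def by auto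
    have TU: "tri ?t \<inter> ?U = {v', r ?t}" using v' W ear False rear by auto
    \<comment> \<open>If the last triangle took \<open>v'\<close>, no triangle would remain for its
      apex.\<close>
    have "perfect_matchings tri ?I (?U - {v'}) = {}"
    proof (rule perfect_matchings_unmatched)
      show "r ?t \<in> ?U - {v'}" using W False rear v' by auto
      show "r ?t \<notin> tri s" if "s \<in> ?I" for s using r_new[of s ?t] that t by simp
    qed
    then have empty: "(\<Sum>G\<in>perfect_matchings tri ?I (?U - {v'}). \<Prod>\<alpha>\<in>G. ?f \<alpha>) = 0"
      by (simp only: sum.empty)
    have diff: "?U - {r ?t} = inner_verts i k - {ear i, v}" using W rW by auto
    define g where "g u = ?f (?t, u) * (\<Sum>G\<in>perfect_matchings tri ?I (?U - {u}). \<Prod>\<alpha>\<in>G. ?f \<alpha>)" for u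
    have "g v' = 0" "g (r ?t) = z ?t * matching_sum z i k v"
      unfolding g_def empty diff IH[OF v] prod.case opp(3) by (rule mult_zero_right, rule refl)
    then have "sum g {v', r ?t} = z ?t * matching_sum z i k v" using v'(3) by simp
    then show ?thesis unfolding rec TU g_def[symmetric] using False by simp
  qed
qed

end

section \<open>Minimal cuts\<close>

lemma ex1_image_iff:
  assumes "inj_on f H"
  shows "(\<exists>!a. a \<in> f ` H) \<longleftrightarrow> (\<exists>!b. b \<in> H)"
proof
  assume "\<exists>!a. a \<in> f ` H"
  then obtain a where a: "f ` H = {a}" by blast
  then obtain b where b: "b \<in> H" "f b = a" by blast
  have "b' = b" if "b' \<in> H" for b'
  proof (rule inj_onD[OF assms _ that b(1)])
    show "f b' = f b" using imageI[OF that, of f] a b(2) by simp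
  qed
  then show "\<exists>!b. b \<in> H" using b(1) by blast
next
  assume "\<exists>!b. b \<in> H"
  then obtain b where "H = {b}" by blast
  then show "\<exists>!a. a \<in> f ` H" by simp
qed

locale subpolygon_cuts =
  path_polygon n T + triangle_path n "2 * n + 3" "verts T" "ends T" p q r
  for n T p q r +
  fixes i j :: nat
  assumes triangles: "triangle a b c \<Longrightarrow> \<exists>t\<le>n. {a, b, c} = {p t, q t, r t}"
    and ij: "1 \<le> i" "i \<le> j" "j \<le> n"
begin

abbreviation "S \<equiv> subpolygon T {i..j}"
abbreviation "I \<equiv> {i - 1..j}"

text \<open>\<open>A t\<close>, \<open>B t\<close>, \<open>C t\<close> are the sides of triangle
  \<open>t\<close> in clockwise order; \<open>C t\<close> is the entry side, hence \<open>t\<close>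
  itself for \<open>t\<close> in \<open>{1..n}\<close>.\<close>

definition "A t = lab (p t) (r t)"
definition "B t = lab (r t) (q t)"
definition "C t = lab (q t) (p t)"

text \<open>The arrow at the vertex \<open>v\<close> of the triangle \<open>t\<close>.\<close>

definition angle :: "nat \<times> nat \<Rightarrow> arrow" where
  "angle = (\<lambda>(t, v). if v = p t then (C t, A t) else if v = r t then (A t, B t) else (B t, C t))"

lemma ABC:
  assumes "t \<le> n"
  shows "A t \<in> {1..m}" "B t \<in> {1..m}" "C t \<in> {1..m}"
    "ends T (A t) = {p t, r t}" "ends T (B t) = {r t, q t}" "ends T (C t) = {q t, p t}"
proof -
  have "{q t, p t} \<in> E" using pq_in[OF assms] by (simp add: insert_commute)
  then show "A t \<in> {1..m}" "B t \<in> {1..m}" "C t \<in> {1..m}"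
    "ends T (A t) = {p t, r t}" "ends T (B t) = {r t, q t}" "ends T (C t) = {q t, p t}"
    unfolding A_def B_def C_def using lab[of "q t" "p t"] lab[OF sides_in(1)[OF assms]]
      lab[OF sides_in(2)[OF assms]] by simp_all
qed

lemma cw_triangle_ABC: "t \<le> n \<Longrightarrow> cw_triangle T (A t) (B t) (C t)"
  unfolding cw_triangle_def arcs using ABC[of t] cw[of t] by blast

lemma cw_triangle_rotate: "cw_triangle P a b c \<Longrightarrow> cw_triangle P b c a"
  unfolding cw_triangle_def using clockwise_rotate by blast

lemma cw_triangleE:
  assumes "cw_triangle T a b c"
  obtains t where "t \<le> n"
    "a = A t \<and> b = B t \<and> c = C t \<or> a = B t \<and> b = C t \<and> c = A t \<or> a = C t \<and> b = A t \<and> c = B t"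
proof -
  obtain u v w where abc: "a \<in> {1..m}" "b \<in> {1..m}" "c \<in> {1..m}" "clockwise u v w"
    "ends T a = {u, v}" "ends T b = {v, w}" "ends T c = {w, u}"
    using assms unfolding cw_triangle_def arcs by blast
  then have "triangle u v w" unfolding triangle_def by (metis imageI)
  then obtain t where t: "t \<le> n" "{u, v, w} = {p t, q t, r t}" using triangles by blast
  have lab: "a = lab u v" "b = lab v w" "c = lab w u" using lab_eq abc by metis+
  note d = distinct[OF t(1)] clockwise_distinct[OF abc(4)]
  note cwt = cw[OF t(1)]
  have "u \<in> {p t, q t, r t}" "v \<in> {p t, q t, r t}" "w \<in> {p t, q t, r t}" using t(2) by blast+
  moreover have "\<not> (u = p t \<and> v = q t)" "\<not> (u = q t \<and> v = r t)" "\<not> (u = r t \<and> v = p t)"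
    "w \<noteq> u" "w \<noteq> v" "u \<noteq> v"
    using calculation abc(4) cwt d clockwise_asym clockwise_rotate by (metis insertE singletonD)+
  ultimately have "u = p t \<and> v = r t \<and> w = q t \<or> u = r t \<and> v = q t \<and> w = p t \<or> u = q t \<and> v = p t \<and> w = r t"
    by auto
  then show thesis using that[OF t(1)] unfolding lab A_def B_def C_def by blast
qed

text \<open>In either orientation the ends of the third side are the symmetric difference of the
  ends of the other two, so the description has one candidate.\<close>

lemma third_side_eq:
  assumes "cw_triangle T a b c"
  shows "third_side T a b = c"
  unfolding third_side_def
proof (rule the_equality)
  have ends: "z \<in> {1..m} \<and> ends T z = (ends T a \<union> ends T b) - (ends T a \<inter> ends T b)"
    if z: "cw_triangle T a b z" for a b z
  proof -
    obtain u v w where "z \<in> {1..m}" "clockwise u v w" "ends T a = {u, v}" "ends T b = {v, w}"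
      "ends T z = {w, u}"
      using z unfolding cw_triangle_def arcs by (elim conjE exE) (rule that)
    then show ?thesis using clockwise_distinct[of u v w] by auto
  qed
  then have ends: "z \<in> {1..m} \<and> ends T z = (ends T a \<union> ends T b) - (ends T a \<inter> ends T b)"
    if "cw_triangle T a b z \<or> cw_triangle T b a z" for z
    using that ends[of a b z] ends[of b a z] by (auto simp only: Un_commute Int_commute)
  show "cw_triangle T a b c \<or> cw_triangle T b a c" using assms by simp
  fix z assume "cw_triangle T a b z \<or> cw_triangle T b a z"
  then show "z = c" using ends[of z] ends[of c] assms inj_ends by (metis inj_onD)
qed

lemma angle_third_side:
  assumes "t \<le> n"
  shows "(case angle (t, v) of (a, b) \<Rightarrow> third_side T a b) = opp t v"
proof -
  note T1 = cw_triangle_ABC[OF assms]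
  note T2 = cw_triangle_rotate[OF T1] and T3 = cw_triangle_rotate[OF cw_triangle_rotate[OF T1]]
  show ?thesis
    using third_side_eq[OF T1] third_side_eq[OF T2] third_side_eq[OF T3]
    unfolding angle_def opp_def A_def B_def C_def by simp
qed

text \<open>Recovers the vertex and the triangle from the arrow, whence the injectivity of
  \<open>angle\<close>.\<close>

lemma angle_ends:
  assumes "t \<le> n" "v \<in> tri t"
  shows "ends T (fst (angle (t, v))) \<inter> ends T (snd (angle (t, v))) = {v}"
    "ends T (fst (angle (t, v))) \<union> ends T (snd (angle (t, v))) = tri t"
  using ABC[OF assms(1)] distinct[OF assms(1)] assms(2) unfolding angle_def tri_def by auto

lemma tri_inj: "s \<le> n \<Longrightarrow> t \<le> n \<Longrightarrow> tri s = tri t \<Longrightarrow> s = t"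
  using r_new[of s t] r_new[of t s] by (cases s t rule: linorder_cases) (auto simp: tri_def)

lemma I_le: "t \<in> I \<Longrightarrow> t \<le> n" using ij by simp

lemma inj_angle: "inj_on angle (Sigma I tri)"
proof (rule inj_onI)
  fix \<alpha> \<beta> assume ab: "\<alpha> \<in> Sigma I tri" "\<beta> \<in> Sigma I tri" "angle \<alpha> = angle \<beta>"
  obtain s u t v where st: "\<alpha> = (s, u)" "\<beta> = (t, v)" by fastforce
  then have le: "s \<le> n" "u \<in> tri s" "t \<le> n" "v \<in> tri t" using ab I_le by auto
  have "tri s = tri t" "{u} = {v}"
    using angle_ends[OF le(1,2)] angle_ends[OF le(3,4)] ab(3) st by auto
  then show "\<alpha> = \<beta>" using tri_inj le st by simp
qed

text \<open>For \<open>l < t\<close> the apex \<open>r t\<close> is not on \<open>l\<close>, which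
  forces \<open>l\<close> onto the entry side of \<open>t\<close>; for \<open>l > Suc t\<close> the
  end \<open>r (l - 1)\<close> of \<open>l\<close> has not been met yet.\<close>

lemma diag_in_tri:
  assumes l: "l \<in> {1..n}" and t: "t \<le> n" and sub: "ends T l \<subseteq> tri t"
  shows "l = t \<or> l = Suc t"
proof (rule ccontr)
  assume "\<not> ?thesis"
  then consider "l < t" | "Suc t < l" by linarith
  then show False
  proof cases
    case 1
    have "r t \<notin> ends T l" using diag_r_new[of l t] 1 l t by simp
    moreover have ne: "ends T l = {p l, q l}" "p l \<noteq> q l" using diag[OF l] distinct[of l] l by auto
    ultimately have "p l = p t \<or> p l = q t" "q l = p t \<or> q l = q t" using sub unfolding tri_def by auto
    then have "ends T l = {p t, q t}" using ne by (elim disjE) (simp_all add: insert_commute)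
    moreover have "ends T t = {p t, q t}" "l \<in> {1..m}" "t \<in> {1..m}" using diag[of t] 1 l t by auto
    ultimately have "l = t" using inj_ends by (metis inj_onD)
    then show False using 1 by simp
  next
    case 2
    have "r (l - 1) \<in> ends T l" using diag[OF l] pq_Suc[of "l - 1"] 2 l by auto
    moreover have "t < l - 1" "l - 1 \<le> n" using 2 l by auto
    ultimately show False using sub r_new[of t "l - 1"] by blast
  qed
qed

lemma tri_contains_diag:
  assumes "t \<in> I"
  obtains l where "l \<in> {i..j}" "l = t \<or> l = Suc t" "ends T l \<subseteq> tri t"
proof (cases "i \<le> t")
  case True
  then show thesis using that[of t] diag_tri[of t] assms ij by simp
next
  case False
  then have "t = i - 1" "Suc t = i" using assms ij by auto
  then show thesis using that[of i] ear(1)[of i] diag[of i] ij by auto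
qed

lemma diag_ABC:
  assumes "l \<in> {1..n}" "t \<le> n" "ends T l \<subseteq> tri t"
  shows "l = A t \<or> l = B t \<or> l = C t"
proof -
  have "ends T l = {p t, r t} \<or> ends T l = {r t, q t} \<or> ends T l = {q t, p t}"
    using ends_side[OF assms(1), of "p t" "r t" "q t"] assms(3) unfolding tri_def by auto
  moreover have "l \<in> {1..m}" using assms(1) by simp
  ultimately show ?thesis using ABC[OF assms(2)] inj_ends by (metis inj_onD)
qed

lemma tri_meets_iff:
  assumes "t \<le> n"
  shows "{A t, B t, C t} \<inter> {i..j} \<noteq> {} \<longleftrightarrow> t \<in> I"
proof
  assume "{A t, B t, C t} \<inter> {i..j} \<noteq> {}"
  then obtain l where l: "l \<in> {i..j}" "l \<in> {A t, B t, C t}" by blast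
  then have "ends T l \<subseteq> tri t" using ABC[OF assms] unfolding tri_def by auto
  then have "l = t \<or> l = Suc t" using diag_in_tri l ij assms by simp
  then show "t \<in> I" using l(1) by auto
next
  assume "t \<in> I"
  then obtain l where "l \<in> {i..j}" "ends T l \<subseteq> tri t" by (rule tri_contains_diag)
  then show "{A t, B t, C t} \<inter> {i..j} \<noteq> {}" using diag_ABC[of l t] assms ij by auto
qed

lemma arcs_S: "a \<in> arcs S \<longleftrightarrow> (\<exists>t\<in>I. a \<in> {A t, B t, C t})"
proof
  assume "a \<in> arcs S"
  then consider "a \<in> {i..j}" | b c where "cw_triangle T a b c" "{a, b, c} \<inter> {i..j} \<noteq> {}"
    unfolding arcs_def subpolygon_def by auto
  then show "\<exists>t\<in>I. a \<in> {A t, B t, C t}"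
  proof cases
    case 1
    then have "a = A a \<or> a = B a \<or> a = C a" using diag_ABC[of a a] diag_tri[of a] ij by auto
    then show ?thesis using 1 by (intro bexI[of _ a]) auto
  next
    case 2
    from 2(1) obtain t where "t \<le> n" and
      "a = A t \<and> b = B t \<and> c = C t \<or> a = B t \<and> b = C t \<and> c = A t \<or> a = C t \<and> b = A t \<and> c = B t"
      by (rule cw_triangleE)
    moreover from this(2) have "{a, b, c} = {A t, B t, C t}"
      by (elim disjE conjE) (simp_all add: insert_commute)
    ultimately show ?thesis using tri_meets_iff[of t] 2(2) by (intro bexI[of _ t]) auto
  qed
next
  assume "\<exists>t\<in>I. a \<in> {A t, B t, C t}"
  then obtain t where t: "t \<in> I" "a \<in> {A t, B t, C t}" by blast
  note T1 = cw_triangle_ABC[OF I_le[OF t(1)]]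
  note T2 = cw_triangle_rotate[OF T1] and T3 = cw_triangle_rotate[OF cw_triangle_rotate[OF T1]]
  have "\<exists>b c. cw_triangle T a b c \<and> {a, b, c} = {A t, B t, C t}"
  proof -
    have "{B t, C t, A t} = {A t, B t, C t}" "{C t, A t, B t} = {A t, B t, C t}" by auto
    moreover have "a = A t \<or> a = B t \<or> a = C t" using t(2) by simp
    ultimately show ?thesis using T1 T2 T3 by metis
  qed
  then have "\<exists>b c. cw_triangle T a b c \<and> {a, b, c} \<inter> {i..j} \<noteq> {}"
    using tri_meets_iff[OF I_le[OF t(1)]] t(1) by metis
  then show "a \<in> arcs S" unfolding arcs_def subpolygon_def by auto
qed

text \<open>Since \<open>cw_triangle\<close> asks only for three arcs, a foreign triangle of
  \<open>T\<close> with all sides in the subpolygon has to be excluded. It would have a vertex in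
  common with no triangle of \<open>I\<close>: \<open>r t\<close> if it comes later on the path,
  \<open>ear (Suc t)\<close> if earlier.\<close>

lemma cw_triangle_S:
  "cw_triangle S a b c \<longleftrightarrow> (\<exists>t\<in>I. a = A t \<and> b = B t \<and> c = C t \<or>
    a = B t \<and> b = C t \<and> c = A t \<or> a = C t \<and> b = A t \<and> c = B t)"
proof
  have ends: "ends S = ends T" by (simp add: subpolygon_def)
  assume abc: "cw_triangle S a b c"
  then have arcsS: "a \<in> arcs S" "b \<in> arcs S" "c \<in> arcs S" unfolding cw_triangle_def by auto
  have sub: "\<exists>s\<in>I. ends T x \<subseteq> tri s" "x \<in> {1..m}" if "x \<in> arcs S" for x
    using that ABC I_le unfolding arcs_S tri_def
    by (metis insertE insertI1 insert_subset empty_subsetI insertCI singletonD,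
        metis insertE singletonD)
  have "cw_triangle T a b c" using abc sub(2) arcsS unfolding cw_triangle_def ends arcs by auto
  then obtain t where t: "t \<le> n" and lab:
    "a = A t \<and> b = B t \<and> c = C t \<or> a = B t \<and> b = C t \<and> c = A t \<or> a = C t \<and> b = A t \<and> c = B t"
    by (rule cw_triangleE)
  then have "A t \<in> arcs S" "B t \<in> arcs S" "C t \<in> arcs S" using arcsS by blast+
  then have all: "\<exists>s\<in>I. v \<in> tri s" if "v \<in> tri t" for v
    using sub(1) ABC[OF t] that unfolding tri_def by (metis insertE insertI1 insert_subset singletonD)
  have "t \<in> I"
  proof (rule ccontr)
    assume "t \<notin> I"
    then consider "j < t" | "Suc t < i" by fastforce
    then show False
    proof cases
      case 1
      have "r t \<in> tri t" by (simp add: tri_def)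
      then obtain s where "s \<in> I" "r t \<in> tri s" using all by blast
      then show False using r_new[of s t] 1 t by simp
    next
      case 2
      then have "ear (Suc t) \<in> tri t" using ear(1)[of "Suc t"] ij by simp
      then obtain s where "s \<in> I" "ear (Suc t) \<in> tri s" using all by blast
      moreover from this(1) have "Suc t \<le> s" "s \<le> n" using 2 I_le by auto
      ultimately show False using ear_gone[of "Suc t" s] by simp
    qed
  qed
  then show "\<exists>t\<in>I. a = A t \<and> b = B t \<and> c = C t \<or>
    a = B t \<and> b = C t \<and> c = A t \<or> a = C t \<and> b = A t \<and> c = B t" using lab by blast
next
  assume "\<exists>t\<in>I. a = A t \<and> b = B t \<and> c = C t \<or>
    a = B t \<and> b = C t \<and> c = A t \<or> a = C t \<and> b = A t \<and> c = B t"
  then obtain t where t: "t \<in> I" and lab: "a = A t \<and> b = B t \<and> c = C t \<or>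
    a = B t \<and> b = C t \<and> c = A t \<or> a = C t \<and> b = A t \<and> c = B t" by blast
  have "cw_triangle T a b c"
    using lab cw_triangle_ABC[OF I_le[OF t]] cw_triangle_rotate by blast
  moreover have "a \<in> arcs S" "b \<in> arcs S" "c \<in> arcs S" using lab t unfolding arcs_S by blast+
  ultimately show "cw_triangle S a b c" unfolding cw_triangle_def by (simp add: subpolygon_def)
qed

lemma triangle_cycles_S: "triangle_cycles S = (\<lambda>t. angle ` ({t} \<times> tri t)) ` I"
proof -
  have ang: "angle ` ({t} \<times> tri t) = {(A t, B t), (B t, C t), (C t, A t)}" if "t \<in> I" for t
    using distinct[OF I_le[OF that]] unfolding angle_def tri_def by auto
  have "c \<in> triangle_cycles S \<longleftrightarrow> (\<exists>t\<in>I. c = {(A t, B t), (B t, C t), (C t, A t)})" for c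
  proof
    assume "c \<in> triangle_cycles S"
    then obtain x y z where c: "c = {(x, y), (y, z), (z, x)}" "cw_triangle S x y z"
      unfolding triangle_cycles_def by blast
    then obtain t where "t \<in> I" "x = A t \<and> y = B t \<and> z = C t \<or>
        x = B t \<and> y = C t \<and> z = A t \<or> x = C t \<and> y = A t \<and> z = B t"
      unfolding cw_triangle_S by blast
    then show "\<exists>t\<in>I. c = {(A t, B t), (B t, C t), (C t, A t)}"
      unfolding c(1) by (intro bexI[of _ t]) auto
  next
    assume "\<exists>t\<in>I. c = {(A t, B t), (B t, C t), (C t, A t)}"
    then show "c \<in> triangle_cycles S" unfolding triangle_cycles_def cw_triangle_S by blast
  qed
  then show ?thesis using ang by (auto simp: image_iff)
qed

lemma angle_follows:
  assumes "t \<in> I"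
  shows "follows_in_triangle S (fst (angle (t, v))) (snd (angle (t, v)))"
proof -
  have "cw_triangle S (A t) (B t) (C t)" "cw_triangle S (B t) (C t) (A t)" "cw_triangle S (C t) (A t) (B t)"
    unfolding cw_triangle_S using assms by blast+
  then show ?thesis unfolding follows_in_triangle_def angle_def by auto
qed

lemma angle_extended:
  assumes "t \<in> I"
  shows "angle (t, v) \<in> extended_quiver S"
proof -
  obtain a b where ab: "angle (t, v) = (a, b)" by fastforce
  then have f: "follows_in_triangle S a b" using angle_follows[OF assms, of v] by simp
  then have "a \<in> arcs S" "b \<in> arcs S" unfolding follows_in_triangle_def cw_triangle_def by blast+
  then show ?thesis
    using f unfolding ab extended_quiver_def ice_quiver_def internal_arrows_def arcs_def by auto
qed

definition "N = (\<Union>l\<in>{i..j}. ends T l)"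

text \<open>The two ears are the only vertices of the subpolygon off its diagonals. So
  \<open>N\<close>, the set of vertices with a big cycle, has as many elements as \<open>I\<close>,
  which drives the counting for minimal cuts.\<close>

lemma N_inner: "N = inner_verts i (Suc (j - i)) - {ear i, r j}"
  and card_N: "card N = Suc (Suc (j - i))"
proof -
  have sub: "{p l, q l} \<subseteq> {p i, q i} \<union> r ` {i..<l}" if "l \<in> {i..j}" for l
  proof (cases "l = i")
    case False
    then have "{p l, q l} \<subseteq> tri (l - 1)" "{i..l - 1} = {i..<l}" "i \<le> l - 1" "l - 1 \<le> n"
      using pq_Suc[of "l - 1"] that ij by auto
    then show ?thesis using tri_subset[of i "l - 1"] by auto
  qed simp
  have ends: "ends T l = {p l, q l}" if "l \<in> {i..j}" for l using diag[of l] that ij by simp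
  have N: "N = {p i, q i} \<union> r ` {i..<j}"
  proof (intro equalityI subsetI)
    fix v assume "v \<in> N"
    then obtain l where l: "l \<in> {i..j}" "v \<in> {p l, q l}" unfolding N_def using ends by auto
    then have "v \<in> {p i, q i} \<union> r ` {i..<l}" using sub by blast
    then show "v \<in> {p i, q i} \<union> r ` {i..<j}" using l(1) by auto
  next
    fix v assume "v \<in> {p i, q i} \<union> r ` {i..<j}"
    then consider "v \<in> {p i, q i}" | s where "s \<in> {i..<j}" "v = r s" by blast
    then show "v \<in> N"
    proof cases
      case 1
      then show ?thesis unfolding N_def using ends[of i] ij by (intro UN_I[of i]) auto
    next
      case 2
      then have "v \<in> ends T (Suc s)" using pq_Suc[of s] ends[of "Suc s"] ij by auto
      then show ?thesis unfolding N_def using 2 by (intro UN_I[of "Suc s"]) auto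
    qed
  qed
  have i1: "i - 1 < s" if "i \<le> s" for s using that ij by linarith
  have r_old: "r s \<notin> {ear i, p i, q i}" if "i \<le> s" "s \<le> j" for s
    using r_new[of "i - 1" s] ear(1)[of i] i1[OF that(1)] that ij by simp
  have r_ne: "r s \<noteq> r j" if "s \<in> {i..<j}" for s using r_inj[of s j] that ij by auto
  have "{i..<i + Suc (j - i)} = insert j {i..<j}" using ij by auto
  then have "inner_verts i (Suc (j - i)) = insert (ear i) (insert (r j) N)"
    unfolding inner_verts_def N by auto
  moreover have "ear i \<notin> N" "r j \<notin> N"
  proof -
    show "ear i \<notin> N" using ear[of i] ij r_old unfolding N by fastforce
    show "r j \<notin> N" using ij r_old[of j] r_ne unfolding N by fastforce
  qed
  ultimately show "N = inner_verts i (Suc (j - i)) - {ear i, r j}" by auto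
  have "inj_on r {i..<j}"
  proof (rule inj_onI)
    fix s t assume "s \<in> {i..<j}" "t \<in> {i..<j}" "r s = r t"
    then show "s = t" using r_inj[of s t] ij by simp
  qed
  then have "card (r ` {i..<j}) = j - i" by (simp add: card_image)
  moreover have "r s \<notin> {p i, q i}" if "s \<in> {i..<j}" for s using r_old[of s] that by simp
  then have "{p i, q i} \<inter> r ` {i..<j} = {}" by fastforce
  moreover have "p i \<noteq> q i" using distinct[of i] ij by simp
  ultimately show "card N = Suc (Suc (j - i))" unfolding N by simp
qed

text \<open>An angle counts in a big cycle only if its arrow lies in the ice quiver, that is, if one
  of its two sides is a diagonal of the subpolygon. This can fail only at the ears
  \<open>ear i\<close> and \<open>r j\<close>, which \<open>N\<close> excludes.\<close>

lemma angle_in_big_cycle: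
  assumes t: "t \<in> I" "u \<in> tri t" and v: "v \<in> N"
  shows "angle (t, u) \<in> big_cycle S v \<longleftrightarrow> u = v"
proof
  obtain a b where ab: "angle (t, u) = (a, b)" by fastforce
  have ends: "ends T a \<inter> ends T b = {u}" "ends T a \<union> ends T b = tri t"
    using angle_ends[OF I_le[OF t(1)] t(2)] ab by simp_all
  have S: "ends S = ends T" "diags S = {i..j}" by (simp_all add: subpolygon_def)
  {
    assume "angle (t, u) \<in> big_cycle S v"
    then have "v \<in> ends T a \<inter> ends T b" unfolding big_cycle_def ab S by simp
    then show "u = v" using ends by simp
  }
  assume uv: "u = v"
  have "\<exists>l\<in>{i..j}. v \<in> ends T l \<and> ends T l \<subseteq> tri t"
  proof -
    have vN: "v \<noteq> ear i" "v \<noteq> r j" using v N_inner by auto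
    have d: "ends T l = {p l, q l}" if "l \<in> {i..j}" for l using diag[of l] that ij by simp
    have "t = i - 1 \<or> t \<in> {i..j}" "v = r t \<Longrightarrow> t \<noteq> j" using t(1) vN by auto
    moreover have "v \<in> {p t, q t} \<or> v = r t" using t(2) uv unfolding tri_def by auto
    ultimately consider "t = i - 1" | "t \<in> {i..j}" "v \<in> {p t, q t}" | "t \<in> {i..<j}" "v = r t"
      by fastforce
    then show ?thesis
    proof cases
      case 1
      then show ?thesis using t(2) uv vN ear(1)[of i] d[of i] ij by (intro bexI[of _ i]) auto
    next
      case 2
      then show ?thesis using d[of t] unfolding tri_def by (intro bexI[of _ t]) auto
    next
      case 3
      then show ?thesis using d[of "Suc t"] pq_Suc[of t] ij by (intro bexI[of _ "Suc t"]) auto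
    qed
  qed
  then obtain l where l: "l \<in> {i..j}" "v \<in> ends T l" "ends T l \<subseteq> tri t" by blast
  have "l = A t \<or> l = B t \<or> l = C t" using diag_ABC[of l t] l ij I_le[OF t(1)] by auto
  then have "l = a \<or> l = b"
    using ab l(2) ABC[OF I_le[OF t(1)]] distinct[OF I_le[OF t(1)]] t(2) uv
    unfolding angle_def tri_def by (auto split: if_splits)
  then have "(a, b) \<in> ice_quiver S"
    using angle_follows[OF t(1), of u] l(1) unfolding ice_quiver_def ab S by auto
  then show "angle (t, u) \<in> big_cycle S v"
    using ends uv unfolding big_cycle_def ab S by auto
qed

lemma big_cycles_S: "big_cycles S = big_cycle S ` N"
proof -
  have "v \<in> verts S" if v: "v \<in> N" for v
  proof -
    obtain l where l: "l \<in> {i..j}" "v \<in> ends T l" using v unfolding N_def by blast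
    then have ln: "l \<le> n" "l \<in> {1..n}" using ij by auto
    have "l = A l \<or> l = B l \<or> l = C l" using diag_ABC[OF ln(2,1)] diag_tri[OF ln(2)] by blast
    then have "{A l, B l, C l} \<inter> {i..j} \<noteq> {}" "v \<in> ends T (A l) \<union> ends T (B l) \<union> ends T (C l)"
      using l by auto
    then show ?thesis using cw_triangle_ABC[OF ln(1)] unfolding subpolygon_def by auto
  qed
  moreover have "(\<exists>d\<in>diags S. v \<in> ends S d) \<longleftrightarrow> v \<in> N" for v
    unfolding N_def by (simp add: subpolygon_def)
  ultimately show ?thesis unfolding big_cycles_def by blast
qed

text \<open>No cancellation occurs: a triangle cycle contains angles at three vertices, whereas the
  angles in a big cycle all sit at one vertex.\<close>

lemma potential_S:
  "potential S c \<noteq> 0 \<longleftrightarrow> c \<in> triangle_cycles S \<or> c \<in> big_cycles S"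
proof -
  have "False" if c: "c \<in> triangle_cycles S" "c \<in> big_cycles S"
  proof -
    obtain t where t: "t \<in> I" "c = angle ` ({t} \<times> tri t)"
      using c(1) unfolding triangle_cycles_S by blast
    obtain v where v: "v \<in> N" "c = big_cycle S v"
      using c(2) unfolding big_cycles_S by blast
    have "u = v" if "u \<in> tri t" for u
      using angle_in_big_cycle[OF t(1) that v(1)] that t(2) v(2) by blast
    then show False using distinct[OF I_le[OF t(1)]] unfolding tri_def by auto
  qed
  then show ?thesis unfolding potential_def by auto
qed

lemma is_cut_S:
  "is_cut (extended_quiver S) (potential S) X \<longleftrightarrow> X \<subseteq> extended_quiver S \<and>
    (\<forall>t\<in>I. \<exists>!\<alpha>. \<alpha> \<in> angle ` ({t} \<times> tri t) \<and> \<alpha> \<in> X) \<and>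
    (\<forall>v\<in>N. \<exists>!\<alpha>. \<alpha> \<in> big_cycle S v \<and> \<alpha> \<in> X)"
proof -
  have "(\<forall>c. potential S c \<noteq> 0 \<longrightarrow> P c) \<longleftrightarrow>
      (\<forall>t\<in>I. P (angle ` ({t} \<times> tri t))) \<and> (\<forall>v\<in>N. P (big_cycle S v))" for P
    unfolding potential_S triangle_cycles_S big_cycles_S by blast
  then show ?thesis unfolding is_cut_def by simp
qed

lemma cut_conditions:
  assumes G: "G \<subseteq> Sigma I tri"
  shows "t \<in> I \<Longrightarrow> (\<exists>!\<alpha>. \<alpha> \<in> angle ` ({t} \<times> tri t) \<and> \<alpha> \<in> angle ` G) \<longleftrightarrow> (\<exists>!u. (t, u) \<in> G)"
    and "v \<in> N \<Longrightarrow> (\<exists>!\<alpha>. \<alpha> \<in> big_cycle S v \<and> \<alpha> \<in> angle ` G) \<longleftrightarrow> (\<exists>!t. (t, v) \<in> G)"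
proof -
  have ex1: "(\<exists>!\<alpha>. \<alpha> \<in> angle ` H) \<longleftrightarrow> (\<exists>!\<beta>. \<beta> \<in> H)" if "H \<subseteq> Sigma I tri" for H
    by (rule ex1_image_iff) (rule inj_on_subset[OF inj_angle that])
  {
    assume t: "t \<in> I"
    have "angle ` ({t} \<times> tri t) \<inter> angle ` G = angle ` (({t} \<times> tri t) \<inter> G)"
      using inj_on_image_Int[OF inj_angle, of "{t} \<times> tri t" G] t G by blast
    then have "(\<exists>!\<alpha>. \<alpha> \<in> angle ` ({t} \<times> tri t) \<and> \<alpha> \<in> angle ` G) \<longleftrightarrow>
        (\<exists>!\<alpha>. \<alpha> \<in> angle ` (({t} \<times> tri t) \<inter> G))"
      unfolding Int_iff[symmetric] by simp
    also have "\<dots> \<longleftrightarrow> (\<exists>!\<beta>. \<beta> \<in> ({t} \<times> tri t) \<inter> G)" using G by (intro ex1) blast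
    also have "({t} \<times> tri t) \<inter> G = Pair t ` {u. (t, u) \<in> G}" using G by auto
    also have "(\<exists>!\<beta>. \<beta> \<in> Pair t ` {u. (t, u) \<in> G}) \<longleftrightarrow> (\<exists>!u. u \<in> {u. (t, u) \<in> G})"
      by (rule ex1_image_iff) (simp add: inj_on_def)
    also have "\<dots> \<longleftrightarrow> (\<exists>!u. (t, u) \<in> G)" by simp
    finally show "(\<exists>!\<alpha>. \<alpha> \<in> angle ` ({t} \<times> tri t) \<and> \<alpha> \<in> angle ` G) \<longleftrightarrow> (\<exists>!u. (t, u) \<in> G)" .
  }
  assume v: "v \<in> N"
  have "big_cycle S v \<inter> angle ` G = angle ` {\<beta> \<in> G. snd \<beta> = v}"
    using angle_in_big_cycle[OF _ _ v] G by force
  then have "(\<exists>!\<alpha>. \<alpha> \<in> big_cycle S v \<and> \<alpha> \<in> angle ` G) \<longleftrightarrow>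
      (\<exists>!\<alpha>. \<alpha> \<in> angle ` {\<beta> \<in> G. snd \<beta> = v})"
    unfolding Int_iff[symmetric] by simp
  also have "\<dots> \<longleftrightarrow> (\<exists>!\<beta>. \<beta> \<in> {\<beta> \<in> G. snd \<beta> = v})" using G by (intro ex1) blast
  also have "{\<beta> \<in> G. snd \<beta> = v} = (\<lambda>t. (t, v)) ` {t. (t, v) \<in> G}" by auto
  also have "(\<exists>!\<beta>. \<beta> \<in> (\<lambda>t. (t, v)) ` {t. (t, v) \<in> G}) \<longleftrightarrow> (\<exists>!t. t \<in> {t. (t, v) \<in> G})"
    by (rule ex1_image_iff) (simp add: inj_on_def)
  also have "\<dots> \<longleftrightarrow> (\<exists>!t. (t, v) \<in> G)" by simp
  finally show "(\<exists>!\<alpha>. \<alpha> \<in> big_cycle S v \<and> \<alpha> \<in> angle ` G) \<longleftrightarrow> (\<exists>!t. (t, v) \<in> G)" .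
qed

lemma card_choice:
  assumes G: "G \<subseteq> Sigma I tri" "\<And>t. t \<in> I \<Longrightarrow> \<exists>!u. (t, u) \<in> G"
  shows "card G = Suc (Suc (j - i))" "finite G"
proof -
  have "fst ` G = I"
  proof (intro equalityI subsetI)
    fix t assume "t \<in> I"
    then obtain u where "(t, u) \<in> G" using G(2) by blast
    then show "t \<in> fst ` G" by force
  qed (use G(1) in auto)
  moreover have "inj_on fst G"
  proof (rule inj_onI)
    fix \<alpha> \<beta> assume "\<alpha> \<in> G" "\<beta> \<in> G" "fst \<alpha> = fst \<beta>"
    moreover obtain t u t' u' where "\<alpha> = (t, u)" "\<beta> = (t', u')" by fastforce
    ultimately have "(t, u) \<in> G" "(t, u') \<in> G" "t' = t" "t \<in> I" using G(1) by auto
    then show "\<alpha> = \<beta>" using G(2)[of t] \<open>\<alpha> = (t, u)\<close> \<open>\<beta> = (t', u')\<close> by blast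
  qed
  moreover have "card I = Suc (Suc (j - i))" using ij by simp
  ultimately show "card G = Suc (Suc (j - i))" "finite G"
    by (metis card_image, metis finite_atLeastAtMost finite_image_iff)
qed

text \<open>
  There are as many triangles as vertices on diagonals, so choosing each of these vertices once
  leaves no choice for the two remaining vertices.
\<close>

lemma choice_perfect:
  assumes G: "G \<subseteq> Sigma I tri" "\<And>t. t \<in> I \<Longrightarrow> \<exists>!u. (t, u) \<in> G"
    and v: "\<And>v. v \<in> N \<Longrightarrow> \<exists>!t. (t, v) \<in> G"
  shows "snd ` G \<subseteq> N"
proof -
  let ?H = "{\<beta> \<in> G. snd \<beta> \<in> N}"
  have "snd ` ?H = N"
  proof (intro equalityI subsetI)
    fix w assume "w \<in> N"
    moreover from this obtain t where "(t, w) \<in> G" using v by blast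
    ultimately show "w \<in> snd ` ?H" by force
  qed auto
  moreover have inj: "inj_on snd ?H"
  proof (rule inj_onI)
    fix \<alpha> \<beta> assume "\<alpha> \<in> ?H" "\<beta> \<in> ?H" "snd \<alpha> = snd \<beta>"
    moreover obtain t u t' u' where "\<alpha> = (t, u)" "\<beta> = (t', u')" by fastforce
    ultimately have "(t, u) \<in> G" "(t', u) \<in> G" "u' = u" "u \<in> N" by auto
    then show "\<alpha> = \<beta>" using v[of u] \<open>\<alpha> = (t, u)\<close> \<open>\<beta> = (t', u')\<close> by blast
  qed
  ultimately have "card ?H = card N" using card_image[OF inj] by simp
  then have "card ?H = card G" using card_N card_choice(1)[OF G] by simp
  then have "?H = G" using card_choice[OF G] by (intro card_subset_eq) auto
  then show ?thesis by auto
qed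

text \<open>
  A cut contains an arrow of each triangle, so its size forbids external arrows in a minimal cut.
\<close>

lemma minimal_cuts_S: "minimal_cuts S = (`) angle ` perfect_matchings tri I N"
proof (intro equalityI subsetI)
  have size: "card (diags S) + 1 = Suc (Suc (j - i))" using ij by (simp add: subpolygon_def)
  {
    fix X assume "X \<in> minimal_cuts S"
    then have X: "\<forall>t\<in>I. \<exists>!\<alpha>. \<alpha> \<in> angle ` ({t} \<times> tri t) \<and> \<alpha> \<in> X"
      "\<forall>v\<in>N. \<exists>!\<alpha>. \<alpha> \<in> big_cycle S v \<and> \<alpha> \<in> X" and card: "card X = Suc (Suc (j - i))"
      unfolding minimal_cuts_def is_cut_S size by simp_all
    define G where "G = {\<beta> \<in> Sigma I tri. angle \<beta> \<in> X}"
    have G: "G \<subseteq> Sigma I tri" unfolding G_def by blast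
    have one: "\<exists>!u. (t, u) \<in> G" if t: "t \<in> I" for t
    proof -
      have eq: "\<alpha> \<in> angle ` ({t} \<times> tri t) \<and> \<alpha> \<in> X \<longleftrightarrow>
          \<alpha> \<in> angle ` ({t} \<times> tri t) \<and> \<alpha> \<in> angle ` G" for \<alpha>
        using t unfolding G_def by auto
      have "\<exists>!\<alpha>. \<alpha> \<in> angle ` ({t} \<times> tri t) \<and> \<alpha> \<in> angle ` G"
        using bspec[OF X(1) t] unfolding eq .
      then show ?thesis by (rule iffD1[OF cut_conditions(1)[OF G t]])
    qed
    have "card (angle ` G) = card X"
      using card_choice(1)[OF G one] card inj_on_subset[OF inj_angle G] by (simp add: card_image)
    moreover have "angle ` G \<subseteq> X" unfolding G_def by blast
    \<comment> \<open>An infinite set would have cardinality 0.\<close>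
    moreover have "finite X" using card by (metis card.infinite nat.simps(3))
    ultimately have XG: "X = angle ` G" using card_subset_eq by metis
    have "\<exists>!t. (t, v) \<in> G" if "v \<in> N" for v
      by (rule iffD1[OF cut_conditions(2)[OF G that]]) (use X(2) that in \<open>simp add: XG\<close>)
    then have "G \<in> perfect_matchings tri I N"
      using G one choice_perfect[OF G one] unfolding perfect_matchings_def by simp
    then show "X \<in> (`) angle ` perfect_matchings tri I N" using XG by blast
  }
  fix X assume "X \<in> (`) angle ` perfect_matchings tri I N"
  then obtain G where X: "X = angle ` G" and "G \<in> perfect_matchings tri I N" by blast
  note G = perfect_matchingsD[OF this(2)]
  have "X \<subseteq> extended_quiver S" using G(1) angle_extended unfolding X by auto
  moreover have "card X = Suc (Suc (j - i))"
    using card_choice(1)[OF G(1,2)] inj_on_subset[OF inj_angle G(1)] by (simp add: X card_image)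
  ultimately show "X \<in> minimal_cuts S"
    unfolding minimal_cuts_def is_cut_S size mem_Collect_eq
    using iffD2[OF cut_conditions(1)[OF G(1)] G(2)] iffD2[OF cut_conditions(2)[OF G(1)] G(3)]
    unfolding X by simp
qed

lemma sum_minimal_cuts:
  fixes z :: "nat \<Rightarrow> 'k::field_char_0"
  shows "(\<Sum>X\<in>minimal_cuts S. \<Prod>(a, b)\<in>X. z (third_side T a b)) = matching_sum z i (Suc (j - i)) (r j)"
proof -
  have sub: "G \<subseteq> Sigma I tri" if "G \<in> perfect_matchings tri I N" for G
    using perfect_matchingsD(1)[OF that] .
  have inj: "inj_on ((`) angle) (perfect_matchings tri I N)"
    using sub inj_angle by (intro inj_onI) (metis inj_on_image_eq_iff)
  have "(\<Sum>X\<in>minimal_cuts S. \<Prod>(a, b)\<in>X. z (third_side T a b)) =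
      (\<Sum>G\<in>perfect_matchings tri I N. \<Prod>(a, b)\<in>angle ` G. z (third_side T a b))"
    unfolding minimal_cuts_S by (subst sum.reindex[OF inj]) simp
  also have "\<dots> = (\<Sum>G\<in>perfect_matchings tri I N. \<Prod>(t, u)\<in>G. z (opp t u))"
  proof (intro sum.cong refl)
    fix G assume G: "G \<in> perfect_matchings tri I N"
    have "(\<Prod>(a, b)\<in>angle ` G. z (third_side T a b)) =
        (\<Prod>\<beta>\<in>G. case angle \<beta> of (a, b) \<Rightarrow> z (third_side T a b))"
      by (subst prod.reindex[OF inj_on_subset[OF inj_angle sub[OF G]]]) simp
    also have "\<dots> = (\<Prod>(t, u)\<in>G. z (opp t u))"
    proof (intro prod.cong refl)
      fix \<beta> assume "\<beta> \<in> G"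
      then obtain t u where b: "\<beta> = (t, u)" "t \<in> I" using sub[OF G] by auto
      then show "(case angle \<beta> of (a, b) \<Rightarrow> z (third_side T a b)) = (case \<beta> of (t, u) \<Rightarrow> z (opp t u))"
        using angle_third_side[OF I_le[OF b(2)], of u] by (simp split: prod.splits)
    qed
    finally show "(\<Prod>(a, b)\<in>angle ` G. z (third_side T a b)) = (\<Prod>(t, u)\<in>G. z (opp t u))" .
  qed
  also have "\<dots> = matching_sum z i (Suc (j - i)) (r j)"
  proof -
    have "I = {i - 1..<i + Suc (j - i)}" using ij by auto
    then show ?thesis
      unfolding N_inner using ij by (simp only:) (intro sum_matchings, auto simp: last_verts_def tri_def)
  qed
  finally show ?thesis .
qed

end

theorem corollary4p7:
  fixes n :: nat and T :: labelled_polygon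
    and F :: "'k::field_char_0 set" and x :: "nat \<Rightarrow> 'k" and i j :: nat
  assumes "n \<ge> 1"
    and "triangulated_polygon T" and "card (verts T) = n + 3"
    and "diags T = {1..n}" and "sides T = {n+1..2*n+3}"
    and "acyclic (diagonal_quiver T)"
    and "diagonal_quiver T \<union> (diagonal_quiver T)\<inverse> =
           {(a, b). a \<in> {1..n} \<and> b \<in> {1..n} \<and> (b = a + 1 \<or> a = b + 1)}"
    and "free_generating_set F (2*n+3) x"
    and "1 \<le> i" and "i \<le> j" and "j \<le> n"
  shows "cluster_numerator n (2*n+3) x (quiver_of_arrows (ice_quiver T)) i j =
           (\<Sum>C\<in>minimal_cuts (subpolygon T {i..j}). \<Prod>(a, b)\<in>C. x (third_side T a b))"
proof -
  interpret path_polygon n T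
    using assms(1,2,4,5,7) by unfold_locales
  interpret algebraically_independent "2 * n + 3" x
    using assms(8) by (rule free_generating_set_independent)
  obtain p q r where path: "triangle_path n (2 * n + 3) (verts T) (ends T) p q r"
    and triangles: "\<And>a b c. triangle a b c \<Longrightarrow> \<exists>t\<le>n. {a, b, c} = {p t, q t, r t}"
    using ex_triangle_path by blast
  interpret tp: triangle_path n "2 * n + 3" "verts T" "ends T" p q r by (rule path)
  obtain w where w: "\<forall>a\<in>{1..2 * n + 3}. \<forall>u v. ends T a = {u, v} \<longrightarrow> len w u v = x a"
    using tp.ex_vectors[of x] indet_nonzero by blast
  interpret ll: lambda_lengths n "2 * n + 3" "verts T" "ends T" p q r x w
    by unfold_locales (use w in blast)
  interpret sc: subpolygon_cuts n T p q r i j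
    by unfold_locales (use triangles assms(9-11) in blast)+
  show ?thesis
    unfolding ice_quiver_eq ll.cluster_numerator_eq[OF assms(9-11)] sc.sum_minimal_cuts ..
qed

end
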